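(* Flat fronts in hyperbolic space are those $\Omega$-surfaces with a pair of isothermic sphere congruences $s^+,s^-$ that each touch a fixed sphere ($s^+$ touches a fixed sphere $q^+$ and $s^-$ touches a fixed sphere $q^-$), where the fixed spheres do not span a contact element, i.e. $(q^+,q^-)\neq0$. (Here a flat front is identified with its Legendre lift.) The two fixed spheres $q^\pm$ yield the two orientations of the infinity sphere of the hyperbolic ambient space of the flat front; this determines the point sphere complex, hence the flat front, up to parallel transformation.
   Context: Lie sphere geometry. $\mathbb{R}^{4,2}$ is $\mathbb{R}^6$ with an inner product $(\cdot,\cdot)$ of signature $(4,2)$, and $|x|^2:=(x,x)$. An (oriented) sphere is a null line in $\mathbb{R}^{4,2}$, usually represented by a non-zero null (light-like) vector spanning it. Two spheres $s,s'$ touch (are in oriented contact) if $(s,s')=0$. A contact element is a null 2-plane in $\mathbb{R}^{4,2}$; two fixed spheres $q^+,q^-$ are said not to span a contact element if $(q^+,q^-)\neq0$. A sphere congruence $s$ (a smooth map from a surface $M^2$ into the spheres) touches a fixed sphere $q$ if $(s,q)=0$ at every point. A Legendre map is a smooth map $f$ from a surface $M^2$ into the null 2-planes with $(ds,s')=0$ for all sections $s,s'$ of $f$ (contact condition), and regular: at each point, if $d_Xs\in f$ for all sections $s$ of $f$, then $X=0$. It envelops a sphere congruence $s$ if $s\in f$ pointwise. A curvature sphere at a point is a null line in $f$ spanned by the value of a section $s_i$ of $f$ with $d_Xs_i\in f$ for some tangent vector $X\neq0$ (a curvature direction). Umbilic-free means that there are two distinct curvature spheres $s_1,s_2$ at every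 point; local coordinates $(u,v)$ are curvature line coordinates if $s_{1u},s_{2v}\in f$. Two sphere congruences $s^\pm$ with $f=\mathrm{span}\{s^+,s^-\}$ separate the curvature spheres harmonically if the cross ratio of the pairs $s^+,s^-$ and $s_1,s_2$ on the projective line given by $f$ equals $-1$ (equivalently, $s^\pm=s_1\pm s_2$ for suitable choices of representatives). A sphere congruence $s$ enveloped by $f$ is isothermic if, locally, in curvature line coordinates $(u,v)$ of $f$, it admits a Moutard lift, i.e. a representative $s$ with $s_{uv}\parallel s$. An $\Omega$-surface is an (umbilic-free) Legendre map that envelops a pair of isothermic sphere congruences $s^\pm$ separating the curvature spheres harmonically; this is the pair of isothermic sphere congruences referred to in the claim. Hyperbolic geometry. Given an orthogonal decomposition $\mathbb{R}^{4,2}=\mathbb{R}^{1,1}\oplus\mathbb{R}^{3,1}$ and an orthonormal basis $(\mathfrak{p},\mathfrak{q})$ of $\mathbb{R}^{1,1}$ with $|\mathfrak{p}|^2=-1$, $|\mathfrak{q}|^2=1$, the vector $\mathfrak{p}$ is called the point sphere complex: a sphere $s$ is a point sphere if $(s,\mathfrak{p})=0$. Each of the two sheets of $\{y\in\mathbb{R}^{3,1}:|y|^2=-1\}$ is a hyperbolic space $H^3$; a point $y$ is identified with the point sphere $\mathfrak{q}+y$. The infinity sphere of these hyperbolic spaces, with its two orientations, is given by the two spheres $\mathfrak{p}+\mathfrak{q}$ and $\mathfrak{p}-\mathfrak{q}$. Conversely, given two spheres $q^\pm$ with $(q^+,q^-)\neq0$, one may normalize $(q^+,q^-)=-2$ and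 set $\mathfrak{p}=\frac12(q^++q^-)$, $\mathfrak{q}=\frac12(q^+-q^-)$, so that $\mathbb{R}^{3,1}=\{q^+,q^-\}^\perp$; a different normalization $e^{\pm t}q^\pm$, $t\in\mathbb{R}$, leads to a parallel front. Let $\mathfrak{f}:M^2\to H^3$ be a smooth map with unit normal field $\mathfrak{t}:M^2\to S^{2,1}=\{y\in\mathbb{R}^{3,1}:|y|^2=1\}$, $(\mathfrak{t},\mathfrak{f})=0$, $(\mathfrak{t},d\mathfrak{f})=0$. It is a front if its Legendre lift $f:=\mathrm{span}\{\mathfrak{q}+\mathfrak{f},\mathfrak{p}+\mathfrak{t}\}$ is a (regular) Legendre map. Its parallel fronts are $\cosh t\,\mathfrak{f}+\sinh t\,\mathfrak{t}$, $t\in\mathbb{R}$, with unit normal fields $\sinh t\,\mathfrak{f}+\cosh t\,\mathfrak{t}$. The front is flat if it and its parallel fronts have vanishing intrinsic Gauss curvature wherever they immerse (equivalently, the product of the principal curvatures there is $\kappa_1\kappa_2=1$). Flat fronts are considered away from umbilics. *)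

theory Defs
  imports "HOL-Analysis.Analysis"
begin

section \<open>Smooth maps and surfaces\<close>

fun k_smooth_on :: "nat \<Rightarrow> 'a::real_normed_vector set \<Rightarrow> ('a \<Rightarrow> 'b::real_normed_vector) \<Rightarrow> bool" where
  "k_smooth_on 0 S g \<longleftrightarrow> continuous_on S g"
| "k_smooth_on (Suc k) S g \<longleftrightarrow>
     (\<forall>z\<in>S. g differentiable (at z)) \<and>
     (\<forall>w. k_smooth_on k S (\<lambda>z. frechet_derivative g (at z) w))"

text \<open>Only used for open \<open>S\<close>.\<close>

definition smooth_on :: "'a::real_normed_vector set \<Rightarrow> ('a \<Rightarrow> 'b::real_normed_vector) \<Rightarrow> bool" where
  "smooth_on S g \<longleftrightarrow> (\<forall>k. k_smooth_on k S g)"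

text \<open>A chart is a pair of a domain and a coordinate map; the coordinates are
  \<open>(u, v) :: real \<times> real\<close>. The map is only relevant on the domain.\<close>

type_synonym 'm chart = "'m set \<times> ('m \<Rightarrow> real \<times> real)"

abbreviation dom_c :: "'m chart \<Rightarrow> 'm set" where "dom_c c \<equiv> fst c"
abbreviation map_c :: "'m chart \<Rightarrow> 'm \<Rightarrow> real \<times> real" where "map_c c \<equiv> snd c"

definition param :: "'m chart \<Rightarrow> real \<times> real \<Rightarrow> 'm" where
  "param c = inv_into (dom_c c) (map_c c)"

definition is_chart :: "'m::topological_space chart \<Rightarrow> bool" where
  "is_chart c \<longleftrightarrow> open (dom_c c) \<and> open (map_c c ` dom_c c) \<and>
     homeomorphism (dom_c c) (map_c c ` dom_c c) (map_c c) (param c)"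

definition smooth_change :: "'m chart \<Rightarrow> 'm chart \<Rightarrow> bool" where
  "smooth_change c d \<longleftrightarrow> smooth_on (map_c c ` (dom_c c \<inter> dom_c d)) (map_c d \<circ> param c)"

definition points :: "'m chart set \<Rightarrow> 'm set" where
  "points A = (\<Union>c\<in>A. dom_c c)"

text \<open>A (connected) smooth surface, given by an atlas; the Hausdorff property and second
  countability come from the type classes.\<close>

definition surface :: "'m::{t2_space,second_countable_topology} chart set \<Rightarrow> bool" where
  "surface A \<longleftrightarrow> (\<forall>c\<in>A. is_chart c) \<and> (\<forall>c\<in>A. \<forall>d\<in>A. smooth_change c d) \<and> connected (points A)"

text \<open>The charts of the maximal atlas, that is, arbitrary local coordinates.\<close>

definition local_coords :: "'m::topological_space chart set \<Rightarrow> 'm chart \<Rightarrow> bool" where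
  "local_coords A c \<longleftrightarrow> is_chart c \<and> dom_c c \<subseteq> points A \<and>
     (\<forall>d\<in>A. smooth_change c d \<and> smooth_change d c)"

definition smooth_map :: "'m chart set \<Rightarrow> 'm set \<Rightarrow> ('m \<Rightarrow> 'b::real_normed_vector) \<Rightarrow> bool" where
  "smooth_map A V g \<longleftrightarrow> (\<forall>c\<in>A. smooth_on (map_c c ` (dom_c c \<inter> V)) (g \<circ> param c))"

text \<open>The derivative \<open>d\<^sub>X g\<close> at \<open>x\<close>, where the tangent vector \<open>X\<close> has the
  coordinate representation \<open>\<xi>\<close> in the chart \<open>c\<close>.\<close>

definition dmap :: "'m chart \<Rightarrow> ('m \<Rightarrow> 'b::real_normed_vector) \<Rightarrow> 'm \<Rightarrow> real \<times> real \<Rightarrow> 'b" where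
  "dmap c g x \<xi> = frechet_derivative (g \<circ> param c) (at (map_c c x)) \<xi>"

definition D\<^sub>u :: "(real \<times> real \<Rightarrow> 'b::real_normed_vector) \<Rightarrow> real \<times> real \<Rightarrow> 'b" where
  "D\<^sub>u h z = frechet_derivative h (at z) (1, 0)"

definition D\<^sub>v :: "(real \<times> real \<Rightarrow> 'b::real_normed_vector) \<Rightarrow> real \<times> real \<Rightarrow> 'b" where
  "D\<^sub>v h z = frechet_derivative h (at z) (0, 1)"


section \<open>Lie sphere geometry\<close>

type_synonym r42 = "(real^4) \<times> (real^2)"

definition lip :: "r42 \<Rightarrow> r42 \<Rightarrow> real" where
  "lip x y = fst x \<bullet> fst y - snd x \<bullet> snd y"

definition sphere_vector :: "r42 \<Rightarrow> bool" where
  "sphere_vector x \<longleftrightarrow> x \<noteq> 0 \<and> lip x x = 0"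

definition null_line :: "r42 set \<Rightarrow> bool" where
  "null_line L \<longleftrightarrow> subspace L \<and> dim L = 1 \<and> (\<forall>x\<in>L. \<forall>y\<in>L. lip x y = 0)"

definition contact_element :: "r42 set \<Rightarrow> bool" where
  "contact_element P \<longleftrightarrow> subspace P \<and> dim P = 2 \<and> (\<forall>x\<in>P. \<forall>y\<in>P. lip x y = 0)"

definition local_section ::
  "'m::topological_space chart set \<Rightarrow> ('m \<Rightarrow> r42 set) \<Rightarrow> 'm set \<Rightarrow> ('m \<Rightarrow> r42) \<Rightarrow> bool" where
  "local_section A f V \<sigma> \<longleftrightarrow>
     open V \<and> V \<subseteq> points A \<and> smooth_map A V \<sigma> \<and> (\<forall>x\<in>V. \<sigma> x \<in> f x)"

text \<open>Maps into null lines or null planes are smooth if they are locally spanned by smooth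
  sections.\<close>

definition sphere_congruence :: "'m::topological_space chart set \<Rightarrow> ('m \<Rightarrow> r42 set) \<Rightarrow> bool" where
  "sphere_congruence A s \<longleftrightarrow> (\<forall>x\<in>points A. null_line (s x)) \<and>
     (\<forall>x\<in>points A. \<exists>V \<sigma>. x \<in> V \<and> local_section A s V \<sigma> \<and> (\<forall>y\<in>V. s y = span {\<sigma> y}))"

definition contact_congruence :: "'m::topological_space chart set \<Rightarrow> ('m \<Rightarrow> r42 set) \<Rightarrow> bool" where
  "contact_congruence A f \<longleftrightarrow> (\<forall>x\<in>points A. contact_element (f x)) \<and>
     (\<forall>x\<in>points A. \<exists>V \<sigma> \<tau>. x \<in> V \<and> local_section A f V \<sigma> \<and> local_section A f V \<tau> \<and>
        (\<forall>y\<in>V. f y = span {\<sigma> y, \<tau> y}))"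

definition contact_condition :: "'m::topological_space chart set \<Rightarrow> ('m \<Rightarrow> r42 set) \<Rightarrow> bool" where
  "contact_condition A f \<longleftrightarrow>
     (\<forall>V \<sigma> \<tau>. local_section A f V \<sigma> \<longrightarrow> local_section A f V \<tau> \<longrightarrow>
        (\<forall>x\<in>V. \<forall>c\<in>A. x \<in> dom_c c \<longrightarrow> (\<forall>\<xi>. lip (dmap c \<sigma> x \<xi>) (\<tau> x) = 0)))"

definition regular :: "'m::topological_space chart set \<Rightarrow> ('m \<Rightarrow> r42 set) \<Rightarrow> bool" where
  "regular A f \<longleftrightarrow>
     (\<forall>c\<in>A. \<forall>x\<in>dom_c c. \<forall>\<xi>.
        (\<forall>V \<sigma>. x \<in> V \<longrightarrow> local_section A f V \<sigma> \<longrightarrow> dmap c \<sigma> x \<xi> \<in> f x) \<longrightarrow> \<xi> = 0)"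

definition legendre_map :: "'m::topological_space chart set \<Rightarrow> ('m \<Rightarrow> r42 set) \<Rightarrow> bool" where
  "legendre_map A f \<longleftrightarrow> contact_congruence A f \<and> contact_condition A f \<and> regular A f"

definition envelops :: "'m chart set \<Rightarrow> ('m \<Rightarrow> r42 set) \<Rightarrow> ('m \<Rightarrow> r42 set) \<Rightarrow> bool" where
  "envelops A f s \<longleftrightarrow> (\<forall>x\<in>points A. s x \<subseteq> f x)"

definition touches_fixed :: "'m chart set \<Rightarrow> ('m \<Rightarrow> r42 set) \<Rightarrow> r42 \<Rightarrow> bool" where
  "touches_fixed A s q \<longleftrightarrow> (\<forall>x\<in>points A. \<forall>y\<in>s x. lip y q = 0)"

definition curvature_sphere ::
  "'m::topological_space chart set \<Rightarrow> ('m \<Rightarrow> r42 set) \<Rightarrow> 'm \<Rightarrow> r42 set \<Rightarrow> bool" where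
  "curvature_sphere A f x S \<longleftrightarrow>
     (\<exists>V \<sigma> c \<xi>. x \<in> V \<and> local_section A f V \<sigma> \<and> \<sigma> x \<noteq> 0 \<and> S = span {\<sigma> x} \<and>
        c \<in> A \<and> x \<in> dom_c c \<and> \<xi> \<noteq> 0 \<and> dmap c \<sigma> x \<xi> \<in> f x)"

definition umbilic_free :: "'m::topological_space chart set \<Rightarrow> ('m \<Rightarrow> r42 set) \<Rightarrow> bool" where
  "umbilic_free A f \<longleftrightarrow>
     (\<forall>x\<in>points A. \<exists>S\<^sub>1 S\<^sub>2. curvature_sphere A f x S\<^sub>1 \<and> curvature_sphere A f x S\<^sub>2 \<and> S\<^sub>1 \<noteq> S\<^sub>2)"

definition curvature_line_coords ::
  "'m::topological_space chart set \<Rightarrow> ('m \<Rightarrow> r42 set) \<Rightarrow> 'm chart \<Rightarrow> bool" where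
  "curvature_line_coords A f c \<longleftrightarrow> local_coords A c \<and>
     (\<exists>\<sigma>\<^sub>1 \<sigma>\<^sub>2. local_section A f (dom_c c) \<sigma>\<^sub>1 \<and> local_section A f (dom_c c) \<sigma>\<^sub>2 \<and>
        (\<forall>x\<in>dom_c c.
           \<sigma>\<^sub>1 x \<noteq> 0 \<and> \<sigma>\<^sub>2 x \<noteq> 0 \<and> span {\<sigma>\<^sub>1 x} \<noteq> span {\<sigma>\<^sub>2 x} \<and>
           curvature_sphere A f x (span {\<sigma>\<^sub>1 x}) \<and> curvature_sphere A f x (span {\<sigma>\<^sub>2 x}) \<and>
           D\<^sub>u (\<sigma>\<^sub>1 \<circ> param c) (map_c c x) \<in> f x \<and> D\<^sub>v (\<sigma>\<^sub>2 \<circ> param c) (map_c c x) \<in> f x))"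

text \<open>The cross ratio of four points of a projective line, in the convention
  \<open>(A - C)(B - D) / ((A - D)(B - C))\<close> for affine coordinates; with respect to the basis \<open>x, y\<close>
  the points have homogeneous coordinates \<open>(1,0)\<close>, \<open>(0,1)\<close>, \<open>(a,b)\<close>, \<open>(c,d)\<close>.\<close>

definition has_cross_ratio :: "r42 set \<Rightarrow> r42 set \<Rightarrow> r42 set \<Rightarrow> r42 set \<Rightarrow> real \<Rightarrow> bool" where
  "has_cross_ratio A B C D r \<longleftrightarrow>
     (\<exists>x y a b c d. x \<noteq> y \<and> independent {x, y} \<and> A = span {x} \<and> B = span {y} \<and>
        C = span {a *\<^sub>R x + b *\<^sub>R y} \<and> D = span {c *\<^sub>R x + d *\<^sub>R y} \<and>
        a * d \<noteq> 0 \<and> r = (b * c) / (a * d))"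

definition separates_harmonically ::
  "'m::topological_space chart set \<Rightarrow> ('m \<Rightarrow> r42 set) \<Rightarrow> ('m \<Rightarrow> r42 set) \<Rightarrow> ('m \<Rightarrow> r42 set) \<Rightarrow> bool" where
  "separates_harmonically A f s\<^sub>p s\<^sub>m \<longleftrightarrow>
     (\<forall>x\<in>points A. f x = span (s\<^sub>p x \<union> s\<^sub>m x) \<and>
        (\<forall>S\<^sub>1 S\<^sub>2. curvature_sphere A f x S\<^sub>1 \<longrightarrow> curvature_sphere A f x S\<^sub>2 \<longrightarrow> S\<^sub>1 \<noteq> S\<^sub>2 \<longrightarrow>
           has_cross_ratio (s\<^sub>p x) (s\<^sub>m x) S\<^sub>1 S\<^sub>2 (-1)))"

definition moutard_lift ::
  "'m::topological_space chart set \<Rightarrow> 'm chart \<Rightarrow> ('m \<Rightarrow> r42 set) \<Rightarrow> ('m \<Rightarrow> r42) \<Rightarrow> bool" where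
  "moutard_lift A c s \<sigma> \<longleftrightarrow> local_section A s (dom_c c) \<sigma> \<and>
     (\<forall>x\<in>dom_c c. \<sigma> x \<noteq> 0 \<and>
        (\<exists>r. D\<^sub>v (D\<^sub>u (\<sigma> \<circ> param c)) (map_c c x) = r *\<^sub>R \<sigma> x))"

definition isothermic ::
  "'m::topological_space chart set \<Rightarrow> ('m \<Rightarrow> r42 set) \<Rightarrow> ('m \<Rightarrow> r42 set) \<Rightarrow> bool" where
  "isothermic A f s \<longleftrightarrow> sphere_congruence A s \<and> envelops A f s \<and>
     (\<forall>x\<in>points A. \<exists>c \<sigma>. x \<in> dom_c c \<and> curvature_line_coords A f c \<and> moutard_lift A c s \<sigma>)"

definition omega_pair ::
  "'m::topological_space chart set \<Rightarrow> ('m \<Rightarrow> r42 set) \<Rightarrow> ('m \<Rightarrow> r42 set) \<Rightarrow> ('m \<Rightarrow> r42 set) \<Rightarrow> bool" where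
  "omega_pair A f s\<^sub>p s\<^sub>m \<longleftrightarrow>
     isothermic A f s\<^sub>p \<and> isothermic A f s\<^sub>m \<and> separates_harmonically A f s\<^sub>p s\<^sub>m"

definition omega_surface :: "'m::topological_space chart set \<Rightarrow> ('m \<Rightarrow> r42 set) \<Rightarrow> bool" where
  "omega_surface A f \<longleftrightarrow> legendre_map A f \<and> umbilic_free A f \<and> (\<exists>s\<^sub>p s\<^sub>m. omega_pair A f s\<^sub>p s\<^sub>m)"

text \<open>An \<open>\<Omega>\<close>-surface \<open>f\<close> with a pair of isothermic sphere congruences
  that touch the fixed spheres \<open>q\<^sub>p\<close> and \<open>q\<^sub>m\<close>, which do not span a contact element.\<close>

definition omega_touching ::
  "'m::topological_space chart set \<Rightarrow> ('m \<Rightarrow> r42 set) \<Rightarrow> ('m \<Rightarrow> r42 set) \<Rightarrow> ('m \<Rightarrow> r42 set) \<Rightarrow>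
    r42 \<Rightarrow> r42 \<Rightarrow> bool" where
  "omega_touching A f s\<^sub>p s\<^sub>m q\<^sub>p q\<^sub>m \<longleftrightarrow>
     omega_surface A f \<and> omega_pair A f s\<^sub>p s\<^sub>m \<and>
     sphere_vector q\<^sub>p \<and> sphere_vector q\<^sub>m \<and>
     touches_fixed A s\<^sub>p q\<^sub>p \<and> touches_fixed A s\<^sub>m q\<^sub>m \<and> lip q\<^sub>p q\<^sub>m \<noteq> 0"


section \<open>Fronts in hyperbolic space\<close>

definition hyperbolic_frame :: "r42 \<Rightarrow> r42 \<Rightarrow> bool" where
  "hyperbolic_frame p q \<longleftrightarrow> lip p p = -1 \<and> lip q q = 1 \<and> lip p q = 0"

definition r31 :: "r42 \<Rightarrow> r42 \<Rightarrow> r42 set" where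
  "r31 p q = {y. lip y p = 0 \<and> lip y q = 0}"

text \<open>The two hyperbolic spaces, as the two sheets of the hyperboloid.\<close>

definition hyperbolic_spaces :: "r42 \<Rightarrow> r42 \<Rightarrow> r42 set set" where
  "hyperbolic_spaces p q = components {y \<in> r31 p q. lip y y = -1}"

definition de_sitter :: "r42 \<Rightarrow> r42 \<Rightarrow> r42 set" where
  "de_sitter p q = {y \<in> r31 p q. lip y y = 1}"

definition infinity_spheres :: "r42 \<Rightarrow> r42 \<Rightarrow> r42 set set" where
  "infinity_spheres p q = {span {p + q}, span {p - q}}"

definition legendre_lift ::
  "r42 \<Rightarrow> r42 \<Rightarrow> ('m \<Rightarrow> r42) \<Rightarrow> ('m \<Rightarrow> r42) \<Rightarrow> 'm \<Rightarrow> r42 set" where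
  "legendre_lift p q F T x = span {q + F x, p + T x}"

definition front ::
  "'m::topological_space chart set \<Rightarrow> r42 \<Rightarrow> r42 \<Rightarrow> ('m \<Rightarrow> r42) \<Rightarrow> ('m \<Rightarrow> r42) \<Rightarrow> bool" where
  "front A p q F T \<longleftrightarrow> hyperbolic_frame p q \<and>
     smooth_map A (points A) F \<and> smooth_map A (points A) T \<and>
     (\<exists>H\<in>hyperbolic_spaces p q. \<forall>x\<in>points A. F x \<in> H) \<and>
     (\<forall>x\<in>points A. T x \<in> de_sitter p q \<and> lip (T x) (F x) = 0) \<and>
     (\<forall>c\<in>A. \<forall>x\<in>dom_c c. \<forall>\<xi>. lip (T x) (dmap c F x \<xi>) = 0) \<and>
     legendre_map A (legendre_lift p q F T)"

definition par_front :: "real \<Rightarrow> ('m \<Rightarrow> r42) \<Rightarrow> ('m \<Rightarrow> r42) \<Rightarrow> 'm \<Rightarrow> r42" where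
  "par_front t F T x = cosh t *\<^sub>R F x + sinh t *\<^sub>R T x"

definition par_normal :: "real \<Rightarrow> ('m \<Rightarrow> r42) \<Rightarrow> ('m \<Rightarrow> r42) \<Rightarrow> 'm \<Rightarrow> r42" where
  "par_normal t F T x = sinh t *\<^sub>R F x + cosh t *\<^sub>R T x"

text \<open>Gauss curvature of the metric \<open>E du\<^sup>2 + 2 F du dv + G dv\<^sup>2\<close>, by Brioschi's formula.\<close>

definition metric_curvature ::
  "(real \<times> real \<Rightarrow> real) \<Rightarrow> (real \<times> real \<Rightarrow> real) \<Rightarrow> (real \<times> real \<Rightarrow> real) \<Rightarrow> real \<times> real \<Rightarrow> real" where
  "metric_curvature E F G z =
     (det (vector
        [vector [- D\<^sub>v (D\<^sub>v E) z / 2 + D\<^sub>v (D\<^sub>u F) z - D\<^sub>u (D\<^sub>u G) z / 2, D\<^sub>u E z / 2, D\<^sub>u F z - D\<^sub>v E z / 2],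
         vector [D\<^sub>v F z - D\<^sub>u G z / 2, E z, F z],
         vector [D\<^sub>v G z / 2, F z, G z]] :: real^3^3)
    - det (vector
        [vector [0, D\<^sub>v E z / 2, D\<^sub>u G z / 2],
         vector [D\<^sub>v E z / 2, E z, F z],
         vector [D\<^sub>u G z / 2, F z, G z]] :: real^3^3))
    / (E z * G z - (F z)\<^sup>2)\<^sup>2"

definition intrinsic_curvature :: "'m chart \<Rightarrow> ('m \<Rightarrow> r42) \<Rightarrow> 'm \<Rightarrow> real" where
  "intrinsic_curvature c g x =
     (let h = g \<circ> param c in
      metric_curvature
        (\<lambda>z. lip (D\<^sub>u h z) (D\<^sub>u h z)) (\<lambda>z. lip (D\<^sub>u h z) (D\<^sub>v h z)) (\<lambda>z. lip (D\<^sub>v h z) (D\<^sub>v h z))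
        (map_c c x))"

definition flat_front ::
  "'m::topological_space chart set \<Rightarrow> r42 \<Rightarrow> r42 \<Rightarrow> ('m \<Rightarrow> r42) \<Rightarrow> ('m \<Rightarrow> r42) \<Rightarrow> bool" where
  "flat_front A p q F T \<longleftrightarrow> front A p q F T \<and> umbilic_free A (legendre_lift p q F T) \<and>
     (\<forall>t. \<forall>c\<in>A. \<forall>x\<in>dom_c c. inj (dmap c (par_front t F T) x) \<longrightarrow>
        intrinsic_curvature c (par_front t F T) x = 0)"

definition lift_of_flat_front ::
  "'m::topological_space chart set \<Rightarrow> ('m \<Rightarrow> r42 set) \<Rightarrow> r42 \<Rightarrow> r42 \<Rightarrow> ('m \<Rightarrow> r42) \<Rightarrow> ('m \<Rightarrow> r42) \<Rightarrow> bool" where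
  "lift_of_flat_front A f p q F T \<longleftrightarrow>
     flat_front A p q F T \<and> (\<forall>x\<in>points A. f x = legendre_lift p q F T x)"

text \<open>Two fronts are parallel up to signs. The signs cannot be avoided: null vectors
  represent spheres only up to scale, and replacing \<open>q, F\<close> by \<open>- q, - F\<close> or \<open>p, T\<close> by
  \<open>- p, - T\<close> changes neither the point spheres \<open>span {q + F x}\<close> nor the tangent planes
  \<open>span {p + T x}\<close> nor the infinity spheres up to order.\<close>

definition parallel_related ::
  "'m chart set \<Rightarrow> r42 \<Rightarrow> r42 \<Rightarrow> ('m \<Rightarrow> r42) \<Rightarrow> ('m \<Rightarrow> r42) \<Rightarrow>
    r42 \<Rightarrow> r42 \<Rightarrow> ('m \<Rightarrow> r42) \<Rightarrow> ('m \<Rightarrow> r42) \<Rightarrow> bool" where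
  "parallel_related A p q F T p' q' F' T' \<longleftrightarrow>
     (\<exists>t. \<exists>\<epsilon>\<in>{1, -1}. \<exists>\<delta>\<in>{1, -1}.
        p' = \<delta> *\<^sub>R (cosh t *\<^sub>R p + sinh t *\<^sub>R q) \<and>
        q' = \<epsilon> *\<^sub>R (sinh t *\<^sub>R p + cosh t *\<^sub>R q) \<and>
        (\<forall>x\<in>points A. F' x = \<epsilon> *\<^sub>R par_front t F T x \<and> T' x = \<delta> *\<^sub>R par_normal t F T x))"

end

(* Normalise the two fixed spheres to k = p + q and l = p - q with (k, l) = -2. If every contact element
   f contains a sphere touching k but not l and one touching l but not k, then f = span {k + P, N - l}
   with null maps P, N into the orthogonal complement of k and l with (P, N) = -2, and F = (P + N) / 2,
   T = (P - N) / 2 is the front with its normal. The sphere spanned by a (k + P) + b (N - l) is a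
   curvature sphere iff a dP(X) + b dN(X) = 0 for some nonzero X, and both harmonic separation by k + P, N - l and, via the Gauss
   equation, the flatness of the immersed parallel fronts say a1 b2 + a2 b1 = 0 for the two curvature
   spheres.
   Given flatness, dN = A^2 (w1 e1 - w2 e2) for dP = w1 e1 + w2 e2 in an orthonormal principal frame. By
   the Codazzi equations A w1 and A w2 are closed, hence locally du and dv; in these coordinates
   N_u = A^2 P_u, N_v = - A^2 P_v, so that A (k + P) and (N - l) / A are Moutard lifts.
   Conversely, if f has a sphere congruence s that touches k and is nowhere a curvature sphere, and all
   spheres of f at one point touch k, then the same holds nearby, since the products of k with the
   spheres of f satisfy a linear homogeneous first order system; so k lies in f near this point and is
   a constant section of f, against regularity and the absence of umbilics. *)

theory Submission
  imports Defs
begin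

section \<open>Calculus of smooth maps\<close>

text \<open>Passing to the parallel front at distance t replaces P, N by e^t P, e^-t N and so
  changes neither the curvature spheres nor the condition a1 b2 + a2 b1 = 0. With dP = b w and dN =
  - a w along a curvature direction one has dF = (b - a)/2 w and dT = (b + a)/2 w, so each curvature
  sphere keeps at most one parallel front from immersing. Hence some parallel front immerses at
  every given point, and its flatness there is harmonic separation; this is why flatness speaks of
  the whole parallel family. The factor A is forced by the Codazzi equation: the sign change of dN
  on the second principal direction makes the term d w1 occur twice, which matches the 2 in d (A^2)
  = 2 A dA and leaves d (A w1) = 0. The obstacle in the converse is that P and N do not exist
  beforehand: the sphere touching k must be scaled to have product -2 with l, which requires a
  nonzero product. If the product vanished at a point, both congruences and thus the whole contact
  element would touch l there. Principal data are given only pointwise, by existence statements;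
  their smoothness has to come from explicit formulas.\<close>

lemma k_smooth_on_subset: "k_smooth_on k S g \<Longrightarrow> T \<subseteq> S \<Longrightarrow> k_smooth_on k T g"
  by (induction k arbitrary: g) (auto intro: continuous_on_subset)

text \<open>\<open>frechet_derivative\<close> is defined by choice, so it is enough that both
  functions have the same derivatives at z; this also settles points where neither is
  differentiable.\<close>

lemma frechet_derivative_cong_open:
  assumes "open S" "z \<in> S" "\<And>x. x \<in> S \<Longrightarrow> g x = h x"
  shows "frechet_derivative g (at z) = frechet_derivative h (at z)"
proof -
  have "(g has_derivative L) (at z) \<longleftrightarrow> (h has_derivative L) (at z)" for L
    using has_derivative_transform_within_open[of g L z UNIV S h]
      has_derivative_transform_within_open[of h L z UNIV S g] assms by auto
  then show ?thesis unfolding frechet_derivative_def by simp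
qed

lemma differentiable_cong_open:
  assumes "open S" "z \<in> S" "\<And>x. x \<in> S \<Longrightarrow> g x = h x"
  shows "g differentiable (at z) \<longleftrightarrow> h differentiable (at z)"
  using has_derivative_transform_within_open[of g _ z UNIV S h]
      has_derivative_transform_within_open[of h _ z UNIV S g] assms
  unfolding differentiable_def by auto

lemma k_smooth_on_cong:
  assumes "open S" "\<And>x. x \<in> S \<Longrightarrow> g x = h x"
  shows "k_smooth_on k S g \<longleftrightarrow> k_smooth_on k S h"
  using assms(2)
proof (induction k arbitrary: g h)
  case 0
  then show ?case by (simp cong: continuous_on_cong)
next
  case (Suc k)
  have "k_smooth_on k S (\<lambda>z. frechet_derivative g (at z) w) \<longleftrightarrow>
    k_smooth_on k S (\<lambda>z. frechet_derivative h (at z) w)" for w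
    by (rule Suc.IH) (metis frechet_derivative_cong_open assms(1) Suc.prems)
  then show ?case using differentiable_cong_open[OF assms(1) _ Suc.prems] by auto
qed

lemma k_smooth_on_continuous: "k_smooth_on k S g \<Longrightarrow> continuous_on S g"
  by (cases k) (auto intro!: continuous_at_imp_continuous_on differentiable_imp_continuous_within)

lemma k_smooth_on_Suc_D: "k_smooth_on (Suc k) S g \<Longrightarrow> k_smooth_on k S g"
proof (induction k arbitrary: g)
  case 0
  then show ?case using k_smooth_on_continuous by fastforce
next
  case (Suc k)
  then show ?case by (metis k_smooth_on.simps(2))
qed

lemma k_smooth_on_local:
  assumes "\<And>z. z \<in> S \<Longrightarrow> \<exists>T. open T \<and> z \<in> T \<and> k_smooth_on k T g"
  shows "k_smooth_on k S g"
  using assms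
proof (induction k arbitrary: g)
  case 0
  then show ?case
    by (metis continuous_on_eq_continuous_at continuous_at_imp_continuous_on k_smooth_on.simps(1))
next
  case (Suc k)
  have "k_smooth_on k S (\<lambda>z. frechet_derivative g (at z) w)" for w
    by (rule Suc.IH) (metis Suc.prems k_smooth_on.simps(2))
  then show ?case using Suc.prems by (metis k_smooth_on.simps(2))
qed

text \<open>Replacing \<open>frechet_derivative\<close> by a formula g' turns each closure property
  below into an induction on k in which the rule of differentiation supplies g'.\<close>

lemma k_smooth_on_SucI:
  assumes "\<And>z. z \<in> S \<Longrightarrow> (g has_derivative g' z) (at z)" "open S"
    and "\<And>w. k_smooth_on k S (\<lambda>z. g' z w)"
  shows "k_smooth_on (Suc k) S g"
proof -
  have eq: "frechet_derivative g (at z) = g' z" if "z \<in> S" for z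
    using assms(1)[OF that] by (metis frechet_derivative_at)
  have "k_smooth_on k S (\<lambda>z. frechet_derivative g (at z) w)" for w
    using k_smooth_on_cong[OF assms(2), of "\<lambda>z. frechet_derivative g (at z) w" "\<lambda>z. g' z w"] eq assms(3)
    by auto
  then show ?thesis using assms(1) by (auto simp: differentiable_def)
qed

lemma k_smooth_on_has_derivative:
  "k_smooth_on (Suc k) S g \<Longrightarrow> z \<in> S \<Longrightarrow> (g has_derivative frechet_derivative g (at z)) (at z)"
  using frechet_derivative_works by auto

lemma k_smooth_on_const: "open S \<Longrightarrow> k_smooth_on k S (\<lambda>z. c)"
proof (induction k arbitrary: c)
  case (Suc k)
  show ?case by (rule k_smooth_on_SucI[of _ _ "\<lambda>_ _. 0"]) (use Suc in auto)
qed auto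

lemma k_smooth_on_add:
  "open S \<Longrightarrow> k_smooth_on k S g \<Longrightarrow> k_smooth_on k S h \<Longrightarrow> k_smooth_on k S (\<lambda>z. g z + h z)"
proof (induction k arbitrary: g h)
  case 0
  then show ?case by (auto intro!: continuous_intros)
next
  case (Suc k)
  show ?case
    by (rule k_smooth_on_SucI[OF has_derivative_add[OF k_smooth_on_has_derivative[OF Suc.prems(2)]
       k_smooth_on_has_derivative[OF Suc.prems(3)]]]) (use Suc in auto)
qed

lemma k_smooth_on_linear:
  assumes "bounded_linear L" "open S"
  shows "k_smooth_on k S g \<Longrightarrow> k_smooth_on k S (\<lambda>z. L (g z))"
proof (induction k arbitrary: g)
  case 0
  then show ?case using assms by (auto intro: bounded_linear.continuous_on)
next
  case (Suc k)
  show ?case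
    by (rule k_smooth_on_SucI, rule bounded_linear.has_derivative[OF assms(1)],
        rule k_smooth_on_has_derivative[OF Suc.prems]) (use Suc assms in auto)
qed

lemma k_smooth_on_bilinear:
  assumes "bounded_bilinear B" "open S"
  shows "k_smooth_on k S g \<Longrightarrow> k_smooth_on k S h \<Longrightarrow> k_smooth_on k S (\<lambda>z. B (g z) (h z))"
proof (induction k arbitrary: g h)
  case 0
  then show ?case using assms by (auto intro: bounded_bilinear.continuous_on)
next
  case (Suc k)
  have "k_smooth_on k S (\<lambda>z. B (g z) (frechet_derivative h (at z) w) + B (frechet_derivative g (at z) w) (h z))" for w
    by (intro k_smooth_on_add Suc.IH assms(2) k_smooth_on_Suc_D[OF Suc.prems(1)]
        k_smooth_on_Suc_D[OF Suc.prems(2)]) (use Suc.prems in auto)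
  then show ?case
    by (intro k_smooth_on_SucI[OF bounded_bilinear.FDERIV[OF assms(1)
     k_smooth_on_has_derivative[OF Suc.prems(1)] k_smooth_on_has_derivative[OF Suc.prems(2)]]])
     (use assms in auto)
qed

lemma k_smooth_on_sum:
  "open S \<Longrightarrow> finite I \<Longrightarrow> (\<And>i. i \<in> I \<Longrightarrow> k_smooth_on k S (g i)) \<Longrightarrow> k_smooth_on k S (\<lambda>z. \<Sum>i\<in>I. g i z)"
proof (induction I rule: infinite_finite_induct)
  case (insert i I)
  show ?case unfolding sum.insert[OF insert(1,2)] by (intro k_smooth_on_add insert) (use insert in auto)
qed (auto intro: k_smooth_on_const)

text \<open>The chain rule applies the derivative of g at f z to a vector that itself depends on z,
  which the induction hypothesis does not cover. Expanding this vector in \<open>Basis\<close>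
  separates the two dependences; hence the Euclidean space in the middle.\<close>

lemma k_smooth_on_compose:
  fixes f :: "'a::real_normed_vector \<Rightarrow> 'b::euclidean_space" and g :: "'b \<Rightarrow> 'c::real_normed_vector"
  assumes "open S" "open T" "f ` S \<subseteq> T"
  shows "k_smooth_on k S f \<Longrightarrow> k_smooth_on k T g \<Longrightarrow> k_smooth_on k S (\<lambda>z. g (f z))"
proof (induction k arbitrary: g)
  case 0
  then show ?case using assms(3) by (auto intro: continuous_on_compose2)
next
  case (Suc k)
  let ?f' = "\<lambda>z. frechet_derivative f (at z)" and ?g' = "\<lambda>z. frechet_derivative g (at z)"
  have gd: "(g has_derivative ?g' (f z)) (at (f z))" if "z \<in> S" for z
    using k_smooth_on_has_derivative[OF Suc.prems(2)] assms(3) that by auto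
  have fd: "(f has_derivative ?f' z) (at z)" if "z \<in> S" for z
    using k_smooth_on_has_derivative[OF Suc.prems(1)] that by auto
  have expand: "?g' (f z) (?f' z w) = (\<Sum>b\<in>Basis. (?f' z w \<bullet> b) *\<^sub>R ?g' (f z) b)" if "z \<in> S" for z w
  proof -
    interpret linear "?g' (f z)" using gd[OF that] has_derivative_linear by blast
    have "?g' (f z) (?f' z w) = ?g' (f z) (\<Sum>b\<in>Basis. (?f' z w \<bullet> b) *\<^sub>R b)"
      by (simp add: euclidean_representation)
    also have "\<dots> = (\<Sum>b\<in>Basis. (?f' z w \<bullet> b) *\<^sub>R ?g' (f z) b)"
      by (simp add: sum scale)
    finally show ?thesis .
  qed
  have sm: "k_smooth_on k S (\<lambda>z. ?g' (f z) b)" for b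
    by (rule Suc.IH) (use Suc.prems k_smooth_on_Suc_D in auto)
  have "k_smooth_on k S (\<lambda>z. \<Sum>b\<in>Basis. (?f' z w \<bullet> b) *\<^sub>R ?g' (f z) b)" for w
    by (intro k_smooth_on_sum assms finite_Basis k_smooth_on_bilinear[OF bounded_bilinear_scaleR] sm
        k_smooth_on_linear[OF bounded_linear_inner_left]) (use Suc.prems in auto)
  then have "k_smooth_on k S (\<lambda>z. ?g' (f z) (?f' z w))" for w
    using k_smooth_on_cong[OF assms(1), of "\<lambda>z. ?g' (f z) (?f' z w)"
        "\<lambda>z. \<Sum>b\<in>Basis. (?f' z w \<bullet> b) *\<^sub>R ?g' (f z) b"] expand by auto
  moreover have "((\<lambda>z. g (f z)) has_derivative (\<lambda>w. ?g' (f z) (?f' z w))) (at z)" if "z \<in> S" for z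
    using diff_chain_at[OF fd gd] that by (simp add: o_def)
  ultimately show ?case by (intro k_smooth_on_SucI[of S _ "\<lambda>z w. ?g' (f z) (?f' z w)"] assms) auto
qed

lemma smooth_on_subset: "smooth_on S g \<Longrightarrow> T \<subseteq> S \<Longrightarrow> smooth_on T g"
  unfolding smooth_on_def using k_smooth_on_subset by blast

lemma smooth_on_cong: "open S \<Longrightarrow> (\<And>x. x \<in> S \<Longrightarrow> g x = h x) \<Longrightarrow> smooth_on S g \<longleftrightarrow> smooth_on S h"
  unfolding smooth_on_def using k_smooth_on_cong by blast

lemma smooth_on_continuous: "smooth_on S g \<Longrightarrow> continuous_on S g"
  unfolding smooth_on_def using k_smooth_on_continuous by blast

lemma smooth_on_local:
  "(\<And>z. z \<in> S \<Longrightarrow> \<exists>T. open T \<and> z \<in> T \<and> smooth_on T g) \<Longrightarrow> smooth_on S g"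
  unfolding smooth_on_def using k_smooth_on_local by meson

lemma smooth_on_const: "open S \<Longrightarrow> smooth_on S (\<lambda>z. c)"
  unfolding smooth_on_def using k_smooth_on_const by blast

lemma smooth_on_add:
  "open S \<Longrightarrow> smooth_on S g \<Longrightarrow> smooth_on S h \<Longrightarrow> smooth_on S (\<lambda>z. g z + h z)"
  unfolding smooth_on_def using k_smooth_on_add by blast

lemma smooth_on_linear:
  "bounded_linear L \<Longrightarrow> open S \<Longrightarrow> smooth_on S g \<Longrightarrow> smooth_on S (\<lambda>z. L (g z))"
  unfolding smooth_on_def using k_smooth_on_linear by blast

lemma smooth_on_bilinear:
  "bounded_bilinear B \<Longrightarrow> open S \<Longrightarrow> smooth_on S g \<Longrightarrow> smooth_on S h \<Longrightarrow> smooth_on S (\<lambda>z. B (g z) (h z))"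
  unfolding smooth_on_def using k_smooth_on_bilinear by blast

lemma smooth_on_compose:
  fixes f :: "'a::real_normed_vector \<Rightarrow> 'b::euclidean_space" and g :: "'b \<Rightarrow> 'c::real_normed_vector"
  shows "open S \<Longrightarrow> open T \<Longrightarrow> f ` S \<subseteq> T \<Longrightarrow> smooth_on S f \<Longrightarrow> smooth_on T g \<Longrightarrow> smooth_on S (\<lambda>z. g (f z))"
  unfolding smooth_on_def using k_smooth_on_compose by blast

lemma smooth_on_has_derivative:
  "smooth_on S g \<Longrightarrow> z \<in> S \<Longrightarrow> (g has_derivative frechet_derivative g (at z)) (at z)"
  unfolding smooth_on_def using k_smooth_on_has_derivative by blast

lemma smooth_on_derivative: "smooth_on S g \<Longrightarrow> smooth_on S (\<lambda>z. frechet_derivative g (at z) w)"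
  unfolding smooth_on_def by (metis k_smooth_on.simps(2))

lemma smooth_onI:
  assumes "open S" "\<And>z. z \<in> S \<Longrightarrow> (g has_derivative g' z) (at z)" "\<And>w. smooth_on S (\<lambda>z. g' z w)"
  shows "smooth_on S g"
proof -
  have "k_smooth_on (Suc k) S g" for k
    by (rule k_smooth_on_SucI[OF assms(2,1)]) (use assms(3) in \<open>auto simp: smooth_on_def\<close>)
  then show ?thesis unfolding smooth_on_def using k_smooth_on_Suc_D by blast
qed

lemma smooth_on_scaleR:
  "open S \<Longrightarrow> smooth_on S g \<Longrightarrow> smooth_on S h \<Longrightarrow> smooth_on S (\<lambda>z. g z *\<^sub>R h z)"
  by (rule smooth_on_bilinear[OF bounded_bilinear_scaleR])

lemma smooth_on_mult:
  fixes g h :: "'a::real_normed_vector \<Rightarrow> real"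
  shows "open S \<Longrightarrow> smooth_on S g \<Longrightarrow> smooth_on S h \<Longrightarrow> smooth_on S (\<lambda>z. g z * h z)"
  by (rule smooth_on_bilinear[OF bounded_bilinear_mult])

lemma smooth_on_minus: "open S \<Longrightarrow> smooth_on S g \<Longrightarrow> smooth_on S (\<lambda>z. - g z)"
  by (rule smooth_on_linear[OF bounded_linear_minus[OF bounded_linear_ident]])

lemma smooth_on_diff:
  "open S \<Longrightarrow> smooth_on S g \<Longrightarrow> smooth_on S h \<Longrightarrow> smooth_on S (\<lambda>z. g z - h z)"
  using smooth_on_add[OF _ _ smooth_on_minus, of S g h] by simp

lemma smooth_on_Pair:
  assumes "open S" "smooth_on S g" "smooth_on S h"
  shows "smooth_on S (\<lambda>z. (g z, h z))"
proof -
  have "bounded_linear (\<lambda>x. (x, 0))" "bounded_linear (\<lambda>x. (0, x))"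
    by (auto intro!: bounded_linear_Pair bounded_linear_ident bounded_linear_zero)
  from this[THEN smooth_on_linear, OF assms(1)] assms
  have "smooth_on S (\<lambda>z. (g z, 0) + (0, h z))"
    by (intro smooth_on_add) auto
  then show ?thesis by (simp del: zero_prod_def)
qed

text \<open>The derivative is a polynomial in \<open>inverse z\<close>, so class k of
  \<open>inverse\<close> yields class k + 1.\<close>

lemma smooth_on_inverse_real: "smooth_on (- {0}) (inverse :: real \<Rightarrow> real)"
proof -
  have "k_smooth_on k (- {0}) (inverse :: real \<Rightarrow> real)" for k
  proof (induction k)
    case 0
    then show ?case by (auto intro!: continuous_intros)
  next
    case (Suc k)
    have "k_smooth_on k (- {0}) (\<lambda>z::real. (inverse z * inverse z) * (- w))" for w
      by (intro k_smooth_on_bilinear[OF bounded_bilinear_mult] Suc k_smooth_on_const) auto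
    then show ?case
      by (intro k_smooth_on_SucI[of _ _ "\<lambda>z w. (inverse z * inverse z) * (- w)"])
        (auto intro!: derivative_eq_intros)
  qed
  then show ?thesis by (simp add: smooth_on_def)
qed

lemma smooth_on_sqrt_real: "smooth_on {0<..} sqrt"
proof -
  have "k_smooth_on k {0<..} sqrt" for k
  proof (induction k)
    case 0
    then show ?case by (auto intro!: continuous_intros)
  next
    case (Suc k)
    have "k_smooth_on k {0<..} (\<lambda>z::real. inverse (sqrt z) * (w / 2))" for w
    proof (rule k_smooth_on_bilinear[OF bounded_bilinear_mult])
      show "k_smooth_on k {0<..} (\<lambda>z::real. inverse (sqrt z))"
        by (rule k_smooth_on_compose[OF _ _ _ Suc, of "- {0}"])
          (use smooth_on_inverse_real in \<open>auto simp: smooth_on_def\<close>)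
    qed (auto intro: k_smooth_on_const)
    then show ?case
      by (intro k_smooth_on_SucI[of _ _ "\<lambda>z w. inverse (sqrt z) * (w / 2)"])
        (auto intro!: derivative_eq_intros simp: field_simps)
  qed
  then show ?thesis by (simp add: smooth_on_def)
qed

lemma smooth_on_inverse:
  assumes "open S" "smooth_on S g" "\<And>z. z \<in> S \<Longrightarrow> g z \<noteq> 0"
  shows "smooth_on S (\<lambda>z. inverse (g z) :: real)"
  by (rule smooth_on_compose[OF _ _ _ _ smooth_on_inverse_real]) (use assms in auto)

lemma smooth_on_divide:
  assumes "open S" "smooth_on S h" "smooth_on S g" "\<And>z. z \<in> S \<Longrightarrow> g z \<noteq> 0"
  shows "smooth_on S (\<lambda>z. h z / g z :: real)"
  unfolding divide_inverse by (intro smooth_on_mult smooth_on_inverse assms)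

lemma smooth_on_sqrt:
  assumes "open S" "smooth_on S g" "\<And>z. z \<in> S \<Longrightarrow> g z > 0"
  shows "smooth_on S (\<lambda>z. sqrt (g z))"
  by (rule smooth_on_compose[OF _ _ _ _ smooth_on_sqrt_real]) (use assms in auto)

section \<open>Partial derivatives and their symmetry\<close>

lemma D_eq_derivative:
  assumes "(g has_derivative g') (at z)"
  shows "D\<^sub>u g z = g' (1, 0)" "D\<^sub>v g z = g' (0, 1)"
  using frechet_derivative_at[OF assms] by (auto simp: D\<^sub>u_def D\<^sub>v_def)

lemma frechet_eq_D:
  assumes "g differentiable (at z)"
  shows "frechet_derivative g (at z) w = fst w *\<^sub>R D\<^sub>u g z + snd w *\<^sub>R D\<^sub>v g z"
proof -
  note lin = linear_frechet_derivative[OF assms]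
  have "w = fst w *\<^sub>R (1,0) + snd w *\<^sub>R (0,1)" by (cases w) simp
  then have "frechet_derivative g (at z) w = frechet_derivative g (at z) (fst w *\<^sub>R (1,0) + snd w *\<^sub>R (0,1))"
    by metis
  then show ?thesis
    unfolding linear_add[OF lin] linear_scale[OF lin] D\<^sub>u_def D\<^sub>v_def .
qed

lemma smooth_on_differentiable: "smooth_on S g \<Longrightarrow> z \<in> S \<Longrightarrow> g differentiable (at z)"
  using smooth_on_has_derivative differentiable_def by blast

lemma smooth_on_has_D:
  "smooth_on S g \<Longrightarrow> z \<in> S \<Longrightarrow> (g has_derivative (\<lambda>w. fst w *\<^sub>R D\<^sub>u g z + snd w *\<^sub>R D\<^sub>v g z)) (at z)"
  by (rule has_derivative_eq_rhs[OF smooth_on_has_derivative])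
    (auto simp: frechet_eq_D[OF smooth_on_differentiable])

lemma smooth_on_D: "smooth_on S g \<Longrightarrow> smooth_on S (D\<^sub>u g)" "smooth_on S g \<Longrightarrow> smooth_on S (D\<^sub>v g)"
  using smooth_on_derivative by (auto simp: D\<^sub>u_def[abs_def] D\<^sub>v_def[abs_def])

lemma D_cong_open:
  assumes "open S" "z \<in> S" "\<And>x. x \<in> S \<Longrightarrow> g x = h x"
  shows "D\<^sub>u g z = D\<^sub>u h z" "D\<^sub>v g z = D\<^sub>v h z"
  using frechet_derivative_cong_open[OF assms] by (auto simp: D\<^sub>u_def D\<^sub>v_def)

lemma D_bilinear:
  assumes "bounded_bilinear B" "g differentiable (at z)" "h differentiable (at z)"
  shows "D\<^sub>u (\<lambda>x. B (g x) (h x)) z = B (g z) (D\<^sub>u h z) + B (D\<^sub>u g z) (h z)"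
    "D\<^sub>v (\<lambda>x. B (g x) (h x)) z = B (g z) (D\<^sub>v h z) + B (D\<^sub>v g z) (h z)"
  using D_eq_derivative[OF bounded_bilinear.FDERIV[OF assms(1) frechet_derivative_works[THEN iffD1, OF assms(2)]
     frechet_derivative_works[THEN iffD1, OF assms(3)]]]
  by (auto simp: D\<^sub>u_def D\<^sub>v_def)

lemma D_add:
  assumes "g differentiable (at z)" "h differentiable (at z)"
  shows "D\<^sub>u (\<lambda>x. g x + h x) z = D\<^sub>u g z + D\<^sub>u h z" "D\<^sub>v (\<lambda>x. g x + h x) z = D\<^sub>v g z + D\<^sub>v h z"
  using D_eq_derivative[OF has_derivative_add[OF frechet_derivative_works[THEN iffD1, OF assms(1)]
     frechet_derivative_works[THEN iffD1, OF assms(2)]]]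
  by (auto simp: D\<^sub>u_def D\<^sub>v_def)

lemma D_linear:
  assumes "bounded_linear L" "g differentiable (at z)"
  shows "D\<^sub>u (\<lambda>x. L (g x)) z = L (D\<^sub>u g z)" "D\<^sub>v (\<lambda>x. L (g x)) z = L (D\<^sub>v g z)"
  using D_eq_derivative[OF bounded_linear.has_derivative[OF assms(1) frechet_derivative_works[THEN iffD1, OF assms(2)]]]
  by (auto simp: D\<^sub>u_def D\<^sub>v_def)

text \<open>Two applications of the mean value theorem to the second difference over a square. The
  second difference is symmetric in the variables, so using this in both orders compares the two
  mixed derivatives.\<close>

lemma rectangle_mvt:
  fixes F F1 F12 :: "real \<Rightarrow> real \<Rightarrow> real"
  assumes "0 < s"
    and 1: "\<And>x y. x \<in> {a..a+s} \<Longrightarrow> y \<in> {b..b+s} \<Longrightarrow> ((\<lambda>x. F x y) has_real_derivative F1 x y) (at x)"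
    and 2: "\<And>x y. x \<in> {a..a+s} \<Longrightarrow> y \<in> {b..b+s} \<Longrightarrow> ((\<lambda>y. F1 x y) has_real_derivative F12 x y) (at y)"
  obtains x y where "x \<in> {a..a+s}" "y \<in> {b..b+s}"
    "F (a+s) (b+s) - F (a+s) b - F a (b+s) + F a b = s * s * F12 x y"
proof -
  have "\<exists>x>a. x < a+s \<and> (F (a+s) (b+s) - F (a+s) b) - (F a (b+s) - F a b) = (a+s-a) * (F1 x (b+s) - F1 x b)"
    using assms by (intro MVT2) (auto intro!: DERIV_diff)
  then obtain x where x: "x > a" "x < a+s"
    "(F (a+s) (b+s) - F (a+s) b) - (F a (b+s) - F a b) = s * (F1 x (b+s) - F1 x b)" by auto
  have "\<exists>y>b. y < b+s \<and> F1 x (b+s) - F1 x b = (b+s-b) * F12 x y"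
    using assms x by (intro MVT2) auto
  then obtain y where y: "y > b" "y < b+s" "F1 x (b+s) - F1 x b = s * F12 x y" by auto
  show ?thesis by (rule that[of x y]) (use x y in auto)
qed

lemma D_has_real_derivative:
  fixes g :: "real \<times> real \<Rightarrow> real"
  assumes "smooth_on S g" "(x, y) \<in> S"
  shows "((\<lambda>x. g (x, y)) has_real_derivative D\<^sub>u g (x, y)) (at x)"
    "((\<lambda>y. g (x, y)) has_real_derivative D\<^sub>v g (x, y)) (at y)"
proof -
  note D = smooth_on_has_D[OF assms]
  have "((\<lambda>x. (x, y)) has_derivative (\<lambda>w. (w, 0))) (at x)"
    by (auto intro!: derivative_eq_intros)
  from diff_chain_at[OF this D]
  show "((\<lambda>x. g (x, y)) has_real_derivative D\<^sub>u g (x, y)) (at x)"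
    by (simp add: has_field_derivative_def mult_commute_abs o_def)
  have "((\<lambda>y. (x, y)) has_derivative (\<lambda>w. (0, w))) (at y)"
    by (auto intro!: derivative_eq_intros)
  from diff_chain_at[OF this D]
  show "((\<lambda>y. g (x, y)) has_real_derivative D\<^sub>v g (x, y)) (at y)"
    by (simp add: has_field_derivative_def mult_commute_abs o_def)
qed

text \<open>If the mixed derivatives differed at z, continuity would keep their values apart on a
  small square, whereas the second difference over it equals s^2 times a value of either of
  them.\<close>

lemma mixed_partials_real:
  fixes g :: "real \<times> real \<Rightarrow> real"
  assumes "smooth_on S g" "open S" "z \<in> S"
  shows "D\<^sub>v (D\<^sub>u g) z = D\<^sub>u (D\<^sub>v g) z"
proof (rule ccontr)
  let ?A = "D\<^sub>v (D\<^sub>u g)" and ?B = "D\<^sub>u (D\<^sub>v g)"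
  assume ne: "?A z \<noteq> ?B z"
  define e where "e = dist (?A z) (?B z) / 2"
  have e: "e > 0" using ne by (simp add: e_def)
  note sm = assms(1) smooth_on_D[OF assms(1)] smooth_on_D[THEN smooth_on_D(1), OF assms(1)]
    smooth_on_D[THEN smooth_on_D(2), OF assms(1)]
  have "isCont ?A z" "isCont ?B z"
    using sm smooth_on_continuous assms continuous_on_eq_continuous_at by blast+
  then obtain d1 d2 where d: "d1 > 0" "\<And>x. dist x z < d1 \<Longrightarrow> dist (?A x) (?A z) < e"
     "d2 > 0" "\<And>x. dist x z < d2 \<Longrightarrow> dist (?B x) (?B z) < e"
    unfolding continuous_at_eps_delta using e by metis
  obtain d3 where d3: "d3 > 0" "ball z d3 \<subseteq> S"
    using assms open_contains_ball by blast
  define d where "d = min d1 (min d2 d3)"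
  \<comment> \<open>Points of the square with corner z and side s are at distance at most 2 s = d /
    2 from z.\<close>
  define s where "s = d / 4"
  obtain a b where z: "z = (a, b)" by force
  have s: "s > 0" using d d3 by (simp add: s_def d_def)
  have near: "dist (x, y) z < d" if "x \<in> {a..a+s}" "y \<in> {b..b+s}" for x y
  proof -
    have "dist (x, y) z \<le> \<bar>x - a\<bar> + \<bar>y - b\<bar>"
      by (simp add: z dist_Pair_Pair dist_real_def sqrt_sum_squares_le_sum_abs)
    also have "\<dots> \<le> 2 * s" using that by auto
    also have "\<dots> < d" using s by (simp add: s_def)
    finally show ?thesis .
  qed
  have inS: "(x, y) \<in> S" if "x \<in> {a..a+s}" "y \<in> {b..b+s}" for x y
    using near[OF that] d3 by (auto simp: d_def dist_commute)
  obtain x y where xy: "x \<in> {a..a+s}" "y \<in> {b..b+s}"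
    "g (a+s, b+s) - g (a+s, b) - g (a, b+s) + g (a, b) = s * s * ?A (x, y)"
    by (rule rectangle_mvt[OF s, of a b "\<lambda>x y. g (x, y)" "\<lambda>x y. D\<^sub>u g (x, y)" "\<lambda>x y. ?A (x, y)"])
      (use D_has_real_derivative sm inS in blast)+
  obtain y' x' where xy': "y' \<in> {b..b+s}" "x' \<in> {a..a+s}"
    "g (a+s, b+s) - g (a, b+s) - g (a+s, b) + g (a, b) = s * s * ?B (x', y')"
    by (rule rectangle_mvt[OF s, of b a "\<lambda>y x. g (x, y)" "\<lambda>y x. D\<^sub>v g (x, y)" "\<lambda>y x. ?B (x, y)"])
      (assumption | rule D_has_real_derivative(2)[OF sm(1) inS] D_has_real_derivative(1)[OF sm(3) inS])+
  have "s * s * ?A (x, y) = s * s * ?B (x', y')" using xy(3) xy'(3) by linarith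
  then have eq: "?A (x, y) = ?B (x', y')" using s by simp
  have "dist (?A (x, y)) (?A z) < e" "dist (?B (x', y')) (?B z) < e"
    using near xy xy' d by (auto simp: d_def)
  then have "dist (?A z) (?B z) < e + e"
    using eq by (metis add_strict_mono dist_commute dist_triangle order_le_less_trans)
  then show False by (simp add: e_def)
qed

lemma mixed_partials:
  fixes g :: "real \<times> real \<Rightarrow> 'b::euclidean_space"
  assumes "smooth_on S g" "open S" "z \<in> S"
  shows "D\<^sub>v (D\<^sub>u g) z = D\<^sub>u (D\<^sub>v g) z"
proof (rule euclidean_eqI)
  fix b :: 'b assume "b \<in> Basis"
  let ?g = "\<lambda>x. g x \<bullet> b"
  have lin: "bounded_linear (\<lambda>x. x \<bullet> b)" by (rule bounded_linear_inner_left)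
  have D1: "D\<^sub>u ?g x = D\<^sub>u g x \<bullet> b" "D\<^sub>v ?g x = D\<^sub>v g x \<bullet> b" if "x \<in> S" for x
    using D_linear[OF lin smooth_on_differentiable[OF assms(1) that]] by auto
  have "D\<^sub>v (D\<^sub>u ?g) z = D\<^sub>v (\<lambda>x. D\<^sub>u g x \<bullet> b) z" "D\<^sub>u (D\<^sub>v ?g) z = D\<^sub>u (\<lambda>x. D\<^sub>v g x \<bullet> b) z"
    by (rule D_cong_open[OF assms(2,3)]; simp add: D1)+
  then have "D\<^sub>v (D\<^sub>u ?g) z = D\<^sub>v (D\<^sub>u g) z \<bullet> b" "D\<^sub>u (D\<^sub>v ?g) z = D\<^sub>u (D\<^sub>v g) z \<bullet> b"
    using D_linear[OF lin smooth_on_differentiable[OF smooth_on_D(1)[OF assms(1)] assms(3)]]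
     D_linear[OF lin smooth_on_differentiable[OF smooth_on_D(2)[OF assms(1)] assms(3)]] by auto
  moreover have "D\<^sub>v (D\<^sub>u ?g) z = D\<^sub>u (D\<^sub>v ?g) z"
    by (rule mixed_partials_real[OF smooth_on_linear[OF lin assms(2,1)] assms(2,3)])
  ultimately show "D\<^sub>v (D\<^sub>u g) z \<bullet> b = D\<^sub>u (D\<^sub>v g) z \<bullet> b" by simp
qed

section \<open>Local inverses and closed forms in the plane\<close>

definition jac :: "(real \<times> real \<Rightarrow> real \<times> real) \<Rightarrow> real \<times> real \<Rightarrow> real" where
  "jac G z = fst (D\<^sub>u G z) * snd (D\<^sub>v G z) - fst (D\<^sub>v G z) * snd (D\<^sub>u G z)"

text \<open>Cramer's rule for the inverse of the differential of G. Being rational in the partial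
  derivatives, it is visibly smooth where \<open>jac G\<close> does not vanish.\<close>

definition dinv :: "(real \<times> real \<Rightarrow> real \<times> real) \<Rightarrow> real \<times> real \<Rightarrow> real \<times> real \<Rightarrow> real \<times> real" where
  "dinv G z w = ((snd (D\<^sub>v G z) * fst w - fst (D\<^sub>v G z) * snd w) / jac G z,
     (fst (D\<^sub>u G z) * snd w - snd (D\<^sub>u G z) * fst w) / jac G z)"

lemma dinv_inverse:
  assumes "jac G z \<noteq> 0"
  shows "dinv G z (fst w *\<^sub>R D\<^sub>u G z + snd w *\<^sub>R D\<^sub>v G z) = w"
proof -
  have "dinv G z (fst w *\<^sub>R D\<^sub>u G z + snd w *\<^sub>R D\<^sub>v G z) =
    (fst w * jac G z / jac G z, snd w * jac G z / jac G z)"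
    unfolding dinv_def by (auto simp: jac_def algebra_simps)
  then show ?thesis using assms by simp
qed

lemma linear_dinv: "bounded_linear (dinv G z)"
  by (subst linear_conv_bounded_linear[symmetric], rule linearI)
    (auto simp: dinv_def algebra_simps add_divide_distrib diff_divide_distrib)

text \<open>The inverse function theorem yields a continuous g with a derivative. This derivative is
  \<open>dinv G (g y)\<close>, a smooth map composed with g, so class k of g implies class k +
  1.\<close>

lemma smooth_local_inverse:
  fixes G :: "real \<times> real \<Rightarrow> real \<times> real"
  assumes "open U" and sm: "smooth_on U G" and z0: "z0 \<in> U" and "jac G z0 \<noteq> 0"
  obtains U' V g where "open U'" "U' \<subseteq> U" "z0 \<in> U'" "open V" "homeomorphism U' V G g"
    "smooth_on V g" "\<And>z. z \<in> U' \<Longrightarrow> jac G z \<noteq> 0"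
    "\<And>y. y \<in> V \<Longrightarrow> (g has_derivative dinv G (g y)) (at y)"
proof -
  let ?L = "\<lambda>z w. fst w *\<^sub>R D\<^sub>u G z + snd w *\<^sub>R D\<^sub>v G z"
  define f' where "f' z = Blinfun (?L z)" for z
  have L: "bounded_linear (?L z)" for z
    by (intro bounded_linear_add bounded_linear_fst bounded_linear_snd bounded_linear_scaleR_left[THEN bounded_linear_compose])
  have f': "blinfun_apply (f' z) = ?L z" for z
    unfolding f'_def using bounded_linear_Blinfun_apply[OF L] by blast
  have c: "continuous_on U (D\<^sub>u G)" "continuous_on U (D\<^sub>v G)"
    using sm smooth_on_D smooth_on_continuous by blast+
  have "(G has_derivative blinfun_apply (f' z)) (at z)" if "z \<in> U" for z
    unfolding f' by (rule smooth_on_has_D[OF sm that])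
  moreover have "continuous_on U f'"
    by (rule continuous_on_blinfun_componentwise) (auto simp: f' intro!: continuous_intros c)
  moreover have "Blinfun (dinv G z0) o\<^sub>L f' z0 = id_blinfun"
    by (rule blinfun_eqI) (simp add: f' bounded_linear_Blinfun_apply[OF linear_dinv] dinv_inverse assms(4))
  ultimately obtain U' V g g' where *: "open U'" "U' \<subseteq> U" "z0 \<in> U'" "open V" "G z0 \<in> V" "homeomorphism U' V G g"
    "\<And>y. y \<in> V \<Longrightarrow> (g has_derivative (g' y)) (at y)"
    "\<And>y. y \<in> V \<Longrightarrow> g' y = inv (blinfun_apply (f'(g y)))"
    "\<And>y. y \<in> V \<Longrightarrow> bij (blinfun_apply (f'(g y)))"
    by (rule inverse_function_theorem[OF assms(1) _ _ z0]) blast+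
  \<comment> \<open>The differential at g y is bijective. If its determinant vanished, the two
    vectors below would lie in its kernel, which makes both columns zero.\<close>
  have j: "jac G (g y) \<noteq> 0" if "y \<in> V" for y
  proof
    assume 0: "jac G (g y) = 0"
    let ?X = "D\<^sub>u G (g y)" and ?Y = "D\<^sub>v G (g y)"
    have inj: "w = 0" if "?L (g y) w = 0" for w
    proof -
      have "inj (?L (g y))" using *(9)[OF \<open>y \<in> V\<close>] unfolding f' bij_def by simp
      from injD[OF this, of w 0] that show ?thesis by simp
    qed
    have "?L (g y) (snd ?Y, - snd ?X) = 0" "?L (g y) (fst ?Y, - fst ?X) = 0"
      using 0 by (auto simp: jac_def prod_eq_iff algebra_simps)
    then have "(snd ?Y, - snd ?X) = 0" "(fst ?Y, - fst ?X) = 0" using inj by blast+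
    then have "?X = 0" "?Y = 0" by (auto simp: prod_eq_iff)
    then show False using inj[of "(1, 0)"] by (simp add: zero_prod_def)
  qed
  have jU: "jac G z \<noteq> 0" if "z \<in> U'" for z
    using j *(6) that unfolding homeomorphism_def by (metis imageI)
  have gd: "(g has_derivative dinv G (g y)) (at y)" if "y \<in> V" for y
  proof -
    have "inv (blinfun_apply (f'(g y))) = dinv G (g y)"
      using dinv_inverse[OF j[OF that]] *(9)[OF that]
      by (metis f' bij_inv_eq_iff ext)
    then show ?thesis using *(7,8) that by metis
  qed
  have smd: "smooth_on U' (\<lambda>z. dinv G z w)" for w
  proof -
    have "smooth_on U' (D\<^sub>u G)" "smooth_on U' (D\<^sub>v G)" using smooth_on_D[OF sm] smooth_on_subset *(2) by blast+
    note q = smooth_on_linear[OF bounded_linear_fst *(1) this(1)] smooth_on_linear[OF bounded_linear_fst *(1) this(2)]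
      smooth_on_linear[OF bounded_linear_snd *(1) this(1)] smooth_on_linear[OF bounded_linear_snd *(1) this(2)]
    show ?thesis unfolding dinv_def using jU *(1)
      by (intro smooth_on_Pair smooth_on_divide smooth_on_diff smooth_on_mult q smooth_on_const)
       (auto simp: jac_def[abs_def] intro!: smooth_on_diff smooth_on_mult q)
  qed
  have "k_smooth_on k V g" for k
  proof (induction k)
    case 0
    then show ?case using *(6) unfolding homeomorphism_def by auto
  next
    case (Suc k)
    have "k_smooth_on k V (\<lambda>y. dinv G (g y) w)" for w
      by (rule k_smooth_on_compose[OF *(4,1) _ Suc])
        (use *(6) smd in \<open>auto simp: homeomorphism_def smooth_on_def\<close>)
    then show ?case by (intro k_smooth_on_SucI[OF gd *(4)])
  qed
  then show ?thesis by (intro that[OF *(1-4,6) _ jU gd]) (auto simp: smooth_on_def)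
qed

text \<open>Poincare lemma on a disc: u integrates the form along the segment from the centre.
  Closedness turns the integrands of its partial derivatives into the t-derivatives of t \<alpha>
  and t \<beta>, which integrate to \<alpha> and \<beta> at the end point.\<close>

lemma closed_form_exact:
  fixes \<alpha> \<beta> :: "real \<times> real \<Rightarrow> real"
  assumes sm: "smooth_on (ball z0 r) \<alpha>" "smooth_on (ball z0 r) \<beta>"
    and closed: "\<And>z. z \<in> ball z0 r \<Longrightarrow> D\<^sub>v \<alpha> z = D\<^sub>u \<beta> z"
  obtains u where "smooth_on (ball z0 r) u"
    "\<And>z. z \<in> ball z0 r \<Longrightarrow> D\<^sub>u u z = \<alpha> z" "\<And>z. z \<in> ball z0 r \<Longrightarrow> D\<^sub>v u z = \<beta> z"
proof -
  let ?B = "ball z0 r"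
  let ?\<zeta> = "\<lambda>x t. z0 + t *\<^sub>R (x - z0)"
  let ?X = "\<lambda>x. fst (x - z0)" and ?Y = "\<lambda>x. snd (x - z0)"
  define f where "f x t = \<alpha> (?\<zeta> x t) * ?X x + \<beta> (?\<zeta> x t) * ?Y x" for x t
  \<comment> \<open>\<open>c1\<close> and \<open>c2\<close> are the partial derivatives of f in x,
    already rewritten by closedness as the t-derivatives of t \<alpha> and t \<beta> along the
    segment.\<close>
  define c1 where "c1 x t = \<alpha> (?\<zeta> x t) + t * (D\<^sub>u \<alpha> (?\<zeta> x t) * ?X x + D\<^sub>v \<alpha> (?\<zeta> x t) * ?Y x)" for x t
  define c2 where "c2 x t = \<beta> (?\<zeta> x t) + t * (D\<^sub>u \<beta> (?\<zeta> x t) * ?X x + D\<^sub>v \<beta> (?\<zeta> x t) * ?Y x)" for x t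
  define fx :: "real \<times> real \<Rightarrow> real \<Rightarrow> (real \<times> real) \<Rightarrow>\<^sub>L real" where "fx x t = c1 x t *\<^sub>R fst_blinfun + c2 x t *\<^sub>R snd_blinfun" for x t
  have fx_apply: "blinfun_apply (fx x t) w = c1 x t * fst w + c2 x t * snd w" for x t w
    by (simp add: fx_def blinfun.add_left blinfun.scaleR_left)
  define u where "u x = integral {0..1} (f x)" for x
  have inB: "?\<zeta> x t \<in> ?B" if "x \<in> ?B" "t \<in> {0..1}" for x t
  proof -
    have "norm (t *\<^sub>R (x - z0)) \<le> norm (x - z0)"
      using that by (simp add: mult_left_le_one_le)
    then show ?thesis using that(1) by (simp add: dist_norm norm_minus_commute)
  qed
  have cont: "continuous_on (?B \<times> {0..1}) (\<lambda>p. g (?\<zeta> (fst p) (snd p)))" if "smooth_on ?B g" for g :: "real \<times> real \<Rightarrow> real"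
    by (rule continuous_on_compose2[OF smooth_on_continuous[OF that]])
      (auto intro!: continuous_intros image_subsetI inB simp: mem_Times_iff simp del: mem_ball)
  note smD = smooth_on_D[OF sm(1)] smooth_on_D[OF sm(2)]
  have cont': "continuous_on {0..1} (\<lambda>t. g (?\<zeta> x t))" if "smooth_on ?B g" "x \<in> ?B" for g :: "real \<times> real \<Rightarrow> real" and x
    by (rule continuous_on_compose2[OF smooth_on_continuous[OF that(1)]])
      (auto intro!: continuous_intros image_subsetI inB that simp del: mem_ball)
  have main: "(u has_derivative (\<lambda>w. fst w *\<^sub>R \<alpha> x + snd w *\<^sub>R \<beta> x)) (at x)" if x: "x \<in> ?B" for x
  proof -
    have der: "(g has_derivative (\<lambda>w. fst w *\<^sub>R D\<^sub>u g z + snd w *\<^sub>R D\<^sub>v g z)) (at z within T)"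
      if "smooth_on ?B g" "z \<in> ?B" for g :: "real \<times> real \<Rightarrow> real" and z T
      using smooth_on_has_D[OF that] has_derivative_at_withinI by blast
    have comp: "((\<lambda>x. g (?\<zeta> x t)) has_derivative (\<lambda>w. t * (fst w * D\<^sub>u g (?\<zeta> y t) + snd w * D\<^sub>v g (?\<zeta> y t)))) (at y within T)"
      if "smooth_on ?B g" "y \<in> ?B" "t \<in> {0..1}" for g :: "real \<times> real \<Rightarrow> real" and y t T
    proof -
      have "((\<lambda>x. ?\<zeta> x t) has_derivative (\<lambda>w. t *\<^sub>R w)) (at y within T)"
        by (auto intro!: derivative_eq_intros)
      from diff_chain_within[OF this der[OF that(1) inB[OF that(2,3)]]]
      show ?thesis by (auto simp: o_def algebra_simps)
    qed
    have comp_t: "((\<lambda>t. g (?\<zeta> y t)) has_derivative (\<lambda>s. s * (?X y * D\<^sub>u g (?\<zeta> y t) + ?Y y * D\<^sub>v g (?\<zeta> y t)))) (at t within T)"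
      if "smooth_on ?B g" "y \<in> ?B" "t \<in> {0..1}" for g :: "real \<times> real \<Rightarrow> real" and y t T
    proof -
      have "((\<lambda>t. ?\<zeta> y t) has_derivative (\<lambda>s. s *\<^sub>R (y - z0))) (at t within T)"
        by (auto intro!: derivative_eq_intros)
      from diff_chain_within[OF this der[OF that(1) inB[OF that(2,3)]]]
      show ?thesis by (auto simp: o_def algebra_simps)
    qed
    have "((\<lambda>x. integral (cbox 0 1) (f x)) has_derivative blinfun_apply (integral (cbox 0 1) (fx x))) (at x within ?B)"
    proof (rule leibniz_rule)
      fix y t assume y: "y \<in> ?B" and t: "t \<in> cbox (0::real) 1"
      then have t': "t \<in> {0..1}" by simp
      have cl: "D\<^sub>u \<beta> (?\<zeta> y t) = D\<^sub>v \<alpha> (?\<zeta> y t)" using closed[OF inB[OF y t']] by simp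
      show "((\<lambda>x. f x t) has_derivative blinfun_apply (fx y t)) (at y within ?B)"
        unfolding f_def
        by (rule has_derivative_eq_rhs, (rule derivative_intros comp[OF sm(1) y t'] comp[OF sm(2) y t'])+)
          (rule ext, simp only: fx_apply c1_def c2_def cl, simp add: algebra_simps)
    next
      fix y assume "y \<in> ?B"
      then have "continuous_on {0..1} (f y)"
        unfolding f_def by (intro continuous_intros cont'[OF sm(1)] cont'[OF sm(2)])
      then show "f y integrable_on cbox 0 1"
        by (simp add: integrable_continuous_interval)
    next
      show "continuous_on (?B \<times> cbox 0 1) (\<lambda>(x, t). fx x t)"
        unfolding fx_def c1_def c2_def split_beta cbox_interval
        by (intro continuous_intros cont sm smD)
    qed (use x in auto)
    moreover have "((\<lambda>t. g (?\<zeta> x t) + t * (D\<^sub>u g (?\<zeta> x t) * ?X x + D\<^sub>v g (?\<zeta> x t) * ?Y x)) has_integral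
        1 * g (?\<zeta> x 1) - 0 * g (?\<zeta> x 0)) {0..1}" if "smooth_on ?B g" for g :: "real \<times> real \<Rightarrow> real"
    proof (rule fundamental_theorem_of_calculus)
      fix t :: real assume "t \<in> {0..1}"
      from has_derivative_mult[OF has_derivative_ident comp_t[OF that x this, of "{0..1}"]]
      show "((\<lambda>t. t * g (?\<zeta> x t)) has_vector_derivative
        g (?\<zeta> x t) + t * (D\<^sub>u g (?\<zeta> x t) * ?X x + D\<^sub>v g (?\<zeta> x t) * ?Y x)) (at t within {0..1})"
        unfolding has_vector_derivative_def by (rule has_derivative_eq_rhs) (auto simp: algebra_simps)
    qed simp
    note this[OF sm(1)] this[OF sm(2)]
    ultimately have "(fx x has_integral (\<alpha> x *\<^sub>R fst_blinfun + \<beta> x *\<^sub>R snd_blinfun)) (cbox 0 1)"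
      unfolding fx_def c1_def c2_def by (auto intro!: has_integral_add has_integral_scaleR_left)
    then have "integral (cbox 0 1) (fx x) = \<alpha> x *\<^sub>R fst_blinfun + \<beta> x *\<^sub>R snd_blinfun"
      by (rule integral_unique)
    with \<open>((\<lambda>x. integral (cbox 0 1) (f x)) has_derivative blinfun_apply (integral (cbox 0 1) (fx x))) (at x within ?B)\<close>
    have "(u has_derivative blinfun_apply (\<alpha> x *\<^sub>R fst_blinfun + \<beta> x *\<^sub>R snd_blinfun)) (at x)"
      using x by (simp add: u_def[abs_def] at_within_open[OF x])
    then show ?thesis
      by (rule has_derivative_eq_rhs) (auto simp: blinfun.add_left blinfun.scaleR_left)
  qed
  have "smooth_on ?B u"
    by (rule smooth_onI[OF open_ball main], assumption) (intro smooth_on_add smooth_on_scaleR smooth_on_const sm open_ball)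
  then show ?thesis by (rule that) (use D_eq_derivative[OF main] in auto)
qed

text \<open>With a primitive C of c, the product of \<phi> and the integrating factor exp (- C) has
  derivative 0.\<close>

lemma linear_ode_zero:
  fixes \<phi> c :: "real \<Rightarrow> real"
  assumes d: "\<And>t. t \<in> {0..1} \<Longrightarrow> (\<phi> has_real_derivative c t * \<phi> t) (at t within {0..1})"
    and c: "continuous_on {0..1} c" and 0: "\<phi> 0 = 0"
  shows "\<phi> 1 = 0"
proof -
  define C where "C t = integral {0..t} c" for t
  have C: "(C has_real_derivative c t) (at t within {0..1})" if "t \<in> {0..1}" for t
    unfolding C_def has_real_derivative_iff_has_vector_derivative
    by (rule integral_has_vector_derivative[OF c that])
  have "((\<lambda>t. \<phi> t * exp (- C t)) has_real_derivative 0) (at t within {0..1})" if "t \<in> {0..1}" for t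
    by (rule derivative_eq_intros d[OF that] C[OF that] refl | simp)+
  then obtain k where "\<And>t. t \<in> {0..1} \<Longrightarrow> \<phi> t * exp (- C t) = k"
    using has_field_derivative_zero_constant[of "{0..1::real}" "\<lambda>t. \<phi> t * exp (- C t)"] by auto
  from this[of 0] this[of 1] 0 show ?thesis by auto
qed

section \<open>Linear algebra of the Lie inner product\<close>

lemma bounded_bilinear_lip: "bounded_bilinear lip"
proof
  show "\<exists>K. \<forall>a b. norm (lip a b) \<le> norm a * norm b * K"
  proof (intro exI allI)
    fix a b :: r42
    have le: "norm (fst c) \<le> norm c" "norm (snd c) \<le> norm c" for c :: r42
      by (cases c; simp add: norm_fst_le norm_snd_le)+
    have "\<bar>fst a \<bullet> fst b\<bar> \<le> norm a * norm b" "\<bar>snd a \<bullet> snd b\<bar> \<le> norm a * norm b"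
      using order_trans[OF Cauchy_Schwarz_ineq2 mult_mono[OF le(1) le(1)]]
        order_trans[OF Cauchy_Schwarz_ineq2 mult_mono[OF le(2) le(2)]] by auto
    then show "norm (lip a b) \<le> norm a * norm b * 2" by (simp add: lip_def)
  qed
qed (auto simp: lip_def algebra_simps inner_simps)

interpretation lip: bounded_bilinear lip by (rule bounded_bilinear_lip)

lemma lip_commute: "lip x y = lip y x"
  by (simp add: lip_def inner_commute)

lemmas lip_simps = lip.add_left lip.add_right lip.diff_left lip.diff_right lip.scaleR_left lip.scaleR_right
  lip.minus_left lip.minus_right lip.zero_left lip.zero_right

text \<open>In signature (4,2) the plane of p and F already takes up both negative directions.
  Concretely, some combination of w, p and F with a nonzero coefficient at w has no negative
  coordinates left.\<close>

lemma lip_definite_complement: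
  assumes p: "lip p p = -1" and F: "lip F F = -1" and pF: "lip p F = 0"
    and wp: "lip w p = 0" and wF: "lip w F = 0"
  shows "lip w w \<ge> 0" "lip w w = 0 \<Longrightarrow> w = 0"
proof -
  \<comment> \<open>The cross product of the two rows formed by the negative coordinates of w, p, F,
    so that x w + y p + z F loses both of these coordinates. Cauchy-Schwarz on the positive parts
    gives x^2 \<ge> 1.\<close>
  define x y z where "x = snd p $ 1 * snd F $ 2 - snd p $ 2 * snd F $ 1"
    and "y = snd F $ 1 * snd w $ 2 - snd F $ 2 * snd w $ 1"
    and "z = snd w $ 1 * snd p $ 2 - snd w $ 2 * snd p $ 1"
  have inner2: "a \<bullet> b = a $ 1 * b $ 1 + a $ 2 * b $ 2" for a b :: "real^2"
    by (simp add: inner_vec_def sum_2)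
  have "x\<^sup>2 = (snd p \<bullet> snd p) * (snd F \<bullet> snd F) - (snd p \<bullet> snd F)\<^sup>2"
    unfolding x_def inner2 by (simp add: power2_eq_square algebra_simps)
  also have "\<dots> = (1 + fst p \<bullet> fst p) * (1 + fst F \<bullet> fst F) - (fst p \<bullet> fst F)\<^sup>2"
    using p F pF by (simp add: lip_def algebra_simps)
  also have "\<dots> \<ge> 1"
  proof -
    have "(fst p \<bullet> fst F)\<^sup>2 \<le> (fst p \<bullet> fst p) * (fst F \<bullet> fst F)" by (rule Cauchy_Schwarz_ineq)
    moreover have "fst p \<bullet> fst p \<ge> 0" "fst F \<bullet> fst F \<ge> 0" by auto
    ultimately show ?thesis by (auto simp: algebra_simps intro: add_nonneg_nonneg order_trans)
  qed
  finally have x: "x\<^sup>2 \<ge> 1" .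
  define v where "v = x *\<^sub>R w + y *\<^sub>R p + z *\<^sub>R F"
  have sv: "snd v = 0"
    by (simp add: v_def vec_eq_iff forall_2 x_def y_def z_def algebra_simps)
  have "lip v v = x\<^sup>2 * lip w w - y\<^sup>2 - z\<^sup>2"
    unfolding v_def using assms lip_commute[of p w] lip_commute[of F w] lip_commute[of F p]
    by (simp add: lip_simps power2_eq_square algebra_simps)
  moreover have vv: "lip v v = fst v \<bullet> fst v" using sv by (simp add: lip_def)
  ultimately have eq: "x\<^sup>2 * lip w w = fst v \<bullet> fst v + y\<^sup>2 + z\<^sup>2" by simp
  then have "x\<^sup>2 * lip w w \<ge> 0" by simp
  then show "lip w w \<ge> 0" using x by (auto simp: zero_le_mult_iff)
  assume "lip w w = 0"
  then have "fst v \<bullet> fst v + (y\<^sup>2 + z\<^sup>2) = 0" using eq by simp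
  then have "fst v \<bullet> fst v = 0 \<and> y\<^sup>2 = 0 \<and> z\<^sup>2 = 0"
    by (subst (asm) add_nonneg_eq_0_iff) (simp_all add: add_nonneg_eq_0_iff)
  then have "v = 0" "y = 0" "z = 0" using sv by (auto simp: prod_eq_iff)
  moreover have "x \<noteq> 0" using x by auto
  ultimately show "w = 0" unfolding v_def by simp
qed

text \<open>Two orthogonal hyperbolic pairs. The value -2 gives the half sums of each pair the
  square -1 and the half differences the square 1, the squares of p, F and of q, T.\<close>

definition null_frame :: "r42 \<Rightarrow> r42 \<Rightarrow> r42 \<Rightarrow> r42 \<Rightarrow> bool" where
  "null_frame k l P N \<longleftrightarrow> lip k k = 0 \<and> lip l l = 0 \<and> lip k l = -2 \<and> lip P P = 0 \<and> lip N N = 0 \<and> lip P N = -2 \<and>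
     lip P k = 0 \<and> lip P l = 0 \<and> lip N k = 0 \<and> lip N l = 0"

definition frame_perp :: "r42 \<Rightarrow> r42 \<Rightarrow> r42 \<Rightarrow> r42 \<Rightarrow> r42 \<Rightarrow> bool" where
  "frame_perp k l P N w \<longleftrightarrow> lip w k = 0 \<and> lip w l = 0 \<and> lip w P = 0 \<and> lip w N = 0"

lemma null_frame_comm: "null_frame k l P N \<Longrightarrow>
   lip k P = 0 \<and> lip l P = 0 \<and> lip k N = 0 \<and> lip l N = 0 \<and> lip l k = -2 \<and> lip N P = -2"
  unfolding null_frame_def using lip_commute by metis

lemma frame_perp_linear:
  "frame_perp k l P N v \<Longrightarrow> frame_perp k l P N w \<Longrightarrow> frame_perp k l P N (v + w)"
  "frame_perp k l P N v \<Longrightarrow> frame_perp k l P N w \<Longrightarrow> frame_perp k l P N (v - w)"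
  "frame_perp k l P N v \<Longrightarrow> frame_perp k l P N (c *\<^sub>R v)"
  by (auto simp: frame_perp_def lip_simps)

lemma frame_perp_definite:
  assumes "null_frame k l P N" "frame_perp k l P N w"
  shows "lip w w \<ge> 0" "lip w w = 0 \<Longrightarrow> w = 0"
proof -
  let ?p = "(1/2) *\<^sub>R (k + l)" and ?F = "(1/2) *\<^sub>R (P + N)"
  have "lip ?p ?p = -1" "lip ?F ?F = -1" "lip ?p ?F = 0" "lip w ?p = 0" "lip w ?F = 0"
    using assms null_frame_comm[OF assms(1)] by (auto simp: null_frame_def frame_perp_def lip_simps)
  from lip_definite_complement[OF this] show "lip w w \<ge> 0" "lip w w = 0 \<Longrightarrow> w = 0" by auto
qed

definition gram :: "r42 \<Rightarrow> r42 \<Rightarrow> real" where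
  "gram X Y = lip X X * lip Y Y - (lip X Y)\<^sup>2"

text \<open>The vectors k, l, P, N, X, Y form a basis, since their Gram matrix is nondegenerate, and
  a vector orthogonal to a basis vanishes.\<close>

lemma frame_perp_dim2:
  assumes nf: "null_frame k l P N" and X: "frame_perp k l P N X" and Y: "frame_perp k l P N Y"
    and g: "gram X Y \<noteq> 0"
    and w: "frame_perp k l P N w" and wX: "lip w X = 0" and wY: "lip w Y = 0"
  shows "w = 0"
proof -
  \<comment> \<open>\<open>r42\<close> doubles as the space of the six coefficients, so that \<Psi>
    is an endomorphism and injectivity implies surjectivity.\<close>
  define \<Psi> :: "r42 \<Rightarrow> r42" where "\<Psi> x = fst x $ 1 *\<^sub>R k + fst x $ 2 *\<^sub>R l + fst x $ 3 *\<^sub>R P + fst x $ 4 *\<^sub>R N +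
     snd x $ 1 *\<^sub>R X + snd x $ 2 *\<^sub>R Y" for x
  have lin: "linear \<Psi>"
    by (rule linearI) (auto simp: \<Psi>_def algebra_simps)
  have perp: "lip X k = 0 \<and> lip k X = 0 \<and> lip X l = 0 \<and> lip l X = 0 \<and> lip X P = 0 \<and> lip P X = 0 \<and> lip X N = 0 \<and> lip N X = 0"
    if "frame_perp k l P N X" for X
    using that lip_commute unfolding frame_perp_def by metis
  have zero: "x = 0" if "lip (\<Psi> x) k = 0" "lip (\<Psi> x) l = 0" "lip (\<Psi> x) P = 0" "lip (\<Psi> x) N = 0"
     "lip (\<Psi> x) X = 0" "lip (\<Psi> x) Y = 0" for x
  proof -
    have 1: "fst x $ 2 = 0" "fst x $ 1 = 0" "fst x $ 3 = 0" "fst x $ 4 = 0"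
      using that(1-4) nf null_frame_comm[OF nf] perp[OF X] perp[OF Y]
      by (auto simp: \<Psi>_def lip_simps null_frame_def)
    have 2: "snd x $ 1 * lip X X + snd x $ 2 * lip X Y = 0" "snd x $ 1 * lip X Y + snd x $ 2 * lip Y Y = 0"
      using that(5-6) 1 lip_commute[of Y X] by (auto simp: \<Psi>_def lip_simps)
    have "snd x $ 1 * gram X Y = 0" "snd x $ 2 * gram X Y = 0"
      using 2 unfolding gram_def by algebra+
    then have "snd x $ 1 = 0" "snd x $ 2 = 0" using g by auto
    with 1 show ?thesis by (auto simp: prod_eq_iff vec_eq_iff forall_2 forall_4)
  qed
  have "inj \<Psi>" unfolding linear_injective_0[OF lin]
    by (intro allI impI, rule zero) (simp_all add: lip_simps)
  then obtain x where x: "w = \<Psi> x"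
    using linear_injective_imp_surjective[OF lin] by (metis surjD)
  with zero[of x] w wX wY have "x = 0" by (auto simp: frame_perp_def)
  then show ?thesis using x linear_0[OF lin] by simp
qed

text \<open>The Gram-Schmidt combination of X and Y has the square |Y|^2 times the Gram determinant,
  hence is null, and the product is definite on the complement of a null frame.\<close>

lemma gram_zero_dependent:
  assumes nf: "null_frame k l P N" and X: "frame_perp k l P N X" and Y: "frame_perp k l P N Y"
    and g: "gram X Y = 0"
  obtains a b where "(a, b) \<noteq> (0, 0)" "a *\<^sub>R X + b *\<^sub>R Y = 0"
proof (cases "Y = 0")
  case True
  then show ?thesis using that[of 0 1] by simp
next
  case False
  let ?v = "lip Y Y *\<^sub>R X + (- lip X Y) *\<^sub>R Y"
  have "lip ?v ?v = lip Y Y * gram X Y"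
    by (simp add: lip_simps gram_def power2_eq_square lip_commute[of Y X] algebra_simps)
  then have "?v = 0"
    using frame_perp_definite(2)[OF nf, of ?v] g X Y frame_perp_linear by auto
  moreover have "lip Y Y \<noteq> 0" using False frame_perp_definite(2)[OF nf Y] by auto
  ultimately show ?thesis using that[of "lip Y Y" "- lip X Y"] by auto
qed

text \<open>In a null subspace the positive and the negative part of a vector have equal length, so
  the projection to the two negative coordinates is injective.\<close>

lemma null_subspace_dim_le:
  fixes W :: "r42 set"
  assumes "subspace W" "\<And>x. x \<in> W \<Longrightarrow> lip x x = 0"
  shows "dim W \<le> 2"
proof -
  have inj: "inj_on snd W"
  proof (rule inj_onI)
    fix x y assume xy: "x \<in> W" "y \<in> W" "snd x = snd y"
    then have "lip (x - y) (x - y) = 0" using assms subspace_diff by blast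
    then have "fst (x - y) \<bullet> fst (x - y) = 0" using xy(3) by (simp add: lip_def)
    then show "x = y" using xy(3) by (auto simp: prod_eq_iff)
  qed
  have "dim W = dim (snd ` W)"
    using dim_image_eq[of snd W] inj assms(1) linear_snd span_eq_iff by (metis (no_types, lifting))
  also have "\<dots> \<le> DIM(real^2)" by (rule dim_subset_UNIV)
  finally show ?thesis by simp
qed

text \<open>Otherwise w and f would span a null subspace of dimension 3. In terms of spheres: what
  touches all spheres of a contact element belongs to it.\<close>

lemma perp_contact_element:
  assumes f: "contact_element f" and w: "lip w w = 0" "\<And>y. y \<in> f \<Longrightarrow> lip y w = 0"
  shows "w \<in> f"
proof (rule ccontr)
  assume nin: "w \<notin> f"
  have sub: "subspace f" and d: "dim f = 2" and nul: "\<And>x y. x \<in> f \<Longrightarrow> y \<in> f \<Longrightarrow> lip x y = 0"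
    using f by (auto simp: contact_element_def)
  have "dim (span (insert w f)) \<le> 2"
  proof (rule null_subspace_dim_le[OF subspace_span])
    fix x assume "x \<in> span (insert w f)"
    then obtain c where "x - c *\<^sub>R w \<in> span f" using span_breakdown_eq by blast
    then have "x - c *\<^sub>R w \<in> f" using sub span_eq_iff by blast
    then obtain y where y: "y \<in> f" "x = y + c *\<^sub>R w" by (metis diff_add_cancel)
    then show "lip x x = 0"
      using nul[OF y(1) y(1)] w(1) w(2)[OF y(1)] lip_commute[of w y] by (simp add: lip_simps)
  qed
  moreover have "dim (insert w f) = 3"
    using nin sub d by (simp add: dim_insert span_eq_iff[THEN iffD2, OF sub])
  ultimately show False by simp
qed

section \<open>Null frames in coordinates\<close>

lemma smooth_on_lip: "open S \<Longrightarrow> smooth_on S g \<Longrightarrow> smooth_on S h \<Longrightarrow> smooth_on S (\<lambda>z. lip (g z) (h z))"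
  by (rule smooth_on_bilinear[OF bounded_bilinear_lip])

lemma D_lip:
  assumes "smooth_on S g" "smooth_on S h" "z \<in> S"
  shows "D\<^sub>u (\<lambda>x. lip (g x) (h x)) z = lip (g z) (D\<^sub>u h z) + lip (D\<^sub>u g z) (h z)"
    "D\<^sub>v (\<lambda>x. lip (g x) (h x)) z = lip (g z) (D\<^sub>v h z) + lip (D\<^sub>v g z) (h z)"
  using D_bilinear[OF bounded_bilinear_lip] smooth_on_differentiable assms by blast+

lemma D_const_on:
  assumes "open S" "z \<in> S" "\<And>x. x \<in> S \<Longrightarrow> g x = c"
  shows "D\<^sub>u g z = 0" "D\<^sub>v g z = 0"
  using D_cong_open[OF assms(1,2), of g "\<lambda>_. c"] assms(3)
    D_eq_derivative[of "\<lambda>_. c" "\<lambda>_. 0" z] by auto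

lemma D_lip_const:
  assumes "open S" "smooth_on S g" "smooth_on S h" "\<And>x. x \<in> S \<Longrightarrow> lip (g x) (h x) = c" "z \<in> S"
  shows "lip (D\<^sub>u g z) (h z) = - lip (g z) (D\<^sub>u h z)" "lip (D\<^sub>v g z) (h z) = - lip (g z) (D\<^sub>v h z)"
  using D_lip[OF assms(2,3,5)] D_const_on[OF assms(1,5), of "\<lambda>x. lip (g x) (h x)"] assms(4) by auto

text \<open>P and N read in coordinates. As P is orthogonal to l, \<open>contact\<close> is the
  contact condition for the sections k + P and N - l.\<close>

locale null_coords =
  fixes k l :: r42 and P N :: "real \<times> real \<Rightarrow> r42" and U :: "(real \<times> real) set"
  assumes open_U: "open U" and smP: "smooth_on U P" and smN: "smooth_on U N"
    and nf: "z \<in> U \<Longrightarrow> null_frame k l (P z) (N z)"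
    and contact: "z \<in> U \<Longrightarrow> lip (D\<^sub>u P z) (N z) = 0" "z \<in> U \<Longrightarrow> lip (D\<^sub>v P z) (N z) = 0"
begin

text \<open>The products of the frame are constant and can be differentiated; \<open>contact\<close>
  settles the products of dP with N and of dN with P.\<close>

lemma perp:
  assumes z: "z \<in> U"
  shows "frame_perp k l (P z) (N z) (D\<^sub>u P z)" "frame_perp k l (P z) (N z) (D\<^sub>v P z)"
    "frame_perp k l (P z) (N z) (D\<^sub>u N z)" "frame_perp k l (P z) (N z) (D\<^sub>v N z)"
proof -
  have c: "lip (D\<^sub>u g z) x = 0 \<and> lip (D\<^sub>v g z) x = 0" if "smooth_on U g" "\<And>y. y \<in> U \<Longrightarrow> lip (g y) x = 0" for g x
    using D_lip_const[OF open_U that(1) smooth_on_const[OF open_U] that(2) z]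
      D_const_on[OF open_U z, of "\<lambda>_. x" x] by (auto simp: lip_simps)
  have s: "lip (D\<^sub>u g z) (g z) = 0 \<and> lip (D\<^sub>v g z) (g z) = 0" if "smooth_on U g" "\<And>y. y \<in> U \<Longrightarrow> lip (g y) (g y) = 0" for g
    using D_lip_const[OF open_U that(1,1) that(2) z] lip_commute[of "g z"] by auto
  have PN: "lip (D\<^sub>u N z) (P z) = 0" "lip (D\<^sub>v N z) (P z) = 0"
    using D_lip_const[OF open_U smP smN, of "-2" z] nf z contact[OF z]
    by (auto simp: null_frame_def lip_commute[of "P z"])
  show "frame_perp k l (P z) (N z) (D\<^sub>u P z)" "frame_perp k l (P z) (N z) (D\<^sub>v P z)"
    "frame_perp k l (P z) (N z) (D\<^sub>u N z)" "frame_perp k l (P z) (N z) (D\<^sub>v N z)"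
    unfolding frame_perp_def
    using c[OF smP] c[OF smN] s[OF smP] s[OF smN] PN contact[OF z] nf unfolding null_frame_def by auto
qed

text \<open>Both sides equal - (P_uv, N), by differentiating \<open>contact\<close>. This is the
  symmetry of the second fundamental form, which later makes principal directions
  orthogonal.\<close>

lemma mixed_sym:
  assumes z: "z \<in> U"
  shows "lip (D\<^sub>u P z) (D\<^sub>v N z) = lip (D\<^sub>v P z) (D\<^sub>u N z)"
proof -
  have "lip (D\<^sub>v (D\<^sub>u P) z) (N z) = - lip (D\<^sub>u P z) (D\<^sub>v N z)"
    by (rule D_lip_const(2)[OF open_U smooth_on_D(1)[OF smP] smN contact(1) z])
  moreover have "lip (D\<^sub>u (D\<^sub>v P) z) (N z) = - lip (D\<^sub>v P z) (D\<^sub>u N z)"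
    by (rule D_lip_const(1)[OF open_U smooth_on_D(2)[OF smP] smN contact(2) z])
  ultimately show ?thesis using mixed_partials[OF smP open_U z] by simp
qed

definition H where "H z = (1/2) *\<^sub>R (P z + N z)"
definition T where "T z = (1/2) *\<^sub>R (P z - N z)"

lemma smH: "smooth_on U H" and smT: "smooth_on U T"
  unfolding H_def[abs_def] T_def[abs_def]
  by (intro smooth_on_linear[OF bounded_linear_scaleR_right open_U] smooth_on_add smooth_on_diff open_U smP smN)+

lemma D_HT:
  assumes "z \<in> U"
  shows "D\<^sub>u H z = (1/2) *\<^sub>R (D\<^sub>u P z + D\<^sub>u N z)" "D\<^sub>v H z = (1/2) *\<^sub>R (D\<^sub>v P z + D\<^sub>v N z)"
    "D\<^sub>u T z = (1/2) *\<^sub>R (D\<^sub>u P z - D\<^sub>u N z)" "D\<^sub>v T z = (1/2) *\<^sub>R (D\<^sub>v P z - D\<^sub>v N z)"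
proof -
  have d: "P differentiable (at z)" "N differentiable (at z)"
    using smP smN assms smooth_on_differentiable by blast+
  then have "(P has_derivative frechet_derivative P (at z)) (at z)" "(N has_derivative frechet_derivative N (at z)) (at z)"
    using frechet_derivative_works by blast+
  then have "(H has_derivative (\<lambda>w. (1/2) *\<^sub>R (frechet_derivative P (at z) w + frechet_derivative N (at z) w))) (at z)"
    "(T has_derivative (\<lambda>w. (1/2) *\<^sub>R (frechet_derivative P (at z) w - frechet_derivative N (at z) w))) (at z)"
    unfolding H_def[abs_def] T_def[abs_def] by (auto intro!: derivative_intros)
  note this[THEN D_eq_derivative(1)] this[THEN D_eq_derivative(2)]
  then show "D\<^sub>u H z = (1/2) *\<^sub>R (D\<^sub>u P z + D\<^sub>u N z)" "D\<^sub>v H z = (1/2) *\<^sub>R (D\<^sub>v P z + D\<^sub>v N z)"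
    "D\<^sub>u T z = (1/2) *\<^sub>R (D\<^sub>u P z - D\<^sub>u N z)" "D\<^sub>v T z = (1/2) *\<^sub>R (D\<^sub>v P z - D\<^sub>v N z)"
    by (simp_all add: D\<^sub>u_def D\<^sub>v_def)
qed

lemma perp_HT:
  assumes "z \<in> U"
  shows "frame_perp k l (P z) (N z) (D\<^sub>u H z)" "frame_perp k l (P z) (N z) (D\<^sub>v H z)"
    "frame_perp k l (P z) (N z) (D\<^sub>u T z)" "frame_perp k l (P z) (N z) (D\<^sub>v T z)"
  unfolding D_HT[OF assms] using perp[OF assms] frame_perp_linear by auto

end

section \<open>The Gauss equation\<close>

text \<open>Brioschi's determinants after insertion of the Gauss formula: a, b and their primed
  versions are Christoffel symbols, L, M, N the second fundamental form. The terms
  \<open>- E * G\<close> and \<open>- F * F\<close> come from the components along the position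
  vector, whose square is -1.\<close>

lemma brioschi_identity:
  fixes E F G :: real
  assumes uu: "uuX = a * E + b * F" "uuY = a * F + b * G"
    and vv: "vvX = a' * E + b' * F" "vvY = a' * F + b' * G"
    and w: "wX = a'' * E + b'' * F" "wY = a'' * F + b'' * G"
    and uuvv: "uuvv = L * N - E * G + a * a' * E + (a * b' + b * a') * F + b * b' * G"
    and ww: "ww = M * M - F * F + a'' * a'' * E + 2 * (a'' * b'') * F + b'' * b'' * G"
  shows "det (vector [vector [uuvv - ww, uuX, uuY], vector [vvX, E, F], vector [vvY, F, G]] :: real^3^3)
    - det (vector [vector [0, wX, wY], vector [wX, E, F], vector [wY, F, G]] :: real^3^3)
    = (L * N - M\<^sup>2 - (E * G - F\<^sup>2)) * (E * G - F\<^sup>2)"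
  unfolding det_3 vector_3 assms by (simp add: power2_eq_square algebra_simps)

context null_coords begin

text \<open>The Gauss equation: the intrinsic curvature is the extrinsic one minus 1.\<close>

lemma curvature_zero_iff:
  assumes z: "z \<in> U" and g: "gram (D\<^sub>u H z) (D\<^sub>v H z) \<noteq> 0"
  shows "metric_curvature (\<lambda>z. lip (D\<^sub>u H z) (D\<^sub>u H z)) (\<lambda>z. lip (D\<^sub>u H z) (D\<^sub>v H z)) (\<lambda>z. lip (D\<^sub>v H z) (D\<^sub>v H z)) z = 0
    \<longleftrightarrow> lip (D\<^sub>u H z) (D\<^sub>u T z) * lip (D\<^sub>v H z) (D\<^sub>v T z) - (lip (D\<^sub>u H z) (D\<^sub>v T z))\<^sup>2 = gram (D\<^sub>u H z) (D\<^sub>v H z)"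
proof -
  define X Y where XY: "X = D\<^sub>u H" "Y = D\<^sub>v H"
  let ?E = "\<lambda>z. lip (X z) (X z)" and ?F = "\<lambda>z. lip (X z) (Y z)" and ?G = "\<lambda>z. lip (Y z) (Y z)"
  define W where "W = D\<^sub>v X"
  define uu vv w where uvw: "uu = D\<^sub>u X z" "vv = D\<^sub>v Y z" "w = W z"
  have smX: "smooth_on U X" and smY: "smooth_on U Y" and smW: "smooth_on U W"
    using smH smooth_on_D unfolding XY W_def by blast+
  have YW: "D\<^sub>u Y x = W x" if "x \<in> U" for x
    using mixed_partials[OF smH open_U that] by (simp add: XY W_def)
  note lc = lip_commute
  note DX = D_lip[OF smX smX] and DF = D_lip[OF smX smY] and DY = D_lip[OF smY smY]
  have Eu: "D\<^sub>u ?E z = 2 * lip uu (X z)" and Ev: "\<And>x. x \<in> U \<Longrightarrow> D\<^sub>v ?E x = 2 * lip (W x) (X x)"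
    using DX z by (auto simp: uvw W_def lc)
  have Gv: "D\<^sub>v ?G z = 2 * lip vv (Y z)" and Gu: "\<And>x. x \<in> U \<Longrightarrow> D\<^sub>u ?G x = 2 * lip (W x) (Y x)"
    using DY z YW by (auto simp: uvw lc)
  have Fv: "D\<^sub>v ?F z = lip vv (X z) + lip w (Y z)" and Fu: "\<And>x. x \<in> U \<Longrightarrow> D\<^sub>u ?F x = lip (X x) (W x) + lip (D\<^sub>u X x) (Y x)"
    using DF z YW by (auto simp: uvw W_def lc)
  have Evv: "D\<^sub>v (D\<^sub>v ?E) z = 2 * (lip w w + lip (D\<^sub>v W z) (X z))"
  proof -
    have "D\<^sub>v (D\<^sub>v ?E) z = D\<^sub>v (\<lambda>x. 2 * lip (W x) (X x)) z"
      by (rule D_cong_open(2)[OF open_U z Ev])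
    also have "\<dots> = 2 * D\<^sub>v (\<lambda>x. lip (W x) (X x)) z"
      using D_linear(2)[OF bounded_linear_mult_right] smooth_on_differentiable[OF smooth_on_lip[OF open_U smW smX] z] by blast
    also have "\<dots> = 2 * (lip w w + lip (D\<^sub>v W z) (X z))"
      using D_lip(2)[OF smW smX z] by (simp add: uvw W_def)
    finally show ?thesis .
  qed
  have Guu: "D\<^sub>u (D\<^sub>u ?G) z = 2 * (lip w w + lip (D\<^sub>u W z) (Y z))"
  proof -
    have "D\<^sub>u (D\<^sub>u ?G) z = D\<^sub>u (\<lambda>x. 2 * lip (W x) (Y x)) z"
      by (rule D_cong_open(1)[OF open_U z Gu])
    also have "\<dots> = 2 * D\<^sub>u (\<lambda>x. lip (W x) (Y x)) z"
      using D_linear(1)[OF bounded_linear_mult_right] smooth_on_differentiable[OF smooth_on_lip[OF open_U smW smY] z] by blast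
    also have "\<dots> = 2 * (lip w w + lip (D\<^sub>u W z) (Y z))"
      using D_lip(1)[OF smW smY z] YW[OF z] by (simp add: uvw)
    finally show ?thesis .
  qed
  have Fuv: "D\<^sub>v (D\<^sub>u ?F) z = lip (X z) (D\<^sub>v W z) + lip w w + lip uu vv + lip (D\<^sub>u W z) (Y z)"
  proof -
    have sDX: "smooth_on U (D\<^sub>u X)" using smX smooth_on_D by blast
    have "D\<^sub>v (D\<^sub>u ?F) z = D\<^sub>v (\<lambda>x. lip (X x) (W x) + lip (D\<^sub>u X x) (Y x)) z"
      by (rule D_cong_open(2)[OF open_U z Fu])
    also have "\<dots> = D\<^sub>v (\<lambda>x. lip (X x) (W x)) z + D\<^sub>v (\<lambda>x. lip (D\<^sub>u X x) (Y x)) z"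
      by (rule D_add(2); rule smooth_on_differentiable[OF smooth_on_lip[OF open_U] z]) (fact smX smW sDX smY)+
    also have "\<dots> = lip (X z) (D\<^sub>v W z) + lip w w + lip uu vv + lip (D\<^sub>v (D\<^sub>u X) z) (Y z)"
      using D_lip(2)[OF smX smW z] D_lip(2)[OF sDX smY z] by (simp add: uvw W_def)
    finally show ?thesis using mixed_partials[OF smX open_U z] by (simp add: W_def)
  qed
  have nfz: "null_frame k l (P z) (N z)" using nf[OF z] .
  have H: "lip (H z) (H z) = -1" "lip (T z) (T z) = 1" "lip (H z) (T z) = 0" "lip (T z) (H z) = 0"
    "lip (H z) k = 0" "lip (H z) l = 0" "lip (T z) k = 0" "lip (T z) l = 0"
    using nfz null_frame_comm[OF nfz] by (auto simp: null_frame_def H_def T_def lip_simps)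
  have PN: "P z = H z + T z" "N z = H z - T z"
    by (auto simp: H_def T_def algebra_simps simp flip: scaleR_add_left)
  have orth: "lip (X x) (H x) = 0" "lip (Y x) (H x) = 0" "lip (X x) (T x) = 0" "lip (Y x) (T x) = 0"
    "lip (X x) k = 0" "lip (Y x) k = 0" "lip (X x) l = 0" "lip (Y x) l = 0" if "x \<in> U" for x
    using perp_HT[OF that] by (auto simp: XY frame_perp_def H_def T_def lip_simps)
  have orth': "lip (H z) (X z) = 0" "lip (H z) (Y z) = 0" "lip (T z) (X z) = 0" "lip (T z) (Y z) = 0"
    using orth[OF z] lc by metis+
  note dc = D_lip_const[OF open_U _ _ _ z]
  have kl: "lip (D\<^sub>u A z) y = 0" "lip (D\<^sub>v A z) y = 0" if "smooth_on U A" "\<And>x. x \<in> U \<Longrightarrow> lip (A x) y = 0" for A y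
    using dc[OF that(1) smooth_on_const[OF open_U], of y 0] that(2) D_const_on[OF open_U z, of "\<lambda>_. y" y]
    by (auto simp: lip_simps)
  define L M M' N' where LMN: "L = - lip (X z) (D\<^sub>u T z)" "M = - lip (X z) (D\<^sub>v T z)" "M' = - lip (Y z) (D\<^sub>u T z)" "N' = - lip (Y z) (D\<^sub>v T z)"
  have uuh: "lip uu (H z) = - ?E z" "lip w (H z) = - ?F z" "lip vv (H z) = - ?G z"
    "lip uu (T z) = L" "lip w (T z) = M" "lip vv (T z) = N'"
    using dc[OF smX smH, of 0] dc[OF smY smH, of 0] dc[OF smX smT, of 0] dc[OF smY smT, of 0] orth
    unfolding uvw W_def LMN XY by auto
  have uvk: "lip x k = 0" "lip x l = 0" if "x \<in> {uu, vv, w}" for x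
    using that kl[OF smX orth(5)] kl[OF smX orth(7)] kl[OF smY orth(6)] kl[OF smY orth(8)]
    unfolding uvw W_def by auto
  define \<Delta> where "\<Delta> = gram (X z) (Y z)"
  have \<Delta>0: "\<Delta> \<noteq> 0" using g by (simp add: \<Delta>_def XY)
  have \<Delta>: "\<Delta> = ?E z * ?G z - (?F z)\<^sup>2" by (simp add: \<Delta>_def gram_def)
  \<comment> \<open>X, Y, T, H span the complement of k and l. Cramer's rule for the Gram matrix
    gives a and b, the coefficient of H has a minus sign because H has square -1, and the remainder
    y is orthogonal to a basis.\<close>
  have expand: "\<exists>a b. x = a *\<^sub>R X z + b *\<^sub>R Y z + lip x (T z) *\<^sub>R T z - lip x (H z) *\<^sub>R H z"
    if x: "lip x k = 0" "lip x l = 0" for x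
  proof -
    define a b where "a = (lip x (X z) * ?G z - lip x (Y z) * ?F z) / \<Delta>"
      and "b = (lip x (Y z) * ?E z - lip x (X z) * ?F z) / \<Delta>"
    define y where "y = x - lip x (T z) *\<^sub>R T z + lip x (H z) *\<^sub>R H z - a *\<^sub>R X z - b *\<^sub>R Y z"
    have ab: "a * ?E z + b * ?F z = lip x (X z)" "a * ?F z + b * ?G z = lip x (Y z)"
    proof -
      have "a * ?E z + b * ?F z = lip x (X z) * \<Delta> / \<Delta>" "a * ?F z + b * ?G z = lip x (Y z) * \<Delta> / \<Delta>"
        unfolding a_def b_def \<Delta> by (auto simp: power2_eq_square algebra_simps add_divide_distrib diff_divide_distrib)
      then show "a * ?E z + b * ?F z = lip x (X z)" "a * ?F z + b * ?G z = lip x (Y z)" using \<Delta>0 by auto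
    qed
    have "lip y (X z) = 0" "lip y (Y z) = 0"
      using ab lc[of "Y z" "X z"] orth' by (auto simp: y_def lip_simps)
    moreover have "frame_perp k l (P z) (N z) y"
      unfolding frame_perp_def PN using x H orth[OF z] by (auto simp: y_def lip_simps)
    ultimately have "y = 0"
      using frame_perp_dim2[OF nfz, of "X z" "Y z" y] perp_HT[OF z] g by (auto simp: XY)
    then have "x = a *\<^sub>R X z + b *\<^sub>R Y z + lip x (T z) *\<^sub>R T z - lip x (H z) *\<^sub>R H z"
      by (simp add: y_def algebra_simps)
    then show ?thesis by blast
  qed
  obtain a b where uu: "uu = a *\<^sub>R X z + b *\<^sub>R Y z + L *\<^sub>R T z + ?E z *\<^sub>R H z"
    using expand[of uu] uvk[of uu] uuh by auto
  obtain a' b' where vv: "vv = a' *\<^sub>R X z + b' *\<^sub>R Y z + N' *\<^sub>R T z + ?G z *\<^sub>R H z"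
    using expand[of vv] uvk[of vv] uuh by auto
  obtain a'' b'' where w: "w = a'' *\<^sub>R X z + b'' *\<^sub>R Y z + M *\<^sub>R T z + ?F z *\<^sub>R H z"
    using expand[of w] uvk[of w] uuh by auto
  have num: "det (vector [vector [lip uu vv - lip w w, lip uu (X z), lip uu (Y z)], vector [lip vv (X z), ?E z, ?F z], vector [lip vv (Y z), ?F z, ?G z]] :: real^3^3)
    - det (vector [vector [0, lip w (X z), lip w (Y z)], vector [lip w (X z), ?E z, ?F z], vector [lip w (Y z), ?F z, ?G z]] :: real^3^3)
    = (L * N' - M\<^sup>2 - (?E z * ?G z - (?F z)\<^sup>2)) * (?E z * ?G z - (?F z)\<^sup>2)"
    by (rule brioschi_identity[where a=a and b=b and a'=a' and b'=b' and a''=a'' and b''=b''])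
      (simp_all add: uu vv w lip_simps H orth[OF z] orth' lc[of "Y z" "X z"] algebra_simps)
  \<comment> \<open>The third derivatives of H cancel in the first entry, leaving (H_uu, H_vv) -
    (H_uv, H_uv).\<close>
  have entries: "- D\<^sub>v (D\<^sub>v ?E) z / 2 + D\<^sub>v (D\<^sub>u ?F) z - D\<^sub>u (D\<^sub>u ?G) z / 2 = lip uu vv - lip w w"
    "D\<^sub>u ?E z / 2 = lip uu (X z)" "D\<^sub>u ?F z - D\<^sub>v ?E z / 2 = lip uu (Y z)"
    "D\<^sub>v ?F z - D\<^sub>u ?G z / 2 = lip vv (X z)" "D\<^sub>v ?G z / 2 = lip vv (Y z)"
    "D\<^sub>v ?E z / 2 = lip w (X z)" "D\<^sub>u ?G z / 2 = lip w (Y z)"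
    unfolding Evv Fuv Guu Eu Gv Ev[OF z] Gu[OF z] Fv Fu[OF z]
    by (simp_all add: uvw lc add_divide_distrib diff_divide_distrib)
  have "metric_curvature ?E ?F ?G z = (L * N' - M\<^sup>2 - \<Delta>) * \<Delta> / \<Delta>\<^sup>2"
    unfolding metric_curvature_def entries(1,3,4) unfolding entries(2,5-7) num \<Delta> by simp
  then have "metric_curvature ?E ?F ?G z = 0 \<longleftrightarrow> L * N' - M\<^sup>2 = \<Delta>"
    using \<Delta>0 by simp
  then show ?thesis by (simp add: LMN \<Delta>_def XY power2_eq_square)
qed

end

section \<open>Principal directions at a point\<close>

text \<open>A change of basis multiplies the determinant of a symmetric form by a squared area. The
  fundamental forms can therefore be compared in a principal basis instead of the coordinate
  basis.\<close>

lemma form_det: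
  fixes L M N :: real
  assumes "Q = (\<lambda>\<xi> \<eta>. L * (fst \<xi> * fst \<eta>) + M * (fst \<xi> * snd \<eta> + snd \<xi> * fst \<eta>) + N * (snd \<xi> * snd \<eta>))"
  shows "Q \<xi> \<xi> * Q \<eta> \<eta> - (Q \<xi> \<eta>)\<^sup>2 = (L * N - M\<^sup>2) * (fst \<xi> * snd \<eta> - snd \<xi> * fst \<eta>)\<^sup>2"
  unfolding assms by (simp add: power2_eq_square algebra_simps)

text \<open>At a point, \<open>a\<close> and \<open>b\<close> below are the values of \<open>dP\<close> and \<open>dN\<close>.\<close>

locale two_curvature_directions =
  fixes k l P N X1 X2 Y1 Y2 :: r42 and \<xi> \<eta> :: "real \<times> real" and \<alpha>1 \<beta>1 \<alpha>2 \<beta>2 :: real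
  assumes nf: "null_frame k l P N"
    and perp: "frame_perp k l P N X1" "frame_perp k l P N X2" "frame_perp k l P N Y1" "frame_perp k l P N Y2"
    and sym: "lip X1 Y2 = lip X2 Y1"
    and reg: "\<And>\<zeta>. fst \<zeta> *\<^sub>R X1 + snd \<zeta> *\<^sub>R X2 = 0 \<Longrightarrow> fst \<zeta> *\<^sub>R Y1 + snd \<zeta> *\<^sub>R Y2 = 0 \<Longrightarrow> \<zeta> = 0"
    and nz: "\<xi> \<noteq> 0" "\<eta> \<noteq> 0" and distinct: "\<alpha>1 * \<beta>2 - \<alpha>2 * \<beta>1 \<noteq> 0"
    and c1: "\<alpha>1 *\<^sub>R (fst \<xi> *\<^sub>R X1 + snd \<xi> *\<^sub>R X2) + \<beta>1 *\<^sub>R (fst \<xi> *\<^sub>R Y1 + snd \<xi> *\<^sub>R Y2) = 0"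
    and c2: "\<alpha>2 *\<^sub>R (fst \<eta> *\<^sub>R X1 + snd \<eta> *\<^sub>R X2) + \<beta>2 *\<^sub>R (fst \<eta> *\<^sub>R Y1 + snd \<eta> *\<^sub>R Y2) = 0"
begin

definition a where "a \<zeta> = fst \<zeta> *\<^sub>R X1 + snd \<zeta> *\<^sub>R X2"
definition b where "b \<zeta> = fst \<zeta> *\<^sub>R Y1 + snd \<zeta> *\<^sub>R Y2"

lemma sym_ab: "lip (a \<zeta>) (b \<theta>) = lip (a \<theta>) (b \<zeta>)"
  using sym by (simp add: a_def b_def lip_simps algebra_simps)

lemma perp_ab: "frame_perp k l P N (a \<zeta>)" "frame_perp k l P N (b \<zeta>)"
  unfolding a_def b_def using perp frame_perp_linear by auto

text \<open>Along a curvature direction dP and dN are multiples of a common vector w. The case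
  distinction allows for \<beta> = 0, where w is read off from dN. By \<open>reg\<close> w is not
  zero, so its square is positive.\<close>

lemma param_direction:
  assumes "\<alpha> *\<^sub>R a \<zeta> + \<beta> *\<^sub>R b \<zeta> = 0" "\<zeta> \<noteq> 0" "(\<alpha>, \<beta>) \<noteq> (0, 0)"
  obtains w where "a \<zeta> = \<beta> *\<^sub>R w" "b \<zeta> = (- \<alpha>) *\<^sub>R w" "lip w w > 0"
proof -
  have ne: "a \<zeta> \<noteq> 0 \<or> b \<zeta> \<noteq> 0" using reg[of \<zeta>] assms(2) by (auto simp: a_def b_def)
  have "\<exists>w. a \<zeta> = \<beta> *\<^sub>R w \<and> b \<zeta> = (- \<alpha>) *\<^sub>R w \<and> frame_perp k l P N w"
  proof (cases "\<beta> = 0")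
    case True
    then have "\<alpha> \<noteq> 0" "a \<zeta> = 0" using assms by auto
    then show ?thesis using True frame_perp_linear(3)[OF perp_ab(2), of "- (1 / \<alpha>)" \<zeta>]
      by (intro exI[of _ "(- (1 / \<alpha>)) *\<^sub>R b \<zeta>"]) auto
  next
    case False
    have "\<beta> *\<^sub>R b \<zeta> = (- \<alpha>) *\<^sub>R a \<zeta>" using assms(1) by (simp add: eq_neg_iff_add_eq_0 add.commute)
    then have "(1 / \<beta>) *\<^sub>R (\<beta> *\<^sub>R b \<zeta>) = (1 / \<beta>) *\<^sub>R ((- \<alpha>) *\<^sub>R a \<zeta>)" by simp
    then have "b \<zeta> = (- \<alpha>) *\<^sub>R ((1 / \<beta>) *\<^sub>R a \<zeta>)" using False by simp
    then show ?thesis using False frame_perp_linear(3)[OF perp_ab(1), of "1 / \<beta>" \<zeta>]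
      by (intro exI[of _ "(1 / \<beta>) *\<^sub>R a \<zeta>"]) auto
  qed
  then obtain w where w: "a \<zeta> = \<beta> *\<^sub>R w" "b \<zeta> = (- \<alpha>) *\<^sub>R w" "frame_perp k l P N w" by blast
  moreover have "lip w w > 0"
    using frame_perp_definite[OF nf w(3)] ne w(1,2) by (metis less_eq_real_def scaleR_zero_right)
  ultimately show ?thesis using that by blast
qed

text \<open>Inserted into \<open>sym_ab\<close>, the common vectors give (\<alpha>1 \<beta>2 -
  \<alpha>2 \<beta>1) (v, w) = 0, so they are orthogonal. A nontrivial relation between \<xi> and
  \<eta>, paired with v and w, would annihilate one of the two coefficient pairs.\<close>

lemma directions:
  obtains v w where "a \<xi> = \<beta>1 *\<^sub>R v" "b \<xi> = (- \<alpha>1) *\<^sub>R v" "a \<eta> = \<beta>2 *\<^sub>R w" "b \<eta> = (- \<alpha>2) *\<^sub>R w"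
    "lip v v > 0" "lip w w > 0" "lip v w = 0" "fst \<xi> * snd \<eta> - snd \<xi> * fst \<eta> \<noteq> 0"
proof -
  have "\<alpha>1 *\<^sub>R a \<xi> + \<beta>1 *\<^sub>R b \<xi> = 0" "(\<alpha>1, \<beta>1) \<noteq> (0, 0)" using c1 distinct by (auto simp: a_def b_def)
  from param_direction[OF this(1) nz(1) this(2)] obtain v where
    v: "a \<xi> = \<beta>1 *\<^sub>R v" "b \<xi> = (- \<alpha>1) *\<^sub>R v" "lip v v > 0" .
  have "\<alpha>2 *\<^sub>R a \<eta> + \<beta>2 *\<^sub>R b \<eta> = 0" "(\<alpha>2, \<beta>2) \<noteq> (0, 0)" using c2 distinct by (auto simp: a_def b_def)
  from param_direction[OF this(1) nz(2) this(2)] obtain w where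
    w: "a \<eta> = \<beta>2 *\<^sub>R w" "b \<eta> = (- \<alpha>2) *\<^sub>R w" "lip w w > 0" .
  have "(\<alpha>1 * \<beta>2 - \<alpha>2 * \<beta>1) * lip v w = 0"
    using sym_ab[of \<xi> \<eta>] unfolding v(1,2) w(1,2) lip_simps real_scaleR_def lip_commute[of w v] by algebra
  then have vw: "lip v w = 0" using distinct by simp
  have "fst \<xi> * snd \<eta> - snd \<xi> * fst \<eta> \<noteq> 0"
  proof
    assume 0: "fst \<xi> * snd \<eta> - snd \<xi> * fst \<eta> = 0"
    have "\<exists>c d. (c, d) \<noteq> (0, 0) \<and> c * fst \<xi> + d * fst \<eta> = 0 \<and> c * snd \<xi> + d * snd \<eta> = 0"
    proof (cases "fst \<xi> = 0 \<and> fst \<eta> = 0")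
      case True
      then have "snd \<xi> \<noteq> 0" using nz by (auto simp: prod_eq_iff)
      then show ?thesis using True by (intro exI[of _ "snd \<eta>"] exI[of _ "- snd \<xi>"]) auto
    next
      case False
      then show ?thesis using 0 by (intro exI[of _ "fst \<eta>"] exI[of _ "- fst \<xi>"]) (auto simp: algebra_simps)
    qed
    then obtain c d where cd: "(c, d) \<noteq> (0, 0)" "c * fst \<xi> + d * fst \<eta> = 0" "c * snd \<xi> + d * snd \<eta> = 0" by blast
    have "c *\<^sub>R a \<xi> + d *\<^sub>R a \<eta> = (c * fst \<xi> + d * fst \<eta>) *\<^sub>R X1 + (c * snd \<xi> + d * snd \<eta>) *\<^sub>R X2"
      "c *\<^sub>R b \<xi> + d *\<^sub>R b \<eta> = (c * fst \<xi> + d * fst \<eta>) *\<^sub>R Y1 + (c * snd \<xi> + d * snd \<eta>) *\<^sub>R Y2"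
      by (simp_all add: a_def b_def algebra_simps)
    then have "(c * \<beta>1) *\<^sub>R v + (d * \<beta>2) *\<^sub>R w = 0" "(c * \<alpha>1) *\<^sub>R v + (d * \<alpha>2) *\<^sub>R w = 0"
      using cd by (simp_all add: v w neg_eq_iff_add_eq_0)
    then have "lip ((c * \<beta>1) *\<^sub>R v + (d * \<beta>2) *\<^sub>R w) v = 0" "lip ((c * \<alpha>1) *\<^sub>R v + (d * \<alpha>2) *\<^sub>R w) v = 0"
       "lip ((c * \<beta>1) *\<^sub>R v + (d * \<beta>2) *\<^sub>R w) w = 0" "lip ((c * \<alpha>1) *\<^sub>R v + (d * \<alpha>2) *\<^sub>R w) w = 0"
      by (simp_all add: lip_simps)
    then have "c * \<beta>1 = 0" "c * \<alpha>1 = 0" "d * \<beta>2 = 0" "d * \<alpha>2 = 0"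
      using v(3) w(3) vw lip_commute[of w v] by (auto simp: lip_simps)
    then have "c = 0" "d = 0" using distinct by auto
    with cd show False by simp
  qed
  with v w vw that show ?thesis by blast
qed

text \<open>In the principal basis the first fundamental form has the entries ((\<beta>i -
  \<alpha>i)/2)^2 and the product of dF with dT the entries (\<beta>i - \<alpha>i) (\<beta>i +
  \<alpha>i)/4, each times the square of v or w. Up to a nonzero factor the two determinants differ
  by (\<beta>1 + \<alpha>1) (\<beta>2 + \<alpha>2) - (\<beta>1 - \<alpha>1) (\<beta>2 - \<alpha>2) =
  2 (\<alpha>1 \<beta>2 + \<alpha>2 \<beta>1).\<close>

lemma harmonic_iff_flat:
  assumes g: "gram ((1/2) *\<^sub>R (X1 + Y1)) ((1/2) *\<^sub>R (X2 + Y2)) \<noteq> 0"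
  shows "lip ((1/2) *\<^sub>R (X1 + Y1)) ((1/2) *\<^sub>R (X1 - Y1)) * lip ((1/2) *\<^sub>R (X2 + Y2)) ((1/2) *\<^sub>R (X2 - Y2))
     - (lip ((1/2) *\<^sub>R (X1 + Y1)) ((1/2) *\<^sub>R (X2 - Y2)))\<^sup>2 = gram ((1/2) *\<^sub>R (X1 + Y1)) ((1/2) *\<^sub>R (X2 + Y2))
    \<longleftrightarrow> \<alpha>1 * \<beta>2 + \<alpha>2 * \<beta>1 = 0"
proof -
  obtain v w where vw: "a \<xi> = \<beta>1 *\<^sub>R v" "b \<xi> = (- \<alpha>1) *\<^sub>R v" "a \<eta> = \<beta>2 *\<^sub>R w" "b \<eta> = (- \<alpha>2) *\<^sub>R w"
    "lip v v > 0" "lip w w > 0" "lip v w = 0" "fst \<xi> * snd \<eta> - snd \<xi> * fst \<eta> \<noteq> 0" by (rule directions)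
  define \<delta> where "\<delta> = (fst \<xi> * snd \<eta> - snd \<xi> * fst \<eta>)\<^sup>2"
  have \<delta>: "\<delta> \<noteq> 0" using vw by (simp add: \<delta>_def)
  define x y where "x = (1/2) *\<^sub>R (X1 + Y1)" and "y = (1/2) *\<^sub>R (X2 + Y2)"
  define x' y' where "x' = (1/2) *\<^sub>R (X1 - Y1)" and "y' = (1/2) *\<^sub>R (X2 - Y2)"
  have sy: "lip y x' = lip x y'"
    using sym by (simp add: x_def y_def x'_def y'_def lip_simps lip_commute[of X2 X1] lip_commute[of Y2 Y1]
      lip_commute[of Y2 X1] lip_commute[of Y1 X2] algebra_simps)
  define I where "I \<zeta> \<theta> = lip x x * (fst \<zeta> * fst \<theta>) + lip x y * (fst \<zeta> * snd \<theta> + snd \<zeta> * fst \<theta>) + lip y y * (snd \<zeta> * snd \<theta>)" for \<zeta> \<theta> :: "real \<times> real"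
  define II where "II \<zeta> \<theta> = lip x x' * (fst \<zeta> * fst \<theta>) + lip x y' * (fst \<zeta> * snd \<theta> + snd \<zeta> * fst \<theta>) + lip y y' * (snd \<zeta> * snd \<theta>)" for \<zeta> \<theta> :: "real \<times> real"
  have I: "I \<zeta> \<theta> = lip ((1/2) *\<^sub>R (a \<zeta> + b \<zeta>)) ((1/2) *\<^sub>R (a \<theta> + b \<theta>))" for \<zeta> \<theta>
  proof -
    have "(1/2) *\<^sub>R (a \<zeta> + b \<zeta>) = fst \<zeta> *\<^sub>R x + snd \<zeta> *\<^sub>R y" for \<zeta>
      by (simp add: a_def b_def x_def y_def algebra_simps)
    then show ?thesis by (simp add: I_def lip_simps lip_commute[of y x] algebra_simps)
  qed
  have II: "II \<zeta> \<theta> = lip ((1/2) *\<^sub>R (a \<zeta> + b \<zeta>)) ((1/2) *\<^sub>R (a \<theta> - b \<theta>))" for \<zeta> \<theta>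
  proof -
    have "(1/2) *\<^sub>R (a \<zeta> + b \<zeta>) = fst \<zeta> *\<^sub>R x + snd \<zeta> *\<^sub>R y" for \<zeta>
      by (simp add: a_def b_def x_def y_def algebra_simps)
    moreover have "(1/2) *\<^sub>R (a \<zeta> - b \<zeta>) = fst \<zeta> *\<^sub>R x' + snd \<zeta> *\<^sub>R y'" for \<zeta>
      by (simp add: a_def b_def x'_def y'_def algebra_simps)
    ultimately show ?thesis by (simp add: II_def lip_simps sy algebra_simps)
  qed
  \<comment> \<open>The 16 collects the four factors 1/2 in a product of two values of a
    form.\<close>
  let ?g = "lip v v * lip w w / 16"
  have "I \<xi> \<xi> * I \<eta> \<eta> - (I \<xi> \<eta>)\<^sup>2 = gram x y * \<delta>"
    unfolding gram_def \<delta>_def by (rule form_det) (simp add: I_def[abs_def])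
  moreover have "I \<xi> \<xi> * I \<eta> \<eta> - (I \<xi> \<eta>)\<^sup>2 = (\<beta>1 - \<alpha>1)\<^sup>2 * (\<beta>2 - \<alpha>2)\<^sup>2 * ?g"
    unfolding I vw using vw(7) lip_commute[of w v] by (simp add: lip_simps power2_eq_square algebra_simps)
  ultimately have 1: "gram x y * \<delta> = (\<beta>1 - \<alpha>1)\<^sup>2 * (\<beta>2 - \<alpha>2)\<^sup>2 * ?g" by simp
  let ?II = "lip x x' * lip y y' - (lip x y')\<^sup>2"
  have "II \<xi> \<xi> * II \<eta> \<eta> - (II \<xi> \<eta>)\<^sup>2 = ?II * \<delta>"
    unfolding \<delta>_def by (rule form_det) (simp add: II_def[abs_def])
  moreover have "II \<xi> \<xi> * II \<eta> \<eta> - (II \<xi> \<eta>)\<^sup>2 = (\<beta>1 - \<alpha>1) * (\<beta>1 + \<alpha>1) * (\<beta>2 - \<alpha>2) * (\<beta>2 + \<alpha>2) * ?g"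
    unfolding II vw using vw(7) lip_commute[of w v] by (simp add: lip_simps power2_eq_square algebra_simps)
  ultimately have 2: "?II * \<delta> = (\<beta>1 - \<alpha>1) * (\<beta>1 + \<alpha>1) * (\<beta>2 - \<alpha>2) * (\<beta>2 + \<alpha>2) * ?g" by simp
  have "gram x y \<noteq> 0" using g by (simp add: x_def y_def)
  then have nz: "(\<beta>1 - \<alpha>1) * (\<beta>2 - \<alpha>2) * ?g \<noteq> 0" using 1 \<delta> by (auto simp: power2_eq_square)
  have "?II = gram x y \<longleftrightarrow> (?II - gram x y) * \<delta> = 0" using \<delta> by auto
  also have "(?II - gram x y) * \<delta> = ?II * \<delta> - gram x y * \<delta>" by (rule left_diff_distrib)
  also have "\<dots> = ((\<beta>1 - \<alpha>1) * (\<beta>2 - \<alpha>2) * ?g) * (2 * (\<alpha>1 * \<beta>2 + \<alpha>2 * \<beta>1))"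
    unfolding 1 2 by (simp add: power2_eq_square algebra_simps)
  finally have "?II = gram x y \<longleftrightarrow> \<alpha>1 * \<beta>2 + \<alpha>2 * \<beta>1 = 0" using nz by auto
  then show ?thesis unfolding x_def y_def x'_def y'_def .
qed

text \<open>On the principal directions dF takes the values ((\<beta>i - \<alpha>i)/2) times v and
  w, which are orthogonal and not null.\<close>

lemma gram_half_sum_nonzero:
  assumes "\<alpha>1 \<noteq> \<beta>1" "\<alpha>2 \<noteq> \<beta>2"
  shows "gram ((1/2) *\<^sub>R (X1 + Y1)) ((1/2) *\<^sub>R (X2 + Y2)) \<noteq> 0"
proof
  assume 0: "gram ((1/2) *\<^sub>R (X1 + Y1)) ((1/2) *\<^sub>R (X2 + Y2)) = 0"
  obtain v w where vw: "a \<xi> = \<beta>1 *\<^sub>R v" "b \<xi> = (- \<alpha>1) *\<^sub>R v" "a \<eta> = \<beta>2 *\<^sub>R w" "b \<eta> = (- \<alpha>2) *\<^sub>R w"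
    "lip v v > 0" "lip w w > 0" "lip v w = 0" "fst \<xi> * snd \<eta> - snd \<xi> * fst \<eta> \<noteq> 0" by (rule directions)
  define x y where "x = (1/2) *\<^sub>R (X1 + Y1)" and "y = (1/2) *\<^sub>R (X2 + Y2)"
  have xy: "fst \<xi> *\<^sub>R x + snd \<xi> *\<^sub>R y = ((\<beta>1 - \<alpha>1) / 2) *\<^sub>R v" "fst \<eta> *\<^sub>R x + snd \<eta> *\<^sub>R y = ((\<beta>2 - \<alpha>2) / 2) *\<^sub>R w"
  proof -
    have "fst \<zeta> *\<^sub>R x + snd \<zeta> *\<^sub>R y = (1/2) *\<^sub>R (a \<zeta> + b \<zeta>)" for \<zeta>
      by (simp add: a_def b_def x_def y_def algebra_simps)
    then show "fst \<xi> *\<^sub>R x + snd \<xi> *\<^sub>R y = ((\<beta>1 - \<alpha>1) / 2) *\<^sub>R v" "fst \<eta> *\<^sub>R x + snd \<eta> *\<^sub>R y = ((\<beta>2 - \<alpha>2) / 2) *\<^sub>R w"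
      by (simp_all add: vw diff_divide_distrib algebra_simps)
  qed
  have "gram (fst \<xi> *\<^sub>R x + snd \<xi> *\<^sub>R y) (fst \<eta> *\<^sub>R x + snd \<eta> *\<^sub>R y) = gram x y * (fst \<xi> * snd \<eta> - snd \<xi> * fst \<eta>)\<^sup>2"
    by (simp add: gram_def lip_simps lip_commute[of y x] power2_eq_square algebra_simps)
  moreover have gram_scale: "gram (c *\<^sub>R v) (d *\<^sub>R w) = c\<^sup>2 * d\<^sup>2 * (lip v v * lip w w - (lip v w)\<^sup>2)" for c d
    by (simp add: gram_def lip_simps power2_eq_square algebra_simps)
  moreover have "gram x y = 0" using 0 by (simp only: x_def y_def)
  ultimately have "gram (((\<beta>1 - \<alpha>1) / 2) *\<^sub>R v) (((\<beta>2 - \<alpha>2) / 2) *\<^sub>R w) = 0"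
    by (simp only: xy mult_zero_left)
  then have "((\<beta>1 - \<alpha>1) / 2)\<^sup>2 * ((\<beta>2 - \<alpha>2) / 2)\<^sup>2 * (lip v v * lip w w) = 0"
    by (simp add: gram_scale vw)
  then show False using assms vw by auto
qed

end

section \<open>Moutard lifts and curvature line parameters\<close>

lemma dinv_right_inverse:
  assumes "jac G z \<noteq> 0"
  shows "fst (dinv G z w) *\<^sub>R D\<^sub>u G z + snd (dinv G z w) *\<^sub>R D\<^sub>v G z = w"
proof -
  have "jac G z *\<^sub>R (fst (dinv G z w) *\<^sub>R D\<^sub>u G z + snd (dinv G z w) *\<^sub>R D\<^sub>v G z) =
    (snd (D\<^sub>v G z) * fst w - fst (D\<^sub>v G z) * snd w) *\<^sub>R D\<^sub>u G z + (fst (D\<^sub>u G z) * snd w - snd (D\<^sub>u G z) * fst w) *\<^sub>R D\<^sub>v G z"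
    using assms by (simp add: dinv_def scaleR_add_right)
  also have "\<dots> = jac G z *\<^sub>R w"
    by (simp add: prod_eq_iff jac_def algebra_simps)
  finally show ?thesis using assms by simp
qed

text \<open>The integrability n_uv = n_vu reads 2 a (a p_uv + a_v p_u + a_u p_v) = 0, and the
  bracket is exactly what separates the mixed derivative of a (k + p) from a_uv (k + p). The lemma
  serves both congruences: exchanging p and n replaces a by 1 / a.\<close>

lemma moutard_product:
  fixes p n :: "real \<times> real \<Rightarrow> r42"
  assumes V: "open V" and sm: "smooth_on V p" "smooth_on V n" "smooth_on V a" and a: "\<And>z. z \<in> V \<Longrightarrow> a z \<noteq> 0"
    and nu: "\<And>z. z \<in> V \<Longrightarrow> D\<^sub>u n z = (a z)\<^sup>2 *\<^sub>R D\<^sub>u p z"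
    and nv: "\<And>z. z \<in> V \<Longrightarrow> D\<^sub>v n z = - (a z)\<^sup>2 *\<^sub>R D\<^sub>v p z"
    and z: "z \<in> V"
  shows "D\<^sub>v (D\<^sub>u (\<lambda>y. a y *\<^sub>R (k + p y))) z = D\<^sub>v (D\<^sub>u a) z *\<^sub>R (k + p z)"
proof -
  note S = bounded_bilinear_scaleR
  note d = smooth_on_differentiable
  note smD = smooth_on_D
  have smk: "smooth_on V (\<lambda>y. k + p y)" using sm V by (intro smooth_on_add smooth_on_const)
  have Dk: "D\<^sub>u (\<lambda>y. k + p y) x = D\<^sub>u p x" "D\<^sub>v (\<lambda>y. k + p y) x = D\<^sub>v p x" if "x \<in> V" for x
    using D_add[of "\<lambda>_. k" x p] d[OF sm(1) that] D_const_on[OF V that, of "\<lambda>_. k" k] by auto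
  have 1: "D\<^sub>u (\<lambda>y. a y *\<^sub>R (k + p y)) x = a x *\<^sub>R D\<^sub>u p x + D\<^sub>u a x *\<^sub>R (k + p x)" if "x \<in> V" for x
    using D_bilinear(1)[OF S d[OF sm(3) that] d[OF smk that]] Dk[OF that] by simp
  have prod: "D\<^sub>v (\<lambda>x. f x *\<^sub>R g x) z = f z *\<^sub>R D\<^sub>v g z + D\<^sub>v f z *\<^sub>R g z"
      "D\<^sub>u (\<lambda>x. f x *\<^sub>R g x) z = f z *\<^sub>R D\<^sub>u g z + D\<^sub>u f z *\<^sub>R g z"
    if "smooth_on V f" "smooth_on V g" for f :: "real \<times> real \<Rightarrow> real" and g :: "real \<times> real \<Rightarrow> r42"
    using D_bilinear[OF S d[OF that(1) z] d[OF that(2) z]] by auto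
  have "D\<^sub>v (D\<^sub>u (\<lambda>y. a y *\<^sub>R (k + p y))) z = D\<^sub>v (\<lambda>x. a x *\<^sub>R D\<^sub>u p x + D\<^sub>u a x *\<^sub>R (k + p x)) z"
    by (rule D_cong_open(2)[OF V z 1])
  also have "\<dots> = D\<^sub>v (\<lambda>x. a x *\<^sub>R D\<^sub>u p x) z + D\<^sub>v (\<lambda>x. D\<^sub>u a x *\<^sub>R (k + p x)) z"
    by (rule D_add(2)) (rule d[OF smooth_on_scaleR[OF V] z]; fact sm smD[OF sm(1)] smD[OF sm(3)] smk)+
  also have "\<dots> = a z *\<^sub>R D\<^sub>v (D\<^sub>u p) z + D\<^sub>v a z *\<^sub>R D\<^sub>u p z + (D\<^sub>u a z *\<^sub>R D\<^sub>v p z + D\<^sub>v (D\<^sub>u a) z *\<^sub>R (k + p z))"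
    using prod(1)[OF sm(3) smD(1)[OF sm(1)]] prod(1)[OF smD(1)[OF sm(3)] smk] Dk[OF z] by simp
  finally have 2: "D\<^sub>v (D\<^sub>u (\<lambda>y. a y *\<^sub>R (k + p y))) z = (a z *\<^sub>R D\<^sub>v (D\<^sub>u p) z + D\<^sub>v a z *\<^sub>R D\<^sub>u p z + D\<^sub>u a z *\<^sub>R D\<^sub>v p z) + D\<^sub>v (D\<^sub>u a) z *\<^sub>R (k + p z)"
    by (simp add: algebra_simps)
  define b where "b x = (a x)\<^sup>2" for x
  have smb: "smooth_on V b" unfolding b_def[abs_def] power2_eq_square by (intro smooth_on_mult V sm)
  have Db: "D\<^sub>u b z = a z * D\<^sub>u a z + D\<^sub>u a z * a z" "D\<^sub>v b z = a z * D\<^sub>v a z + D\<^sub>v a z * a z"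
    unfolding b_def[abs_def] power2_eq_square
    using D_bilinear[OF bounded_bilinear_mult d[OF sm(3) z] d[OF sm(3) z]] by auto
  have "D\<^sub>v (D\<^sub>u n) z = D\<^sub>v (\<lambda>x. b x *\<^sub>R D\<^sub>u p x) z"
    by (rule D_cong_open(2)[OF V z]) (simp add: nu b_def)
  then have n1: "D\<^sub>v (D\<^sub>u n) z = b z *\<^sub>R D\<^sub>v (D\<^sub>u p) z + D\<^sub>v b z *\<^sub>R D\<^sub>u p z"
    using prod(1)[OF smb smD(1)[OF sm(1)]] by simp
  have "D\<^sub>u (D\<^sub>v n) z = D\<^sub>u (\<lambda>x. b x *\<^sub>R (- D\<^sub>v p x)) z"
    by (rule D_cong_open(1)[OF V z]) (simp add: nv b_def)
  then have n2: "D\<^sub>u (D\<^sub>v n) z = b z *\<^sub>R D\<^sub>u (\<lambda>x. - D\<^sub>v p x) z - D\<^sub>u b z *\<^sub>R D\<^sub>v p z"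
    using prod(2)[OF smb smooth_on_minus[OF V smD(2)[OF sm(1)]]] by simp
  have "D\<^sub>u (\<lambda>x. - D\<^sub>v p x) z = - D\<^sub>v (D\<^sub>u p) z"
    using D_linear(1)[OF bounded_linear_minus[OF bounded_linear_ident] d[OF smD(2)[OF sm(1)] z]]
      mixed_partials[OF sm(1) V z] by simp
  with n1 n2 mixed_partials[OF sm(2) V z]
  have "b z *\<^sub>R D\<^sub>v (D\<^sub>u p) z + D\<^sub>v b z *\<^sub>R D\<^sub>u p z = - (b z *\<^sub>R D\<^sub>v (D\<^sub>u p) z) - D\<^sub>u b z *\<^sub>R D\<^sub>v p z" by simp
  then have "(b z *\<^sub>R D\<^sub>v (D\<^sub>u p) z + D\<^sub>v b z *\<^sub>R D\<^sub>u p z) + (b z *\<^sub>R D\<^sub>v (D\<^sub>u p) z + D\<^sub>u b z *\<^sub>R D\<^sub>v p z) = 0"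
    by simp
  then have "(a z + a z) *\<^sub>R (a z *\<^sub>R D\<^sub>v (D\<^sub>u p) z + D\<^sub>v a z *\<^sub>R D\<^sub>u p z + D\<^sub>u a z *\<^sub>R D\<^sub>v p z) = 0"
    unfolding Db unfolding b_def power2_eq_square by (simp only: algebra_simps scaleR_scaleR)
  then have "a z *\<^sub>R D\<^sub>v (D\<^sub>u p) z + D\<^sub>v a z *\<^sub>R D\<^sub>u p z + D\<^sub>u a z *\<^sub>R D\<^sub>v p z = 0"
    using a[OF z] by simp
  then show ?thesis using 2 by simp
qed

text \<open>The Codazzi equation; \<open>\<epsilon> = \<plusminus> 1\<close> covers both principal directions.\<close>

lemma principal_form_closed:
  fixes P N e e' :: "real \<times> real \<Rightarrow> r42" and A :: "real \<times> real \<Rightarrow> real"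
  assumes B: "open B" and sm: "smooth_on B P" "smooth_on B N" "smooth_on B e" "smooth_on B A"
    and A: "\<And>z. z \<in> B \<Longrightarrow> A z \<noteq> 0" and eps: "\<epsilon> \<noteq> 0"
    and e: "\<And>z. z \<in> B \<Longrightarrow> lip (e z) (e z) = 1" "\<And>z. z \<in> B \<Longrightarrow> lip (e z) (e' z) = 0"
    and Pu: "\<And>z. z \<in> B \<Longrightarrow> D\<^sub>u P z = lip (D\<^sub>u P z) (e z) *\<^sub>R e z + lip (D\<^sub>u P z) (e' z) *\<^sub>R e' z"
    and Pv: "\<And>z. z \<in> B \<Longrightarrow> D\<^sub>v P z = lip (D\<^sub>v P z) (e z) *\<^sub>R e z + lip (D\<^sub>v P z) (e' z) *\<^sub>R e' z"
    and Nu: "\<And>z. z \<in> B \<Longrightarrow> D\<^sub>u N z = (\<epsilon> * (A z)\<^sup>2) *\<^sub>R (lip (D\<^sub>u P z) (e z) *\<^sub>R e z - lip (D\<^sub>u P z) (e' z) *\<^sub>R e' z)"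
    and Nv: "\<And>z. z \<in> B \<Longrightarrow> D\<^sub>v N z = (\<epsilon> * (A z)\<^sup>2) *\<^sub>R (lip (D\<^sub>v P z) (e z) *\<^sub>R e z - lip (D\<^sub>v P z) (e' z) *\<^sub>R e' z)"
    and z: "z \<in> B"
  shows "D\<^sub>v (\<lambda>x. A x * lip (D\<^sub>u P x) (e x)) z = D\<^sub>u (\<lambda>x. A x * lip (D\<^sub>v P x) (e x)) z"
proof -
  define p q where pq: "p = (\<lambda>x. lip (D\<^sub>u P x) (e x))" "q = (\<lambda>x. lip (D\<^sub>v P x) (e x))"
  note smD = smooth_on_D
  note d = smooth_on_differentiable
  have smp: "smooth_on B p" "smooth_on B q"
    unfolding pq by (intro smooth_on_lip B smD sm)+
  have smb: "smooth_on B (\<lambda>x. (A x)\<^sup>2)" unfolding power2_eq_square by (intro smooth_on_mult B sm)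
  define b where "b = (\<lambda>x. \<epsilon> * (A x)\<^sup>2)"
  have smb: "smooth_on B b" unfolding b_def by (intro smooth_on_mult smooth_on_const B smb)
  have mult: "D\<^sub>u (\<lambda>x. f x * g x) z = f z * D\<^sub>u g z + D\<^sub>u f z * g z" "D\<^sub>v (\<lambda>x. f x * g x) z = f z * D\<^sub>v g z + D\<^sub>v f z * g z"
    if "smooth_on B f" "smooth_on B g" for f g :: "real \<times> real \<Rightarrow> real"
    using D_bilinear[OF bounded_bilinear_mult d[OF that(1) z] d[OF that(2) z]] by auto
  have Db: "D\<^sub>u b z = \<epsilon> * (2 * A z * D\<^sub>u A z)" "D\<^sub>v b z = \<epsilon> * (2 * A z * D\<^sub>v A z)"
    unfolding b_def power2_eq_square
    using mult[OF smooth_on_const[OF B] smooth_on_mult[OF B sm(4,4)], of \<epsilon>] mult[OF sm(4,4)]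
      D_const_on[OF B z, of "\<lambda>_. \<epsilon>" \<epsilon>] by auto
  have ee: "lip (D\<^sub>u e z) (e z) = 0" "lip (D\<^sub>v e z) (e z) = 0"
    using D_lip_const[OF B sm(3,3) e(1) z] by (auto simp: lip_commute[of "e z"])
  have n: "lip (D\<^sub>u N x) (e x) = b x * p x" "lip (D\<^sub>v N x) (e x) = b x * q x" if "x \<in> B" for x
    using e[OF that] Nu[OF that] Nv[OF that] by (auto simp: pq b_def lip_simps lip_commute[of "e' x"])
  have "D\<^sub>v (\<lambda>x. lip (D\<^sub>u N x) (e x)) z = D\<^sub>v (\<lambda>x. b x * p x) z" "D\<^sub>u (\<lambda>x. lip (D\<^sub>v N x) (e x)) z = D\<^sub>u (\<lambda>x. b x * q x) z"
    by (rule D_cong_open[OF B z]; simp add: n)+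
  then have "b z * D\<^sub>v p z + D\<^sub>v b z * p z = lip (D\<^sub>u N z) (D\<^sub>v e z) + lip (D\<^sub>v (D\<^sub>u N) z) (e z)"
    "b z * D\<^sub>u q z + D\<^sub>u b z * q z = lip (D\<^sub>v N z) (D\<^sub>u e z) + lip (D\<^sub>u (D\<^sub>v N) z) (e z)"
    using D_lip(2)[OF smD(1)[OF sm(2)] sm(3) z] D_lip(1)[OF smD(2)[OF sm(2)] sm(3) z] mult[OF smb smp(1)] mult[OF smb smp(2)] by auto
  then have 1: "b z * (D\<^sub>v p z - D\<^sub>u q z) + D\<^sub>v b z * p z - D\<^sub>u b z * q z = lip (D\<^sub>u N z) (D\<^sub>v e z) - lip (D\<^sub>v N z) (D\<^sub>u e z)"
    using mixed_partials[OF sm(2) B z] by (simp add: algebra_simps)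
  have 2: "D\<^sub>v p z - D\<^sub>u q z = lip (D\<^sub>u P z) (D\<^sub>v e z) - lip (D\<^sub>v P z) (D\<^sub>u e z)"
    unfolding pq using D_lip(2)[OF smD(1)[OF sm(1)] sm(3) z] D_lip(1)[OF smD(2)[OF sm(1)] sm(3) z]
      mixed_partials[OF sm(1) B z] by auto
  have ee': "lip (e z) (D\<^sub>u e z) = 0" "lip (e z) (D\<^sub>v e z) = 0" using ee lip_commute by metis+
  have "lip (D\<^sub>u P z) (D\<^sub>v e z) = lip (D\<^sub>u P z) (e' z) * lip (e' z) (D\<^sub>v e z)"
    "lip (D\<^sub>v P z) (D\<^sub>u e z) = lip (D\<^sub>v P z) (e' z) * lip (e' z) (D\<^sub>u e z)"
    by (subst Pu[OF z] Pv[OF z], simp add: lip_simps ee')+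
  moreover have "lip (D\<^sub>u N z) (D\<^sub>v e z) = - b z * (lip (D\<^sub>u P z) (e' z) * lip (e' z) (D\<^sub>v e z))"
    "lip (D\<^sub>v N z) (D\<^sub>u e z) = - b z * (lip (D\<^sub>v P z) (e' z) * lip (e' z) (D\<^sub>u e z))"
    by (subst Nu[OF z] Nv[OF z], simp add: lip_simps ee' b_def)+
  ultimately have 3: "lip (D\<^sub>u N z) (D\<^sub>v e z) - lip (D\<^sub>v N z) (D\<^sub>u e z) = - b z * (D\<^sub>v p z - D\<^sub>u q z)"
    unfolding 2 by (simp add: algebra_simps)
  \<comment> \<open>As e is a unit field, only the e' component meets its derivative, and dN carries
    the opposite sign there. So the right side of 1 is - b (p_v - q_u), this term occurs twice, and
    the 2 from the derivative of A^2 can be divided out.\<close>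
  have "2 * (\<epsilon> * A z) * (A z * (D\<^sub>v p z - D\<^sub>u q z) + D\<^sub>v A z * p z - D\<^sub>u A z * q z) = 0"
    using 1 unfolding 3 Db unfolding b_def power2_eq_square by (simp add: algebra_simps)
  then have "A z * (D\<^sub>v p z - D\<^sub>u q z) + D\<^sub>v A z * p z - D\<^sub>u A z * q z = 0" using A[OF z] eps by simp
  then show ?thesis
    using mult[OF sm(4) smp(1)] mult[OF sm(4) smp(2)] unfolding pq by (simp add: algebra_simps)
qed

lemma combination_of_combinations:
  fixes e e' :: "'a::real_vector"
  assumes "X = p *\<^sub>R e + p' *\<^sub>R e'" "Y = q *\<^sub>R e + q' *\<^sub>R e'"
  shows "a *\<^sub>R X + b *\<^sub>R Y = (a * p + b * q) *\<^sub>R e + (a * p' + b * q') *\<^sub>R e'"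
  unfolding assms by (simp add: algebra_simps)

text \<open>\<open>flat\<close> is harmonic separation written for dP and dN: relative to dP, the
  differential dN has two opposite eigenvalues. The number \<mu> is given only pointwise.\<close>

locale flat_coords = null_coords +
  assumes regular: "z \<in> U \<Longrightarrow> fst \<zeta> *\<^sub>R D\<^sub>u P z + snd \<zeta> *\<^sub>R D\<^sub>v P z = 0 \<Longrightarrow>
      fst \<zeta> *\<^sub>R D\<^sub>u N z + snd \<zeta> *\<^sub>R D\<^sub>v N z = 0 \<Longrightarrow> \<zeta> = 0"
    and flat: "z \<in> U \<Longrightarrow> \<exists>\<mu> \<xi> \<eta>. \<mu> > 0 \<and> \<xi> \<noteq> 0 \<and> \<eta> \<noteq> 0 \<and>
      fst \<xi> *\<^sub>R D\<^sub>u N z + snd \<xi> *\<^sub>R D\<^sub>v N z = \<mu> *\<^sub>R (fst \<xi> *\<^sub>R D\<^sub>u P z + snd \<xi> *\<^sub>R D\<^sub>v P z) \<and>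
      fst \<eta> *\<^sub>R D\<^sub>u N z + snd \<eta> *\<^sub>R D\<^sub>v N z = (- \<mu>) *\<^sub>R (fst \<eta> *\<^sub>R D\<^sub>u P z + snd \<eta> *\<^sub>R D\<^sub>v P z)"
begin

text \<open>The eigenvalue \<mu> as a smooth function: the eigenvectors are orthogonal, so changing
  the sign of one component preserves the length and |N_u| = \<mu> |P_u|, whatever direction u
  is.\<close>

definition lam where "lam z = sqrt (lip (D\<^sub>u N z) (D\<^sub>u N z) / lip (D\<^sub>u P z) (D\<^sub>u P z))"

lemma pointwise:
  assumes z: "z \<in> U"
  obtains v w s t s' t' where "lip v v > 0" "lip w w > 0" "lip v w = 0"
    "D\<^sub>u P z = s *\<^sub>R v + t *\<^sub>R w" "D\<^sub>v P z = s' *\<^sub>R v + t' *\<^sub>R w"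
    "D\<^sub>u N z = lam z *\<^sub>R (s *\<^sub>R v - t *\<^sub>R w)" "D\<^sub>v N z = lam z *\<^sub>R (s' *\<^sub>R v - t' *\<^sub>R w)"
    "s * t' - t * s' \<noteq> 0" "lam z > 0" "lip (D\<^sub>u P z) (D\<^sub>u P z) > 0" "lip (D\<^sub>u N z) (D\<^sub>u N z) > 0"
proof -
  obtain \<mu> \<xi> \<eta> where *: "\<mu> > 0" "\<xi> \<noteq> 0" "\<eta> \<noteq> 0"
      "fst \<xi> *\<^sub>R D\<^sub>u N z + snd \<xi> *\<^sub>R D\<^sub>v N z = \<mu> *\<^sub>R (fst \<xi> *\<^sub>R D\<^sub>u P z + snd \<xi> *\<^sub>R D\<^sub>v P z)"
      "fst \<eta> *\<^sub>R D\<^sub>u N z + snd \<eta> *\<^sub>R D\<^sub>v N z = (- \<mu>) *\<^sub>R (fst \<eta> *\<^sub>R D\<^sub>u P z + snd \<eta> *\<^sub>R D\<^sub>v P z)"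
    using flat[OF z] by blast
  interpret C: two_curvature_directions k l "P z" "N z" "D\<^sub>u P z" "D\<^sub>v P z" "D\<^sub>u N z" "D\<^sub>v N z" \<xi> \<eta> "-\<mu>" 1 \<mu> 1
    by unfold_locales (use * nf[OF z] perp[OF z] mixed_sym[OF z] regular[OF z] in auto)
  obtain v w where vw: "C.a \<xi> = 1 *\<^sub>R v" "C.b \<xi> = (- (- \<mu>)) *\<^sub>R v" "C.a \<eta> = 1 *\<^sub>R w" "C.b \<eta> = (- \<mu>) *\<^sub>R w"
    "lip v v > 0" "lip w w > 0" "lip v w = 0" "fst \<xi> * snd \<eta> - snd \<xi> * fst \<eta> \<noteq> 0" by (rule C.directions)
  define \<delta> where "\<delta> = fst \<xi> * snd \<eta> - snd \<xi> * fst \<eta>"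
  have \<delta>: "\<delta> \<noteq> 0" using vw by (simp add: \<delta>_def)
  \<comment> \<open>Cramer's rule, recovering the coordinate derivatives from those in the
    directions \<xi> and \<eta>.\<close>
  have P1: "\<delta> *\<^sub>R D\<^sub>u P z = snd \<eta> *\<^sub>R v - snd \<xi> *\<^sub>R w" "\<delta> *\<^sub>R D\<^sub>v P z = - (fst \<eta> *\<^sub>R v) + fst \<xi> *\<^sub>R w"
    "\<delta> *\<^sub>R D\<^sub>u N z = \<mu> *\<^sub>R (snd \<eta> *\<^sub>R v + snd \<xi> *\<^sub>R w)" "\<delta> *\<^sub>R D\<^sub>v N z = \<mu> *\<^sub>R (- (fst \<eta> *\<^sub>R v) - fst \<xi> *\<^sub>R w)"
  proof -
    have v: "v = C.a \<xi>" "\<mu> *\<^sub>R v = C.b \<xi>" and w: "w = C.a \<eta>" "\<mu> *\<^sub>R w = - C.b \<eta>" using vw by auto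
    show "\<delta> *\<^sub>R D\<^sub>u P z = snd \<eta> *\<^sub>R v - snd \<xi> *\<^sub>R w" "\<delta> *\<^sub>R D\<^sub>v P z = - (fst \<eta> *\<^sub>R v) + fst \<xi> *\<^sub>R w"
      unfolding v w C.a_def \<delta>_def by (simp_all add: algebra_simps)
    have "\<mu> *\<^sub>R (snd \<eta> *\<^sub>R v + snd \<xi> *\<^sub>R w) = snd \<eta> *\<^sub>R (\<mu> *\<^sub>R v) + snd \<xi> *\<^sub>R (\<mu> *\<^sub>R w)"
      "\<mu> *\<^sub>R (- (fst \<eta> *\<^sub>R v) - fst \<xi> *\<^sub>R w) = - (fst \<eta> *\<^sub>R (\<mu> *\<^sub>R v)) - fst \<xi> *\<^sub>R (\<mu> *\<^sub>R w)"
      by (simp_all add: algebra_simps)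
    then show "\<delta> *\<^sub>R D\<^sub>u N z = \<mu> *\<^sub>R (snd \<eta> *\<^sub>R v + snd \<xi> *\<^sub>R w)" "\<delta> *\<^sub>R D\<^sub>v N z = \<mu> *\<^sub>R (- (fst \<eta> *\<^sub>R v) - fst \<xi> *\<^sub>R w)"
      unfolding v(2) w(2) C.b_def \<delta>_def by (simp_all add: algebra_simps)
  qed
  define s t s' t' where st: "s = snd \<eta> / \<delta>" "t = - snd \<xi> / \<delta>" "s' = - fst \<eta> / \<delta>" "t' = fst \<xi> / \<delta>"
  have div: "x = (1 / \<delta>) *\<^sub>R y" if "\<delta> *\<^sub>R x = y" for x y :: r42 using that \<delta> by auto
  have P2: "D\<^sub>u P z = s *\<^sub>R v + t *\<^sub>R w" "D\<^sub>v P z = s' *\<^sub>R v + t' *\<^sub>R w"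
    "D\<^sub>u N z = \<mu> *\<^sub>R (s *\<^sub>R v - t *\<^sub>R w)" "D\<^sub>v N z = \<mu> *\<^sub>R (s' *\<^sub>R v - t' *\<^sub>R w)"
    using P1[THEN div] by (simp_all add: st algebra_simps)
  have det: "s * t' - t * s' \<noteq> 0"
  proof -
    have "s * t' - t * s' = \<delta> / (\<delta> * \<delta>)" by (simp add: st \<delta>_def diff_divide_distrib algebra_simps)
    then show ?thesis using \<delta> by simp
  qed
  then have "s \<noteq> 0 \<or> t \<noteq> 0" by auto
  then have pos: "s * s * lip v v + t * t * lip w w > 0"
    using vw(5,6) by (smt (verit) mult_nonneg_nonneg mult_pos_pos not_real_square_gt_zero zero_le_square)
  have PP: "lip (D\<^sub>u P z) (D\<^sub>u P z) = s * s * lip v v + t * t * lip w w"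
    "lip (D\<^sub>u N z) (D\<^sub>u N z) = \<mu>\<^sup>2 * (s * s * lip v v + t * t * lip w w)"
    unfolding P2 using vw(7) lip_commute[of w v] by (simp_all add: lip_simps power2_eq_square algebra_simps)
  have "lam z = \<mu>" unfolding lam_def PP using pos *(1) by simp
  with P2 det pos PP *(1) vw that show ?thesis by auto
qed

lemma smooth_lam: "smooth_on U lam"
  unfolding lam_def[abs_def]
proof (intro smooth_on_sqrt smooth_on_divide smooth_on_lip open_U smooth_on_D smP smN)
  fix z assume "z \<in> U"
  then show "lip (D\<^sub>u P z) (D\<^sub>u P z) \<noteq> 0" "lip (D\<^sub>u N z) (D\<^sub>u N z) / lip (D\<^sub>u P z) (D\<^sub>u P z) > 0"
    by (auto elim!: pointwise)
qed

text \<open>Twice a principal component of dP(\<omega>): since dN / \<open>lam\<close> has the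
  eigenvalues 1 and -1 relative to dP, adding it (\<epsilon> = 1) or subtracting it (\<epsilon> =
  -1) removes one of the two components. This produces principal vectors without a smooth choice of
  v and w.\<close>

definition proj :: "real \<Rightarrow> real \<times> real \<Rightarrow> real \<times> real \<Rightarrow> r42" where
  "proj \<epsilon> \<omega> z = fst \<omega> *\<^sub>R (D\<^sub>u P z + (\<epsilon> / lam z) *\<^sub>R D\<^sub>u N z) + snd \<omega> *\<^sub>R (D\<^sub>v P z + (\<epsilon> / lam z) *\<^sub>R D\<^sub>v N z)"

lemma smooth_proj: "smooth_on U (proj \<epsilon> \<omega>)"
  unfolding proj_def[abs_def]
  by (intro smooth_on_add smooth_on_scaleR smooth_on_divide smooth_on_const open_U smooth_on_D smP smN smooth_lam)
    (auto elim!: pointwise)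

text \<open>A fixed \<omega> whose two principal components are nonzero at z0 keeps them nonzero
  nearby, so both projections can be normalised there to smooth unit fields.\<close>

lemma principal_frame:
  assumes z0: "z0 \<in> U"
  obtains r e1 e2 where "r > 0" "ball z0 r \<subseteq> U" "smooth_on (ball z0 r) e1" "smooth_on (ball z0 r) e2"
    "\<And>z. z \<in> ball z0 r \<Longrightarrow> lip (e1 z) (e1 z) = 1 \<and> lip (e2 z) (e2 z) = 1 \<and> lip (e1 z) (e2 z) = 0"
    "\<And>z. z \<in> ball z0 r \<Longrightarrow>
       D\<^sub>u P z = lip (D\<^sub>u P z) (e1 z) *\<^sub>R e1 z + lip (D\<^sub>u P z) (e2 z) *\<^sub>R e2 z \<and>
       D\<^sub>v P z = lip (D\<^sub>v P z) (e1 z) *\<^sub>R e1 z + lip (D\<^sub>v P z) (e2 z) *\<^sub>R e2 z \<and>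
       D\<^sub>u N z = lam z *\<^sub>R (lip (D\<^sub>u P z) (e1 z) *\<^sub>R e1 z - lip (D\<^sub>u P z) (e2 z) *\<^sub>R e2 z) \<and>
       D\<^sub>v N z = lam z *\<^sub>R (lip (D\<^sub>v P z) (e1 z) *\<^sub>R e1 z - lip (D\<^sub>v P z) (e2 z) *\<^sub>R e2 z)"
proof -
  have projs: "proj 1 \<omega> z = (2 * (fst \<omega> * s + snd \<omega> * s')) *\<^sub>R v" "proj (-1) \<omega> z = (2 * (fst \<omega> * t + snd \<omega> * t')) *\<^sub>R w"
    if "D\<^sub>u P z = s *\<^sub>R v + t *\<^sub>R w" "D\<^sub>v P z = s' *\<^sub>R v + t' *\<^sub>R w"
    "D\<^sub>u N z = lam z *\<^sub>R (s *\<^sub>R v - t *\<^sub>R w)" "D\<^sub>v N z = lam z *\<^sub>R (s' *\<^sub>R v - t' *\<^sub>R w)" "lam z > 0" for \<omega> z s t s' t' v w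
  proof -
    have d: "D\<^sub>u P z + (\<epsilon> / lam z) *\<^sub>R D\<^sub>u N z = (s * (1 + \<epsilon>)) *\<^sub>R v + (t * (1 - \<epsilon>)) *\<^sub>R w"
      "D\<^sub>v P z + (\<epsilon> / lam z) *\<^sub>R D\<^sub>v N z = (s' * (1 + \<epsilon>)) *\<^sub>R v + (t' * (1 - \<epsilon>)) *\<^sub>R w" for \<epsilon>
      using that(5) unfolding that(1-4) by (simp_all add: algebra_simps)
    show "proj 1 \<omega> z = (2 * (fst \<omega> * s + snd \<omega> * s')) *\<^sub>R v" "proj (-1) \<omega> z = (2 * (fst \<omega> * t + snd \<omega> * t')) *\<^sub>R w"
      unfolding proj_def d by (simp_all add: algebra_simps)
  qed
  obtain v w s t s' t' where 0: "lip v v > 0" "lip w w > 0" "lip v w = 0"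
    "D\<^sub>u P z0 = s *\<^sub>R v + t *\<^sub>R w" "D\<^sub>v P z0 = s' *\<^sub>R v + t' *\<^sub>R w"
    "D\<^sub>u N z0 = lam z0 *\<^sub>R (s *\<^sub>R v - t *\<^sub>R w)" "D\<^sub>v N z0 = lam z0 *\<^sub>R (s' *\<^sub>R v - t' *\<^sub>R w)"
    "s * t' - t * s' \<noteq> 0" "lam z0 > 0"
     "lip (D\<^sub>u P z0) (D\<^sub>u P z0) > 0" "lip (D\<^sub>u N z0) (D\<^sub>u N z0) > 0" by (rule pointwise[OF z0])
  \<comment> \<open>The solution for which both components become the determinant s t' - t s', which
    is not zero.\<close>
  define \<omega> :: "real \<times> real" where "\<omega> = (t' - s', s - t)"
  have \<omega>: "fst \<omega> * s + snd \<omega> * s' = s * t' - t * s'" "fst \<omega> * t + snd \<omega> * t' = s * t' - t * s'"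
    by (simp_all add: \<omega>_def algebra_simps)
  let ?q = "\<lambda>\<epsilon> z. lip (proj \<epsilon> \<omega> z) (proj \<epsilon> \<omega> z)"
  have pos0: "?q 1 z0 > 0" "?q (-1) z0 > 0"
  proof -
    have "(2 * (s * t' - t * s')) * (2 * (s * t' - t * s')) > 0"
    proof -
      have "2 * (s * t' - t * s') \<noteq> 0" using 0(8) by simp
      then show ?thesis using not_real_square_gt_zero by blast
    qed
    moreover have "lip (c *\<^sub>R x) (c *\<^sub>R x) = c * c * lip x x" for c x by (simp add: lip_simps)
    ultimately show "?q 1 z0 > 0" "?q (-1) z0 > 0"
      unfolding projs[OF 0(4-7,9)] \<omega> using 0(1,2) by (simp_all only: mult_pos_pos)
  qed
  have smq: "smooth_on U (?q \<epsilon>)" for \<epsilon> by (intro smooth_on_lip open_U smooth_proj)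
  have cont: "(?q \<epsilon> \<longlongrightarrow> ?q \<epsilon> z0) (nhds z0)" for \<epsilon>
    using smooth_on_continuous[OF smq] open_U z0 continuous_on_eq_continuous_at
      tendsto_at_iff_tendsto_nhds[of "?q \<epsilon>" z0] unfolding isCont_def by blast
  have "\<forall>\<^sub>F z in nhds z0. ?q 1 z > 0" "\<forall>\<^sub>F z in nhds z0. ?q (-1) z > 0" "\<forall>\<^sub>F z in nhds z0. z \<in> U"
    using order_tendstoD(1)[OF cont pos0(1)] order_tendstoD(1)[OF cont pos0(2)] eventually_nhds_in_open[OF open_U z0]
    by blast+
  then have "\<forall>\<^sub>F z in nhds z0. ?q 1 z > 0 \<and> ?q (-1) z > 0 \<and> z \<in> U" by (intro eventually_conj)
  then obtain r where r: "r > 0" "\<And>z. dist z z0 < r \<Longrightarrow> ?q 1 z > 0 \<and> ?q (-1) z > 0 \<and> z \<in> U"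
    unfolding eventually_nhds_metric by blast
  let ?B = "ball z0 r"
  define e where "e \<epsilon> z = (1 / sqrt (?q \<epsilon> z)) *\<^sub>R proj \<epsilon> \<omega> z" for \<epsilon> z
  have B: "?B \<subseteq> U" and qpos: "\<And>z. z \<in> ?B \<Longrightarrow> ?q 1 z > 0 \<and> ?q (-1) z > 0" using r by (auto simp: dist_commute)
  have sme: "smooth_on ?B (e 1)" "smooth_on ?B (e (-1))"
  proof -
    have *: "smooth_on ?B (e \<epsilon>)" if "\<And>z. z \<in> ?B \<Longrightarrow> ?q \<epsilon> z > 0" for \<epsilon>
      unfolding e_def[abs_def]
    proof (intro smooth_on_scaleR smooth_on_divide smooth_on_const smooth_on_sqrt open_ball)
      show "smooth_on ?B (?q \<epsilon>)" "smooth_on ?B (proj \<epsilon> \<omega>)" using smq smooth_proj B smooth_on_subset by blast+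
      show "\<And>z. z \<in> ?B \<Longrightarrow> ?q \<epsilon> z > 0" "\<And>z. z \<in> ?B \<Longrightarrow> sqrt (?q \<epsilon> z) \<noteq> 0" using that by force+
    qed
    show "smooth_on ?B (e 1)" "smooth_on ?B (e (-1))" using * qpos by auto
  qed
  have main: "(lip (e 1 z) (e 1 z) = 1 \<and> lip (e (-1) z) (e (-1) z) = 1 \<and> lip (e 1 z) (e (-1) z) = 0) \<and>
     D\<^sub>u P z = lip (D\<^sub>u P z) (e 1 z) *\<^sub>R e 1 z + lip (D\<^sub>u P z) (e (-1) z) *\<^sub>R e (-1) z \<and>
       D\<^sub>v P z = lip (D\<^sub>v P z) (e 1 z) *\<^sub>R e 1 z + lip (D\<^sub>v P z) (e (-1) z) *\<^sub>R e (-1) z \<and>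
       D\<^sub>u N z = lam z *\<^sub>R (lip (D\<^sub>u P z) (e 1 z) *\<^sub>R e 1 z - lip (D\<^sub>u P z) (e (-1) z) *\<^sub>R e (-1) z) \<and>
       D\<^sub>v N z = lam z *\<^sub>R (lip (D\<^sub>v P z) (e 1 z) *\<^sub>R e 1 z - lip (D\<^sub>v P z) (e (-1) z) *\<^sub>R e (-1) z)"
    if z: "z \<in> ?B" for z
  proof -
    obtain v w s t s' t' where 1: "lip v v > 0" "lip w w > 0" "lip v w = 0"
    "D\<^sub>u P z = s *\<^sub>R v + t *\<^sub>R w" "D\<^sub>v P z = s' *\<^sub>R v + t' *\<^sub>R w"
    "D\<^sub>u N z = lam z *\<^sub>R (s *\<^sub>R v - t *\<^sub>R w)" "D\<^sub>v N z = lam z *\<^sub>R (s' *\<^sub>R v - t' *\<^sub>R w)"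
    "s * t' - t * s' \<noteq> 0" "lam z > 0"
     "lip (D\<^sub>u P z) (D\<^sub>u P z) > 0" "lip (D\<^sub>u N z) (D\<^sub>u N z) > 0" by (rule pointwise[OF subsetD[OF B z]])
    have ee: "lip (e 1 z) (e 1 z) = 1" "lip (e (-1) z) (e (-1) z) = 1"
      using qpos[OF z] by (auto simp: e_def lip_simps)
    obtain c d where cd: "e 1 z = c *\<^sub>R v" "e (-1) z = d *\<^sub>R w"
      unfolding e_def projs[OF 1(4-7,9)] scaleR_scaleR by blast
    have o: "lip (e 1 z) (e (-1) z) = 0" unfolding cd using 1(3) by (simp add: lip_simps)
    have c: "c * (c * lip v v) = 1" "d * (d * lip w w) = 1" using ee unfolding cd by (auto simp: lip_simps)
    have cv: "lip (x *\<^sub>R v + y *\<^sub>R w) (e 1 z) *\<^sub>R e 1 z = x *\<^sub>R v" "lip (x *\<^sub>R v + y *\<^sub>R w) (e (-1) z) *\<^sub>R e (-1) z = y *\<^sub>R w" for x y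
    proof -
      have "lip (x *\<^sub>R v + y *\<^sub>R w) (e 1 z) *\<^sub>R e 1 z = (x * (c * (c * lip v v))) *\<^sub>R v"
        "lip (x *\<^sub>R v + y *\<^sub>R w) (e (-1) z) *\<^sub>R e (-1) z = (y * (d * (d * lip w w))) *\<^sub>R w"
        unfolding cd using 1(3) lip_commute[of w v] by (simp_all add: lip_simps algebra_simps)
      then show "lip (x *\<^sub>R v + y *\<^sub>R w) (e 1 z) *\<^sub>R e 1 z = x *\<^sub>R v" "lip (x *\<^sub>R v + y *\<^sub>R w) (e (-1) z) *\<^sub>R e (-1) z = y *\<^sub>R w"
        unfolding c by simp_all
    qed
    show ?thesis unfolding 1(4-7) cv using ee o by simp
  qed
  show ?thesis
    by (rule that[OF r(1) B sme]) (use main in blast)+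
qed

text \<open>The closed forms A (dP, e1) and A (dP, e2) have primitives f and h on a disc. In the
  parameters G = (f, h) the derivatives of P are e1 / A and e2 / A and those of N are A e1 and - A
  e2.\<close>

lemma curvature_line_parameters:
  assumes z0: "z0 \<in> U"
  obtains U' V G g A where "open U'" "U' \<subseteq> U" "z0 \<in> U'" "open V" "homeomorphism U' V G g"
    "smooth_on U' G" "smooth_on V g" "smooth_on V A" "\<And>y. y \<in> V \<Longrightarrow> A y > 0"
    "\<And>y. y \<in> V \<Longrightarrow> D\<^sub>u (\<lambda>y. N (g y)) y = (A y)\<^sup>2 *\<^sub>R D\<^sub>u (\<lambda>y. P (g y)) y"
    "\<And>y. y \<in> V \<Longrightarrow> D\<^sub>v (\<lambda>y. N (g y)) y = - (A y)\<^sup>2 *\<^sub>R D\<^sub>v (\<lambda>y. P (g y)) y"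
    "\<And>y. y \<in> V \<Longrightarrow> D\<^sub>u (\<lambda>y. P (g y)) y \<noteq> 0" "\<And>y. y \<in> V \<Longrightarrow> D\<^sub>v (\<lambda>y. P (g y)) y \<noteq> 0"
proof -
  obtain r e1 e2 where r: "r > 0" "ball z0 r \<subseteq> U" and sme: "smooth_on (ball z0 r) e1" "smooth_on (ball z0 r) e2"
    and ee: "\<And>z. z \<in> ball z0 r \<Longrightarrow> lip (e1 z) (e1 z) = 1 \<and> lip (e2 z) (e2 z) = 1 \<and> lip (e1 z) (e2 z) = 0"
    and ex: "\<And>z. z \<in> ball z0 r \<Longrightarrow>
       D\<^sub>u P z = lip (D\<^sub>u P z) (e1 z) *\<^sub>R e1 z + lip (D\<^sub>u P z) (e2 z) *\<^sub>R e2 z \<and>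
       D\<^sub>v P z = lip (D\<^sub>v P z) (e1 z) *\<^sub>R e1 z + lip (D\<^sub>v P z) (e2 z) *\<^sub>R e2 z \<and>
       D\<^sub>u N z = lam z *\<^sub>R (lip (D\<^sub>u P z) (e1 z) *\<^sub>R e1 z - lip (D\<^sub>u P z) (e2 z) *\<^sub>R e2 z) \<and>
       D\<^sub>v N z = lam z *\<^sub>R (lip (D\<^sub>v P z) (e1 z) *\<^sub>R e1 z - lip (D\<^sub>v P z) (e2 z) *\<^sub>R e2 z)"
    by (rule principal_frame[OF z0]) blast
  let ?B = "ball z0 r"
  define A where "A z = sqrt (lam z)" for z
  have lampos: "lam z > 0" if "z \<in> ?B" for z using that r(2) by (auto elim!: pointwise)
  have A: "A z > 0" "(A z)\<^sup>2 = lam z" if "z \<in> ?B" for z using lampos[OF that] by (auto simp: A_def)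
  have smB: "smooth_on ?B P" "smooth_on ?B N" "smooth_on ?B lam" using smP smN smooth_lam r(2) smooth_on_subset by blast+
  have smA: "smooth_on ?B A" unfolding A_def[abs_def] by (intro smooth_on_sqrt smB open_ball lampos)
  define \<alpha>1 \<beta>1 \<alpha>2 \<beta>2 where ab: "\<alpha>1 = (\<lambda>x. A x * lip (D\<^sub>u P x) (e1 x))" "\<beta>1 = (\<lambda>x. A x * lip (D\<^sub>v P x) (e1 x))"
    "\<alpha>2 = (\<lambda>x. A x * lip (D\<^sub>u P x) (e2 x))" "\<beta>2 = (\<lambda>x. A x * lip (D\<^sub>v P x) (e2 x))"
  have sma: "smooth_on ?B \<alpha>1" "smooth_on ?B \<beta>1" "smooth_on ?B \<alpha>2" "smooth_on ?B \<beta>2"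
    unfolding ab by (intro smooth_on_mult smooth_on_lip open_ball smA smooth_on_D smB sme)+
  have cl1: "D\<^sub>v \<alpha>1 z = D\<^sub>u \<beta>1 z" if z: "z \<in> ?B" for z
    unfolding ab
  proof (rule principal_form_closed[OF open_ball smB(1,2) sme(1) smA _ _ _ _ _ _ _ _ z, where e'=e2 and \<epsilon>=1])
    fix x assume x: "x \<in> ?B"
    show "A x \<noteq> 0" using A[OF x] by auto
    show "lip (e1 x) (e1 x) = 1" "lip (e1 x) (e2 x) = 0" using ee[OF x] by auto
  qed (use ex A in auto)
  \<comment> \<open>Exchanging e1 and e2 reverses the sign of dN, which \<epsilon> = -1
    absorbs.\<close>
  have cl2: "D\<^sub>v \<alpha>2 z = D\<^sub>u \<beta>2 z" if z: "z \<in> ?B" for z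
    unfolding ab
  proof (rule principal_form_closed[OF open_ball smB(1,2) sme(2) smA _ _ _ _ _ _ _ _ z, where e'=e1 and \<epsilon>="-1"])
    fix x assume x: "x \<in> ?B"
    show "A x \<noteq> 0" using A[OF x] by auto
    show "lip (e2 x) (e2 x) = 1" "lip (e2 x) (e1 x) = 0" using ee[OF x] lip_commute by metis+
    show "D\<^sub>u P x = lip (D\<^sub>u P x) (e2 x) *\<^sub>R e2 x + lip (D\<^sub>u P x) (e1 x) *\<^sub>R e1 x"
       "D\<^sub>v P x = lip (D\<^sub>v P x) (e2 x) *\<^sub>R e2 x + lip (D\<^sub>v P x) (e1 x) *\<^sub>R e1 x"
      using ex[OF x] by (metis add.commute)+
    have "D\<^sub>u N x = lam x *\<^sub>R (lip (D\<^sub>u P x) (e1 x) *\<^sub>R e1 x - lip (D\<^sub>u P x) (e2 x) *\<^sub>R e2 x)"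
       "D\<^sub>v N x = lam x *\<^sub>R (lip (D\<^sub>v P x) (e1 x) *\<^sub>R e1 x - lip (D\<^sub>v P x) (e2 x) *\<^sub>R e2 x)" using ex[OF x] by blast+
    then show "D\<^sub>u N x = (- 1 * (A x)\<^sup>2) *\<^sub>R (lip (D\<^sub>u P x) (e2 x) *\<^sub>R e2 x - lip (D\<^sub>u P x) (e1 x) *\<^sub>R e1 x)"
      "D\<^sub>v N x = (- 1 * (A x)\<^sup>2) *\<^sub>R (lip (D\<^sub>v P x) (e2 x) *\<^sub>R e2 x - lip (D\<^sub>v P x) (e1 x) *\<^sub>R e1 x)"
      unfolding A(2)[OF x] by (simp_all only: scaleR_diff_right minus_mult_left scaleR_minus_left mult_1 minus_diff_eq) (simp_all add: algebra_simps)
  qed simp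
  obtain f where f: "smooth_on ?B f" "\<And>z. z \<in> ?B \<Longrightarrow> D\<^sub>u f z = \<alpha>1 z" "\<And>z. z \<in> ?B \<Longrightarrow> D\<^sub>v f z = \<beta>1 z"
    using closed_form_exact[OF sma(1,2) cl1] by blast
  obtain h where h: "smooth_on ?B h" "\<And>z. z \<in> ?B \<Longrightarrow> D\<^sub>u h z = \<alpha>2 z" "\<And>z. z \<in> ?B \<Longrightarrow> D\<^sub>v h z = \<beta>2 z"
    using closed_form_exact[OF sma(3,4) cl2] by blast
  define G where "G z = (f z, h z)" for z
  have smG: "smooth_on ?B G" unfolding G_def[abs_def] by (intro smooth_on_Pair open_ball f h)
  have DG: "D\<^sub>u G z = (\<alpha>1 z, \<alpha>2 z)" "D\<^sub>v G z = (\<beta>1 z, \<beta>2 z)" if "z \<in> ?B" for z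
    using D_eq_derivative[OF has_derivative_Pair[OF smooth_on_has_D[OF f(1) that] smooth_on_has_D[OF h(1) that]]]
      f(2,3)[OF that] h(2,3)[OF that] by (simp_all add: G_def[abs_def])
  have z0B: "z0 \<in> ?B" using r by simp
  \<comment> \<open>Up to A^2 this is the determinant of dP in the frame e1, e2. A vector killed by
    dP is killed by dN as well, since both have the same components up to sign and scale, so
    regularity applies.\<close>
  have jac0: "jac G z0 \<noteq> 0"
  proof
    assume "jac G z0 = 0"
    then have j: "A z0 * A z0 * (lip (D\<^sub>u P z0) (e1 z0) * lip (D\<^sub>v P z0) (e2 z0) - lip (D\<^sub>v P z0) (e1 z0) * lip (D\<^sub>u P z0) (e2 z0)) = 0"
      by (simp add: jac_def DG[OF z0B] ab algebra_simps)
    let ?p = "lip (D\<^sub>u P z0) (e1 z0)" and ?q = "lip (D\<^sub>v P z0) (e1 z0)" and ?p' = "lip (D\<^sub>u P z0) (e2 z0)" and ?q' = "lip (D\<^sub>v P z0) (e2 z0)"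
    have j: "?p * ?q' - ?q * ?p' = 0" using j A(1)[OF z0B] by simp
    have "\<zeta> = 0" if "fst \<zeta> * ?p + snd \<zeta> * ?q = 0" "fst \<zeta> * ?p' + snd \<zeta> * ?q' = 0" for \<zeta> :: "real \<times> real"
    proof (rule regular[OF z0])
      have "fst \<zeta> *\<^sub>R D\<^sub>u P z0 + snd \<zeta> *\<^sub>R D\<^sub>v P z0 = (fst \<zeta> * ?p + snd \<zeta> * ?q) *\<^sub>R e1 z0 + (fst \<zeta> * ?p' + snd \<zeta> * ?q') *\<^sub>R e2 z0"
        by (rule combination_of_combinations) (use ex[OF z0B] in blast)+
      then show "fst \<zeta> *\<^sub>R D\<^sub>u P z0 + snd \<zeta> *\<^sub>R D\<^sub>v P z0 = 0" using that by simp
      have N0: "D\<^sub>u N z0 = lam z0 *\<^sub>R (?p *\<^sub>R e1 z0 - ?p' *\<^sub>R e2 z0)" "D\<^sub>v N z0 = lam z0 *\<^sub>R (?q *\<^sub>R e1 z0 - ?q' *\<^sub>R e2 z0)"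
        using ex[OF z0B] by blast+
      have "fst \<zeta> *\<^sub>R D\<^sub>u N z0 + snd \<zeta> *\<^sub>R D\<^sub>v N z0 = lam z0 *\<^sub>R ((fst \<zeta> * ?p + snd \<zeta> * ?q) *\<^sub>R e1 z0 - (fst \<zeta> * ?p' + snd \<zeta> * ?q') *\<^sub>R e2 z0)"
        unfolding N0 by (simp add: algebra_simps)
      then show "fst \<zeta> *\<^sub>R D\<^sub>u N z0 + snd \<zeta> *\<^sub>R D\<^sub>v N z0 = 0" using that by simp
    qed
    note zero = this
    have "(?q, - ?p) = 0" by (rule zero) (use j in \<open>simp_all add: algebra_simps\<close>)
    moreover have "(?q', - ?p') = 0" by (rule zero) (use j in \<open>simp_all add: algebra_simps\<close>)
    ultimately have "?p = 0" "?p' = 0" by (simp_all add: zero_prod_def)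
    then have "(1 :: real, 0 :: real) = 0" by (intro zero) simp_all
    then show False by (simp add: zero_prod_def)
  qed
  show ?thesis
  proof (rule smooth_local_inverse[OF open_ball smG z0B jac0])
    fix U' V g
    assume *: "open U'" "U' \<subseteq> ?B" "z0 \<in> U'" "open V" "homeomorphism U' V G g"
      "smooth_on V g" "\<And>z. z \<in> U' \<Longrightarrow> jac G z \<noteq> 0" "\<And>y. y \<in> V \<Longrightarrow> (g has_derivative dinv G (g y)) (at y)"
    have gV: "g y \<in> U'" if "y \<in> V" for y using *(5) that unfolding homeomorphism_def by auto
    have DPN: "D\<^sub>u (\<lambda>y. P (g y)) y = (1 / A (g y)) *\<^sub>R e1 (g y)" "D\<^sub>v (\<lambda>y. P (g y)) y = (1 / A (g y)) *\<^sub>R e2 (g y)"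
      "D\<^sub>u (\<lambda>y. N (g y)) y = A (g y) *\<^sub>R e1 (g y)" "D\<^sub>v (\<lambda>y. N (g y)) y = - A (g y) *\<^sub>R e2 (g y)" if y: "y \<in> V" for y
    proof -
      let ?z = "g y"
      have z: "?z \<in> ?B" using gV[OF y] *(2) by blast
      have comp: "((\<lambda>y. F (g y)) has_derivative (\<lambda>w. fst (dinv G ?z w) *\<^sub>R D\<^sub>u F ?z + snd (dinv G ?z w) *\<^sub>R D\<^sub>v F ?z)) (at y)"
        if "smooth_on ?B F" for F :: "real \<times> real \<Rightarrow> r42"
        using diff_chain_at[OF *(8)[OF y] smooth_on_has_D[OF that z]] by (simp add: o_def)
      note DPu = D_eq_derivative[OF comp[OF smB(1)]] and DNu = D_eq_derivative[OF comp[OF smB(2)]]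
      let ?p = "lip (D\<^sub>u P ?z) (e1 ?z)" and ?q = "lip (D\<^sub>v P ?z) (e1 ?z)" and ?p' = "lip (D\<^sub>u P ?z) (e2 ?z)" and ?q' = "lip (D\<^sub>v P ?z) (e2 ?z)"
      \<comment> \<open>Here w is a vector in the new parameters and \<zeta> its preimage under dG,
        whose components are A times those of dP.\<close>
      have X: "fst \<zeta> *\<^sub>R D\<^sub>u P ?z + snd \<zeta> *\<^sub>R D\<^sub>v P ?z = (1 / A ?z) *\<^sub>R (fst w *\<^sub>R e1 ?z + snd w *\<^sub>R e2 ?z) \<and>
          fst \<zeta> *\<^sub>R D\<^sub>u N ?z + snd \<zeta> *\<^sub>R D\<^sub>v N ?z = A ?z *\<^sub>R (fst w *\<^sub>R e1 ?z - snd w *\<^sub>R e2 ?z)" if \<zeta>: "\<zeta> = dinv G ?z w" for \<zeta> w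
      proof -
        have "fst \<zeta> *\<^sub>R D\<^sub>u G ?z + snd \<zeta> *\<^sub>R D\<^sub>v G ?z = w"
          unfolding \<zeta> by (rule dinv_right_inverse[OF *(7)[OF gV[OF y]]])
        then have "A ?z * (fst \<zeta> * ?p + snd \<zeta> * ?q) = fst w" "A ?z * (fst \<zeta> * ?p' + snd \<zeta> * ?q') = snd w"
          unfolding DG[OF z] by (auto simp: ab algebra_simps)
        then have w: "fst \<zeta> * ?p + snd \<zeta> * ?q = fst w / A ?z" "fst \<zeta> * ?p' + snd \<zeta> * ?q' = snd w / A ?z"
          using A(1)[OF z] by (auto simp: field_simps)
        have "fst \<zeta> *\<^sub>R D\<^sub>u P ?z + snd \<zeta> *\<^sub>R D\<^sub>v P ?z = (fst \<zeta> * ?p + snd \<zeta> * ?q) *\<^sub>R e1 ?z + (fst \<zeta> * ?p' + snd \<zeta> * ?q') *\<^sub>R e2 ?z"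
          by (rule combination_of_combinations) (use ex[OF z] in blast)+
        moreover have N0: "D\<^sub>u N ?z = lam ?z *\<^sub>R (?p *\<^sub>R e1 ?z - ?p' *\<^sub>R e2 ?z)" "D\<^sub>v N ?z = lam ?z *\<^sub>R (?q *\<^sub>R e1 ?z - ?q' *\<^sub>R e2 ?z)"
          using ex[OF z] by blast+
        have "fst \<zeta> *\<^sub>R D\<^sub>u N ?z + snd \<zeta> *\<^sub>R D\<^sub>v N ?z = lam ?z *\<^sub>R ((fst \<zeta> * ?p + snd \<zeta> * ?q) *\<^sub>R e1 ?z - (fst \<zeta> * ?p' + snd \<zeta> * ?q') *\<^sub>R e2 ?z)"
          unfolding N0 by (simp add: algebra_simps)
        ultimately show ?thesis
          unfolding w A(2)[OF z, symmetric] using A(1)[OF z] by (simp add: power2_eq_square algebra_simps)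
      qed
      show "D\<^sub>u (\<lambda>y. P (g y)) y = (1 / A (g y)) *\<^sub>R e1 (g y)" "D\<^sub>v (\<lambda>y. P (g y)) y = (1 / A (g y)) *\<^sub>R e2 (g y)"
        "D\<^sub>u (\<lambda>y. N (g y)) y = A (g y) *\<^sub>R e1 (g y)" "D\<^sub>v (\<lambda>y. N (g y)) y = - A (g y) *\<^sub>R e2 (g y)"
        unfolding DPu DNu using X[OF refl, of "(1, 0)"] X[OF refl, of "(0, 1)"] by simp_all
    qed
    have smAg: "smooth_on V (\<lambda>y. A (g y))"
      by (rule smooth_on_compose[OF *(4) open_ball _ *(6) smA]) (use gV *(2) in blast)
    show ?thesis
    proof (rule that[OF *(1) _ *(3,4,5) _ *(6) smAg])
      show "U' \<subseteq> U" using *(2) r(2) by blast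
      show "smooth_on U' G" using smG *(2) smooth_on_subset by blast
      fix y assume y: "y \<in> V"
      then have z: "g y \<in> ?B" using gV *(2) by blast
      show "A (g y) > 0" using A z by blast
      show "D\<^sub>u (\<lambda>y. N (g y)) y = (A (g y))\<^sup>2 *\<^sub>R D\<^sub>u (\<lambda>y. P (g y)) y"
        "D\<^sub>v (\<lambda>y. N (g y)) y = - (A (g y))\<^sup>2 *\<^sub>R D\<^sub>v (\<lambda>y. P (g y)) y"
        unfolding DPN[OF y] using A(1)[OF z] by (simp_all add: power2_eq_square)
      have "e1 (g y) \<noteq> 0" "e2 (g y) \<noteq> 0" using ee[OF z] by (auto simp: lip_simps)
      then show "D\<^sub>u (\<lambda>y. P (g y)) y \<noteq> 0" "D\<^sub>v (\<lambda>y. P (g y)) y \<noteq> 0"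
        unfolding DPN[OF y] using A(1)[OF z] by simp_all
  qed
qed
qed

end

section \<open>Smooth maps on a surface\<close>

lemma is_chartD:
  assumes "is_chart c"
  shows "open (dom_c c)" "open (map_c c ` dom_c c)" "continuous_on (dom_c c) (map_c c)"
    "continuous_on (map_c c ` dom_c c) (param c)" "x \<in> dom_c c \<Longrightarrow> param c (map_c c x) = x"
    "z \<in> map_c c ` dom_c c \<Longrightarrow> map_c c (param c z) = z" "z \<in> map_c c ` dom_c c \<Longrightarrow> param c z \<in> dom_c c"
  using assms unfolding is_chart_def homeomorphism_def by auto

lemma chart_image_iff:
  assumes "is_chart c"
  shows "z \<in> map_c c ` (dom_c c \<inter> V) \<longleftrightarrow> z \<in> map_c c ` dom_c c \<and> param c z \<in> V"
  using is_chartD(5-7)[OF assms] by (auto intro!: image_eqI[of z "map_c c" "param c z"])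

lemma open_chart_image:
  assumes "is_chart c" "open V"
  shows "open (map_c c ` (dom_c c \<inter> V))"
proof -
  have "map_c c ` (dom_c c \<inter> V) = map_c c ` dom_c c \<inter> param c -` V"
    using chart_image_iff[OF assms(1)] by blast
  then show ?thesis
    using continuous_open_preimage[OF is_chartD(4,2)[OF assms(1)] assms(2)] by simp
qed

lemma smooth_changeD:
  assumes "is_chart c" "is_chart d" "smooth_change c d"
  defines "W \<equiv> map_c c ` (dom_c c \<inter> dom_c d)"
  shows "open W" "smooth_on W (map_c d \<circ> param c)" "z \<in> W \<Longrightarrow> (map_c d \<circ> param c) z \<in> map_c d ` (dom_c d \<inter> dom_c c)"
    "z \<in> W \<Longrightarrow> param d ((map_c d \<circ> param c) z) = param c z"
  using open_chart_image[OF assms(1) is_chartD(1)[OF assms(2)]] assms(3) is_chartD(5-7)[OF assms(1)] is_chartD(5-7)[OF assms(2)]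
  unfolding W_def smooth_change_def by auto

text \<open>The image of \<xi> under the differential of the chart change, which has a left inverse.
  One \<xi>' works for all g, so relations between dP and dN survive the change. The charts are
  merely compatible, so one of them may be a refined chart.\<close>

lemma dmap_chart_change:
  assumes c: "is_chart c" and d: "is_chart d" and cd: "smooth_change c d" "smooth_change d c"
    and x: "x \<in> dom_c c" "x \<in> dom_c d" and \<xi>: "\<xi> \<noteq> 0"
  obtains \<xi>' where "\<xi>' \<noteq> 0"
    "\<And>g :: 'm::topological_space \<Rightarrow> 'b::real_normed_vector. (g \<circ> param d) differentiable (at (map_c d x)) \<Longrightarrow> dmap c g x \<xi> = dmap d g x \<xi>'"
proof -
  let ?t = "map_c d \<circ> param c" and ?s = "map_c c \<circ> param d"
  let ?W = "map_c c ` (dom_c c \<inter> dom_c d)"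
  note C = smooth_changeD[OF c d cd(1)] and D = smooth_changeD[OF d c cd(2)]
  have z: "map_c c x \<in> ?W" and z': "map_c d x \<in> map_c d ` (dom_c d \<inter> dom_c c)" using x by auto
  have tz: "?t (map_c c x) = map_c d x" using is_chartD(5)[OF c x(1)] by simp
  have td: "(?t has_derivative frechet_derivative ?t (at (map_c c x))) (at (map_c c x))"
    by (rule smooth_on_has_derivative[OF C(2) z])
  have sd: "(?s has_derivative frechet_derivative ?s (at (map_c d x))) (at (?t (map_c c x)))"
    unfolding tz by (rule smooth_on_has_derivative[OF D(2) z'])
  define \<xi>' where "\<xi>' = frechet_derivative ?t (at (map_c c x)) \<xi>"
  have "((?s \<circ> ?t) has_derivative frechet_derivative ?s (at (map_c d x)) \<circ> frechet_derivative ?t (at (map_c c x))) (at (map_c c x))"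
    by (rule diff_chain_at[OF td sd])
  moreover have "(?s \<circ> ?t) z = z" if "z \<in> ?W" for z
  proof -
    have "z \<in> map_c c ` dom_c c" using that by blast
    from is_chartD(6)[OF c this] C(4)[OF that] show ?thesis by simp
  qed
  ultimately have "((\<lambda>z. z) has_derivative frechet_derivative ?s (at (map_c d x)) \<circ> frechet_derivative ?t (at (map_c c x))) (at (map_c c x))"
    using has_derivative_transform_within_open[OF _ C(1) z, of "?s \<circ> ?t" _ UNIV "\<lambda>z. z"] by simp
  then have "frechet_derivative ?s (at (map_c d x)) \<circ> frechet_derivative ?t (at (map_c c x)) = (\<lambda>w. w)"
    using has_derivative_unique[OF _ has_derivative_ident] by blast
  from fun_cong[OF this, of \<xi>] have "frechet_derivative ?s (at (map_c d x)) \<xi>' = \<xi>" by (simp add: \<xi>'_def)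
  then have ne: "\<xi>' \<noteq> 0" using \<xi> linear_0[OF has_derivative_linear[OF sd]] by auto
  have "dmap c g x \<xi> = dmap d g x \<xi>'" if "(g \<circ> param d) differentiable (at (map_c d x))" for g :: "'m \<Rightarrow> 'b"
  proof -
    have "((g \<circ> param d) has_derivative frechet_derivative (g \<circ> param d) (at (map_c d x))) (at (?t (map_c c x)))"
      using that frechet_derivative_works unfolding tz by blast
    from diff_chain_at[OF td this]
    have "((g \<circ> param c) has_derivative frechet_derivative (g \<circ> param d) (at (map_c d x)) \<circ> frechet_derivative ?t (at (map_c c x))) (at (map_c c x))"
      by (rule has_derivative_transform_within_open[OF _ C(1) z]) (use C(4) in auto)
    from fun_cong[OF frechet_derivative_at[OF this], of \<xi>] show ?thesis by (simp add: dmap_def \<xi>'_def)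
  qed
  with ne that show ?thesis by blast
qed

locale atlas =
  fixes A :: "'m::{t2_space,second_countable_topology} chart set"
  assumes surface: "surface A"
begin

lemma chart: "c \<in> A \<Longrightarrow> is_chart c" and change: "c \<in> A \<Longrightarrow> d \<in> A \<Longrightarrow> smooth_change c d"
  and connected: "connected (points A)"
  using surface by (auto simp: surface_def)

lemma open_points: "open (points A)"
  unfolding points_def using is_chartD(1)[OF chart] by blast

lemma dom_points: "c \<in> A \<Longrightarrow> x \<in> dom_c c \<Longrightarrow> x \<in> points A"
  by (auto simp: points_def)

lemma pointsE: assumes "x \<in> points A" obtains c where "c \<in> A" "x \<in> dom_c c"
  using assms by (auto simp: points_def)

lemma smooth_mapD: "smooth_map A V g \<Longrightarrow> c \<in> A \<Longrightarrow> smooth_on (map_c c ` (dom_c c \<inter> V)) (g \<circ> param c)"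
  by (simp add: smooth_map_def)

lemma smooth_map_subset: "smooth_map A V g \<Longrightarrow> W \<subseteq> V \<Longrightarrow> smooth_map A W g"
  unfolding smooth_map_def by (meson Int_mono image_mono order_refl smooth_on_subset)

lemma smooth_map_differentiable:
  assumes "smooth_map A V g" "c \<in> A" "x \<in> dom_c c" "x \<in> V"
  shows "(g \<circ> param c) differentiable (at (map_c c x))"
  using smooth_on_differentiable[OF smooth_mapD[OF assms(1,2)]] assms(3,4) by blast

lemma smooth_map_cong:
  assumes "open V" "\<And>x. x \<in> V \<Longrightarrow> g x = h x"
  shows "smooth_map A V g \<longleftrightarrow> smooth_map A V h"
  unfolding smooth_map_def
proof (rule ball_cong)
  fix c assume "c \<in> A"
  then have c: "is_chart c" by (rule chart)
  show "smooth_on (map_c c ` (dom_c c \<inter> V)) (g \<circ> param c) \<longleftrightarrow> smooth_on (map_c c ` (dom_c c \<inter> V)) (h \<circ> param c)"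
    by (rule smooth_on_cong[OF open_chart_image[OF c assms(1)]]) (use assms(2) chart_image_iff[OF c] in auto)
qed simp

lemma smooth_map_local:
  assumes "\<And>x. x \<in> V \<Longrightarrow> \<exists>W. open W \<and> x \<in> W \<and> smooth_map A W g"
  shows "smooth_map A V g"
  unfolding smooth_map_def
proof (intro ballI smooth_on_local)
  fix c z assume c: "c \<in> A" and z: "z \<in> map_c c ` (dom_c c \<inter> V)"
  then obtain x where x: "x \<in> dom_c c" "x \<in> V" "z = map_c c x" by blast
  obtain W where W: "open W" "x \<in> W" "smooth_map A W g" using assms[OF x(2)] by blast
  show "\<exists>T. open T \<and> z \<in> T \<and> smooth_on T (g \<circ> param c)"
    by (rule exI[of _ "map_c c ` (dom_c c \<inter> W)"])
      (use open_chart_image[OF chart[OF c] W(1)] x W smooth_mapD[OF W(3) c] in blast)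
qed

lemma smooth_map_continuous:
  assumes g: "smooth_map A V g" and V: "open V" "V \<subseteq> points A"
  shows "continuous_on V g"
proof (rule continuous_at_imp_continuous_on, rule ballI)
  fix x assume x: "x \<in> V"
  from subsetD[OF V(2) this] obtain c where c: "c \<in> A" "x \<in> dom_c c" by (rule pointsE)
  note C = is_chartD[OF chart[OF c(1)]]
  have "continuous_on (map_c c ` (dom_c c \<inter> V)) (g \<circ> param c)"
    by (rule smooth_on_continuous[OF smooth_mapD[OF g c(1)]])
  then have "continuous_on (dom_c c \<inter> V) ((g \<circ> param c) \<circ> map_c c)"
    by (rule continuous_on_compose[OF continuous_on_subset[OF C(3) Int_lower1]])
  then have "continuous_on (dom_c c \<inter> V) g"
    by (rule continuous_on_eq) (use C(5) in auto)
  moreover have "open (dom_c c \<inter> V)" "x \<in> dom_c c \<inter> V" using C(1) V(1) c x by auto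
  ultimately show "isCont g x" by (simp add: continuous_on_eq_continuous_at)
qed

lemma smooth_map_const: "open V \<Longrightarrow> smooth_map A V (\<lambda>x. k)"
  unfolding smooth_map_def o_def using open_chart_image[OF chart] smooth_on_const by blast

lemma smooth_map_bilinear:
  assumes "bounded_bilinear B" "open V" "smooth_map A V g" "smooth_map A V h"
  shows "smooth_map A V (\<lambda>x. B (g x) (h x))"
  unfolding smooth_map_def
proof
  fix c assume c: "c \<in> A"
  show "smooth_on (map_c c ` (dom_c c \<inter> V)) ((\<lambda>x. B (g x) (h x)) \<circ> param c)"
    using smooth_on_bilinear[OF assms(1) open_chart_image[OF chart[OF c] assms(2)] smooth_mapD[OF assms(3) c] smooth_mapD[OF assms(4) c]]
    by (simp add: o_def)
qed

lemma smooth_map_add: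
  assumes "open V" "smooth_map A V g" "smooth_map A V h"
  shows "smooth_map A V (\<lambda>x. g x + h x)"
  unfolding smooth_map_def
proof
  fix c assume c: "c \<in> A"
  show "smooth_on (map_c c ` (dom_c c \<inter> V)) ((\<lambda>x. g x + h x) \<circ> param c)"
    using smooth_on_add[OF open_chart_image[OF chart[OF c] assms(1)] smooth_mapD[OF assms(2) c] smooth_mapD[OF assms(3) c]]
    by (simp add: o_def)
qed

lemma smooth_map_linear:
  assumes "bounded_linear L" "open V" "smooth_map A V g"
  shows "smooth_map A V (\<lambda>x. L (g x))"
  unfolding smooth_map_def
proof
  fix c assume c: "c \<in> A"
  show "smooth_on (map_c c ` (dom_c c \<inter> V)) ((\<lambda>x. L (g x)) \<circ> param c)"
    using smooth_on_linear[OF assms(1) open_chart_image[OF chart[OF c] assms(2)] smooth_mapD[OF assms(3) c]]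
    by (simp add: o_def)
qed

lemma smooth_map_diff:
  assumes "open V" "smooth_map A V g" "smooth_map A V h"
  shows "smooth_map A V (\<lambda>x. g x - h x)"
  using smooth_map_add[OF assms(1,2) smooth_map_linear[OF bounded_linear_minus[OF bounded_linear_ident] assms(1,3)]] by simp

lemma smooth_map_scaleR:
  "open V \<Longrightarrow> smooth_map A V g \<Longrightarrow> smooth_map A V h \<Longrightarrow> smooth_map A V (\<lambda>x. g x *\<^sub>R h x)"
  by (rule smooth_map_bilinear[OF bounded_bilinear_scaleR])

lemma smooth_map_lip:
  "open V \<Longrightarrow> smooth_map A V g \<Longrightarrow> smooth_map A V h \<Longrightarrow> smooth_map A V (\<lambda>x. lip (g x) (h x))"
  by (rule smooth_map_bilinear[OF bounded_bilinear_lip])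

lemma smooth_map_inverse:
  assumes "open V" "smooth_map A V g" "\<And>x. x \<in> V \<Longrightarrow> g x \<noteq> 0"
  shows "smooth_map A V (\<lambda>x. inverse (g x) :: real)"
  unfolding smooth_map_def
proof
  fix c assume c: "c \<in> A"
  show "smooth_on (map_c c ` (dom_c c \<inter> V)) ((\<lambda>x. inverse (g x)) \<circ> param c)"
    using smooth_on_inverse[OF open_chart_image[OF chart[OF c] assms(1)] smooth_mapD[OF assms(2) c]] assms(3)
      chart_image_iff[OF chart[OF c]] by (simp add: o_def)
qed

lemma has_derivative_dmap:
  assumes "smooth_map A V g" "c \<in> A" "x \<in> dom_c c" "x \<in> V"
  shows "((g \<circ> param c) has_derivative dmap c g x) (at (map_c c x))"
  using frechet_derivative_works[THEN iffD1, OF smooth_map_differentiable[OF assms]] by (simp add: dmap_def[abs_def])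

lemma dmapI: "((g \<circ> param c) has_derivative g') (at (map_c c x)) \<Longrightarrow> dmap c g x \<xi> = g' \<xi>"
  by (simp add: dmap_def frechet_derivative_at[symmetric])

lemma dmap_cong:
  assumes c: "c \<in> A" "x \<in> dom_c c" and V: "open V" "x \<in> V" and eq: "\<And>y. y \<in> V \<Longrightarrow> g y = h y"
  shows "dmap c g x \<xi> = dmap c h x \<xi>"
proof -
  have "frechet_derivative (g \<circ> param c) (at (map_c c x)) = frechet_derivative (h \<circ> param c) (at (map_c c x))"
  proof (rule frechet_derivative_cong_open[OF open_chart_image[OF chart[OF c(1)] V(1)]])
    show "map_c c x \<in> map_c c ` (dom_c c \<inter> V)" using c V by blast
    fix z assume "z \<in> map_c c ` (dom_c c \<inter> V)"
    then have "param c z \<in> V" using chart_image_iff[OF chart[OF c(1)]] by blast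
    then show "(g \<circ> param c) z = (h \<circ> param c) z" using eq by simp
  qed
  then show ?thesis by (simp add: dmap_def)
qed

lemma dmap_bilinear:
  assumes "bounded_bilinear B" "smooth_map A V g" "smooth_map A V h" "c \<in> A" "x \<in> dom_c c" "x \<in> V"
  shows "dmap c (\<lambda>x. B (g x) (h x)) x \<xi> = B (g x) (dmap c h x \<xi>) + B (dmap c g x \<xi>) (h x)"
proof -
  have "((\<lambda>x. B (g x) (h x)) \<circ> param c has_derivative (\<lambda>\<xi>. B ((g \<circ> param c) (map_c c x)) (dmap c h x \<xi>) +
      B (dmap c g x \<xi>) ((h \<circ> param c) (map_c c x)))) (at (map_c c x))"
    using bounded_bilinear.FDERIV[OF assms(1) has_derivative_dmap[OF assms(2,4-6)] has_derivative_dmap[OF assms(3,4-6)]]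
    by (simp add: o_def)
  from dmapI[OF this] show ?thesis using is_chartD(5)[OF chart[OF assms(4)] assms(5)] by simp
qed

lemma dmap_add:
  assumes "smooth_map A V g" "smooth_map A V h" "c \<in> A" "x \<in> dom_c c" "x \<in> V"
  shows "dmap c (\<lambda>x. g x + h x) x \<xi> = dmap c g x \<xi> + dmap c h x \<xi>"
  by (rule dmapI) (use has_derivative_add[OF has_derivative_dmap[OF assms(1,3-5)] has_derivative_dmap[OF assms(2,3-5)]] in \<open>simp add: o_def\<close>)

lemma dmap_diff:
  assumes "smooth_map A V g" "smooth_map A V h" "c \<in> A" "x \<in> dom_c c" "x \<in> V"
  shows "dmap c (\<lambda>x. g x - h x) x \<xi> = dmap c g x \<xi> - dmap c h x \<xi>"
  by (rule dmapI) (use has_derivative_diff[OF has_derivative_dmap[OF assms(1,3-5)] has_derivative_dmap[OF assms(2,3-5)]] in \<open>simp add: o_def\<close>)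

lemma dmap_const: "dmap c (\<lambda>x. k) x \<xi> = 0"
  by (rule dmapI) (simp add: o_def)

lemma dmap_scale:
  assumes "smooth_map A V g" "c \<in> A" "x \<in> dom_c c" "x \<in> V"
  shows "dmap c (\<lambda>x. r *\<^sub>R g x) x \<xi> = r *\<^sub>R dmap c g x \<xi>"
  by (rule dmapI) (use has_derivative_scaleR_right[OF has_derivative_dmap[OF assms]] in \<open>simp add: o_def\<close>)

lemma dmap_lip_const:
  assumes "open V" "smooth_map A V g" "smooth_map A V h" "\<And>y. y \<in> V \<Longrightarrow> lip (g y) (h y) = r" "c \<in> A" "x \<in> dom_c c" "x \<in> V"
  shows "lip (dmap c g x \<xi>) (h x) = - lip (g x) (dmap c h x \<xi>)"
proof -
  have "dmap c (\<lambda>x. lip (g x) (h x)) x \<xi> = dmap c (\<lambda>x. r) x \<xi>"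
    by (rule dmap_cong[OF assms(5,6,1,7) assms(4)])
  then show ?thesis
    using dmap_bilinear[OF bounded_bilinear_lip assms(2,3,5-7)] by (simp add: dmap_const)
qed

lemma dmap_D:
  assumes "smooth_map A V g" "c \<in> A" "x \<in> dom_c c" "x \<in> V"
  shows "dmap c g x \<xi> = fst \<xi> *\<^sub>R D\<^sub>u (g \<circ> param c) (map_c c x) + snd \<xi> *\<^sub>R D\<^sub>v (g \<circ> param c) (map_c c x)"
  unfolding dmap_def by (rule frechet_eq_D[OF smooth_map_differentiable[OF assms]])

lemma local_section_cong:
  "(\<And>x. x \<in> points A \<Longrightarrow> f x = f' x) \<Longrightarrow> local_section A f V \<sigma> \<longleftrightarrow> local_section A f' V \<sigma>"
  unfolding local_section_def by blast

text \<open>A surface lift agrees with \<open>legendre_lift\<close> on \<open>points A\<close> only,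
  so properties are carried between maps that coincide there.\<close>

lemma legendre_map_cong:
  assumes eq: "\<And>x. x \<in> points A \<Longrightarrow> f x = f' x" and f: "legendre_map A f"
  shows "legendre_map A f'"
proof -
  have ls: "local_section A f V \<sigma> \<longleftrightarrow> local_section A f' V \<sigma>" for V \<sigma>
    using local_section_cong[of f f'] eq by blast
  have V: "V \<subseteq> points A" if "local_section A f' V \<sigma>" for V \<sigma> using that by (simp add: local_section_def)
  have "contact_congruence A f'"
    unfolding contact_congruence_def
  proof (intro conjI ballI)
    fix x assume x: "x \<in> points A"
    then show "contact_element (f' x)" using f eq by (auto simp: legendre_map_def contact_congruence_def)
    obtain V \<sigma> \<tau> where *: "x \<in> V" "local_section A f V \<sigma>" "local_section A f V \<tau>" "\<forall>y\<in>V. f y = span {\<sigma> y, \<tau> y}"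
      using f x unfolding legendre_map_def contact_congruence_def by blast
    have "local_section A f' V \<sigma>" "local_section A f' V \<tau>" using * ls by blast+
    moreover have "\<forall>y\<in>V. f' y = span {\<sigma> y, \<tau> y}" using * V[OF \<open>local_section A f' V \<sigma>\<close>] eq by (metis subsetD)
    ultimately show "\<exists>V \<sigma> \<tau>. x \<in> V \<and> local_section A f' V \<sigma> \<and> local_section A f' V \<tau> \<and> (\<forall>y\<in>V. f' y = span {\<sigma> y, \<tau> y})"
      using *(1) by blast
  qed
  moreover have "contact_condition A f'"
    using f ls unfolding legendre_map_def contact_condition_def by blast
  moreover have "regular A f'"
    unfolding regular_def
  proof (intro ballI allI impI)
    fix c x \<xi> assume c: "c \<in> A" "x \<in> dom_c c" and *: "\<forall>V \<sigma>. x \<in> V \<longrightarrow> local_section A f' V \<sigma> \<longrightarrow> dmap c \<sigma> x \<xi> \<in> f' x"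
    have "f x = f' x" using eq dom_points[OF c] by blast
    then show "\<xi> = 0" using f c * ls unfolding legendre_map_def regular_def by metis
  qed
  ultimately show ?thesis by (simp add: legendre_map_def)
qed

lemma curvature_sphere_cong:
  assumes eq: "\<And>x. x \<in> points A \<Longrightarrow> f x = f' x" and "curvature_sphere A f x S"
  shows "curvature_sphere A f' x S"
proof -
  obtain V \<sigma> c \<xi> where *: "x \<in> V" "local_section A f V \<sigma>" "\<sigma> x \<noteq> 0" "S = span {\<sigma> x}"
        "c \<in> A" "x \<in> dom_c c" "\<xi> \<noteq> 0" "dmap c \<sigma> x \<xi> \<in> f x"
    using assms(2) unfolding curvature_sphere_def by blast
  have "local_section A f' V \<sigma>" using local_section_cong[of f f'] eq *(2) by blast
  moreover have "dmap c \<sigma> x \<xi> \<in> f' x" using eq[OF dom_points[OF *(5,6)]] *(8) by simp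
  ultimately show ?thesis using * unfolding curvature_sphere_def by blast
qed

lemma umbilic_free_cong:
  "(\<And>x. x \<in> points A \<Longrightarrow> f x = f' x) \<Longrightarrow> umbilic_free A f \<Longrightarrow> umbilic_free A f'"
  unfolding umbilic_free_def using curvature_sphere_cong[of f f'] by meson

end

section \<open>Legendre maps in a null frame\<close>

text \<open>With \<open>k = p + q\<close>, \<open>l = p - q\<close>, \<open>P = F + T\<close> and \<open>N = F - T\<close>, the lift of a front \<open>F\<close> with
  normal \<open>T\<close> is spanned by the spheres \<open>k + P\<close> and \<open>N - l\<close>, which touch \<open>k\<close> and \<open>l\<close>.\<close>

locale null_map = atlas A for A :: "'m::{t2_space,second_countable_topology} chart set" +
  fixes k l :: r42 and P N :: "'m \<Rightarrow> r42" and f :: "'m \<Rightarrow> r42 set"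
  assumes smP: "smooth_map A (points A) P" and smN: "smooth_map A (points A) N"
    and nf: "x \<in> points A \<Longrightarrow> null_frame k l (P x) (N x)"
    and contact: "c \<in> A \<Longrightarrow> x \<in> dom_c c \<Longrightarrow> lip (dmap c P x \<xi>) (N x) = 0"
    and f: "x \<in> points A \<Longrightarrow> f x = span {k + P x, N x - l}"
    and legendre: "legendre_map A f"
begin

lemma coords:
  assumes c: "c \<in> A"
  shows "null_coords k l (P \<circ> param c) (N \<circ> param c) (map_c c ` dom_c c)"
proof
  note C = is_chartD[OF chart[OF c]]
  have int: "dom_c c \<inter> points A = dom_c c" using dom_points[OF c] by blast
  show "open (map_c c ` dom_c c)" by (rule C)
  show "smooth_on (map_c c ` dom_c c) (P \<circ> param c)" "smooth_on (map_c c ` dom_c c) (N \<circ> param c)"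
    using smooth_mapD[OF smP c] smooth_mapD[OF smN c] unfolding int by auto
  fix z assume z: "z \<in> map_c c ` dom_c c"
  then have x: "param c z \<in> dom_c c" "param c z \<in> points A" "map_c c (param c z) = z" using C(6,7) dom_points[OF c] by auto
  show "null_frame k l ((P \<circ> param c) z) ((N \<circ> param c) z)" using nf[OF x(2)] by simp
  show "lip (D\<^sub>u (P \<circ> param c) z) ((N \<circ> param c) z) = 0" "lip (D\<^sub>v (P \<circ> param c) z) ((N \<circ> param c) z) = 0"
    using contact[OF c x(1), of "(1, 0)"] contact[OF c x(1), of "(0, 1)"] x(3) by (auto simp: dmap_def D\<^sub>u_def D\<^sub>v_def)
qed

lemma perp_dmap:
  assumes c: "c \<in> A" "x \<in> dom_c c"
  shows "frame_perp k l (P x) (N x) (dmap c P x \<xi>)" "frame_perp k l (P x) (N x) (dmap c N x \<xi>)"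
proof -
  interpret nc: null_coords k l "P \<circ> param c" "N \<circ> param c" "map_c c ` dom_c c" by (rule coords[OF c(1)])
  have z: "map_c c x \<in> map_c c ` dom_c c" using c by auto
  note q = nc.perp[OF z]
  have p: "param c (map_c c x) = x" using is_chartD(5)[OF chart[OF c(1)] c(2)] .
  have x: "x \<in> points A" using dom_points[OF c] .
  show "frame_perp k l (P x) (N x) (dmap c P x \<xi>)" "frame_perp k l (P x) (N x) (dmap c N x \<xi>)"
    unfolding dmap_D[OF smP c x] dmap_D[OF smN c x]
    using q frame_perp_linear p by auto
qed

lemma lip_frame:
  assumes "x \<in> points A"
  shows "lip (\<alpha> *\<^sub>R (k + P x) + \<beta> *\<^sub>R (N x - l)) l = -2 * \<alpha>" "lip (\<alpha> *\<^sub>R (k + P x) + \<beta> *\<^sub>R (N x - l)) k = 2 * \<beta>"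
  using nf[OF assms] null_frame_comm[OF nf[OF assms]] by (simp_all add: null_frame_def lip_simps)

lemma lift_coeff_zero:
  assumes "x \<in> points A" "\<alpha> *\<^sub>R (k + P x) + \<beta> *\<^sub>R (N x - l) = 0"
  shows "\<alpha> = 0" "\<beta> = 0"
  using lip_frame[OF assms(1), of \<alpha> \<beta>] unfolding assms(2) by (simp_all add: lip_simps)

lemma lift_coeff_eq:
  assumes "x \<in> points A" "\<alpha> *\<^sub>R (k + P x) + \<beta> *\<^sub>R (N x - l) = \<alpha>' *\<^sub>R (k + P x) + \<beta>' *\<^sub>R (N x - l)"
  shows "\<alpha> = \<alpha>'" "\<beta> = \<beta>'"
  using lip_frame[OF assms(1), of \<alpha> \<beta>] lip_frame[OF assms(1), of \<alpha>' \<beta>'] assms(2) by simp_all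

lemma mem_f: "x \<in> points A \<Longrightarrow> y \<in> f x \<longleftrightarrow> (\<exists>\<alpha> \<beta>. y = \<alpha> *\<^sub>R (k + P x) + \<beta> *\<^sub>R (N x - l))"
  using f by (auto simp: span_insert span_singleton algebra_simps)

text \<open>k + P touches k and N - l touches l, so pairing with l and with k isolates the two
  coefficients.\<close>

lemma f_decomp:
  assumes "x \<in> points A" "y \<in> f x"
  shows "y = (lip y l / -2) *\<^sub>R (k + P x) + (lip y k / 2) *\<^sub>R (N x - l)"
proof -
  obtain \<alpha> \<beta> where y: "y = \<alpha> *\<^sub>R (k + P x) + \<beta> *\<^sub>R (N x - l)" using mem_f[OF assms(1)] assms(2) by blast
  show ?thesis using lip_frame[OF assms(1), of \<alpha> \<beta>] y by simp
qed

lemma perp_mem_f: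
  assumes "x \<in> points A" "frame_perp k l (P x) (N x) w" "w \<in> f x"
  shows "w = 0"
  using f_decomp[OF assms(1,3)] assms(2) by (simp add: frame_perp_def)

text \<open>Derivatives of the coefficients contribute vectors of f. What remains is a combination
  of dP and dN, which is orthogonal to the frame, and f contains no such vector except 0.\<close>

lemma dmap_section:
  assumes s: "local_section A f V \<sigma>" and x: "x \<in> V" and c: "c \<in> A" "x \<in> dom_c c"
  shows "dmap c \<sigma> x \<xi> \<in> f x \<longleftrightarrow> (lip (\<sigma> x) l / -2) *\<^sub>R dmap c P x \<xi> + (lip (\<sigma> x) k / 2) *\<^sub>R dmap c N x \<xi> = 0"
proof -
  have V: "open V" "V \<subseteq> points A" "smooth_map A V \<sigma>" "\<And>y. y \<in> V \<Longrightarrow> \<sigma> y \<in> f y"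
    using s by (auto simp: local_section_def)
  have xp: "x \<in> points A" using V x by blast
  define a b where "a y = lip (\<sigma> y) l / -2" and "b y = lip (\<sigma> y) k / 2" for y
  have sP: "smooth_map A V P" "smooth_map A V N" using smP smN V(2) smooth_map_subset by blast+
  have sm: "smooth_map A V a" "smooth_map A V b" "smooth_map A V (\<lambda>y. k + P y)" "smooth_map A V (\<lambda>y. N y - l)"
    unfolding a_def[abs_def] b_def[abs_def] divide_inverse
    by (intro smooth_map_bilinear[OF bounded_bilinear_mult] smooth_map_lip smooth_map_add smooth_map_diff smooth_map_const V sP)+
  have D: "dmap c (\<lambda>y. k + P y) x \<xi> = dmap c P x \<xi>" "dmap c (\<lambda>y. N y - l) x \<xi> = dmap c N x \<xi>"
    using dmap_add[OF smooth_map_const[OF V(1)] sP(1) c x, of k] dmap_diff[OF sP(2) smooth_map_const[OF V(1)] c x, of l]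
    by (simp_all add: dmap_const)
  have "dmap c \<sigma> x \<xi> = dmap c (\<lambda>y. a y *\<^sub>R (k + P y) + b y *\<^sub>R (N y - l)) x \<xi>"
    by (rule dmap_cong[OF c V(1) x], unfold a_def b_def, rule f_decomp[OF subsetD[OF V(2)] V(4)])
  also have "\<dots> = dmap c (\<lambda>y. a y *\<^sub>R (k + P y)) x \<xi> + dmap c (\<lambda>y. b y *\<^sub>R (N y - l)) x \<xi>"
    by (rule dmap_add[OF smooth_map_scaleR[OF V(1) sm(1,3)] smooth_map_scaleR[OF V(1) sm(2,4)] c x])
  also have "\<dots> = (a x *\<^sub>R dmap c P x \<xi> + b x *\<^sub>R dmap c N x \<xi>) + (dmap c a x \<xi> *\<^sub>R (k + P x) + dmap c b x \<xi> *\<^sub>R (N x - l))"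
    using dmap_bilinear[OF bounded_bilinear_scaleR sm(1,3) c x] dmap_bilinear[OF bounded_bilinear_scaleR sm(2,4) c x] D
    by simp
  finally have eq: "dmap c \<sigma> x \<xi> = (a x *\<^sub>R dmap c P x \<xi> + b x *\<^sub>R dmap c N x \<xi>) + (dmap c a x \<xi> *\<^sub>R (k + P x) + dmap c b x \<xi> *\<^sub>R (N x - l))" .
  have in_f: "dmap c a x \<xi> *\<^sub>R (k + P x) + dmap c b x \<xi> *\<^sub>R (N x - l) \<in> f x" using mem_f[OF xp] by blast
  have sub: "subspace (f x)" using f[OF xp] by simp
  have "dmap c \<sigma> x \<xi> \<in> f x \<longleftrightarrow> a x *\<^sub>R dmap c P x \<xi> + b x *\<^sub>R dmap c N x \<xi> \<in> f x"
    unfolding eq using in_f sub by (metis add_diff_cancel_right' subspace_add subspace_diff)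
  also have "\<dots> \<longleftrightarrow> a x *\<^sub>R dmap c P x \<xi> + b x *\<^sub>R dmap c N x \<xi> = 0"
    using perp_mem_f[OF xp] frame_perp_linear perp_dmap[OF c] subspace_0[OF sub] by metis
  finally show ?thesis by (simp add: a_def b_def)
qed

text \<open>Every sphere of f x extends to a section with constant coefficients, which supplies the
  sections that the definition of curvature spheres asks for.\<close>

lemma constant_section: "local_section A f (points A) (\<lambda>x. \<alpha> *\<^sub>R (k + P x) + \<beta> *\<^sub>R (N x - l))"
  unfolding local_section_def
  by (intro conjI open_points order_refl smooth_map_add smooth_map_scaleR smooth_map_diff smooth_map_const smP smN)
    (use mem_f in blast)

lemma regular_dmap:
  assumes c: "c \<in> A" "x \<in> dom_c c" and "dmap c P x \<xi> = 0" "dmap c N x \<xi> = 0"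
  shows "\<xi> = 0"
proof -
  have "dmap c \<sigma> x \<xi> \<in> f x" if "x \<in> V" "local_section A f V \<sigma>" for V \<sigma>
    unfolding dmap_section[OF that(2,1) c] using assms by simp
  then show ?thesis using legendre c unfolding legendre_map_def regular_def by blast
qed

text \<open>Curvature spheres become the degenerate members of the pencil \<alpha> dP + \<beta> dN
  in any single chart of A; the direction is first carried over from the chart in the
  definition.\<close>

lemma curvature_sphere_iff:
  assumes x: "c \<in> A" "x \<in> dom_c c"
  shows "curvature_sphere A f x S \<longleftrightarrow>
    (\<exists>\<xi> \<alpha> \<beta>. \<xi> \<noteq> 0 \<and> (\<alpha>, \<beta>) \<noteq> (0, 0) \<and> \<alpha> *\<^sub>R dmap c P x \<xi> + \<beta> *\<^sub>R dmap c N x \<xi> = 0 \<and>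
      S = span {\<alpha> *\<^sub>R (k + P x) + \<beta> *\<^sub>R (N x - l)})" (is "?L \<longleftrightarrow> ?R")
proof
  have xp: "x \<in> points A" using dom_points[OF x] .
  assume ?L
  then obtain V \<sigma> d \<xi> where *: "x \<in> V" "local_section A f V \<sigma>" "\<sigma> x \<noteq> 0" "S = span {\<sigma> x}"
        "d \<in> A" "x \<in> dom_c d" "\<xi> \<noteq> 0" "dmap d \<sigma> x \<xi> \<in> f x"
    unfolding curvature_sphere_def by blast
  have "\<sigma> x \<in> f x" using * by (auto simp: local_section_def)
  note dec = f_decomp[OF xp this]
  obtain \<xi>' where \<xi>': "\<xi>' \<noteq> 0" and
    ch: "\<And>g :: 'm \<Rightarrow> r42. (g \<circ> param c) differentiable (at (map_c c x)) \<Longrightarrow> dmap d g x \<xi> = dmap c g x \<xi>'"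
    using dmap_chart_change[OF chart[OF *(5)] chart[OF x(1)] change[OF *(5) x(1)] change[OF x(1) *(5)] *(6) x(2) *(7)] by blast
  have "dmap d P x \<xi> = dmap c P x \<xi>'" "dmap d N x \<xi> = dmap c N x \<xi>'"
    using ch smooth_map_differentiable[OF smP x xp] smooth_map_differentiable[OF smN x xp] by blast+
  with dmap_section[OF *(2,1,5,6), of \<xi>] *(8)
  have "(lip (\<sigma> x) l / -2) *\<^sub>R dmap c P x \<xi>' + (lip (\<sigma> x) k / 2) *\<^sub>R dmap c N x \<xi>' = 0" by simp
  moreover have "(lip (\<sigma> x) l / -2, lip (\<sigma> x) k / 2) \<noteq> (0, 0)" using dec *(3) by auto
  moreover have "S = span {(lip (\<sigma> x) l / -2) *\<^sub>R (k + P x) + (lip (\<sigma> x) k / 2) *\<^sub>R (N x - l)}" using dec *(4) by simp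
  ultimately show ?R using \<xi>' by blast
next
  have xp: "x \<in> points A" using dom_points[OF x] .
  assume ?R
  then obtain \<xi> \<alpha> \<beta> where *: "\<xi> \<noteq> 0" "(\<alpha>, \<beta>) \<noteq> (0, 0)" "\<alpha> *\<^sub>R dmap c P x \<xi> + \<beta> *\<^sub>R dmap c N x \<xi> = 0"
      "S = span {\<alpha> *\<^sub>R (k + P x) + \<beta> *\<^sub>R (N x - l)}" by blast
  let ?\<sigma> = "\<lambda>x. \<alpha> *\<^sub>R (k + P x) + \<beta> *\<^sub>R (N x - l)"
  have "dmap c ?\<sigma> x \<xi> \<in> f x"
    unfolding dmap_section[OF constant_section xp x] lip_frame[OF xp] using *(3) by simp
  moreover have "?\<sigma> x \<noteq> 0" using lift_coeff_zero[OF xp, of \<alpha> \<beta>] *(2) by auto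
  ultimately show ?L
    unfolding curvature_sphere_def using constant_section[of \<alpha> \<beta>] *(1,4) x xp by blast
qed

lemma span_lift_eq:
  assumes x: "x \<in> points A"
    and "span {\<alpha> *\<^sub>R (k + P x) + \<beta> *\<^sub>R (N x - l)} = span {\<alpha>' *\<^sub>R (k + P x) + \<beta>' *\<^sub>R (N x - l)}"
  obtains r where "\<alpha> = r * \<alpha>'" "\<beta> = r * \<beta>'"
proof -
  have "\<alpha> *\<^sub>R (k + P x) + \<beta> *\<^sub>R (N x - l) \<in> span {\<alpha>' *\<^sub>R (k + P x) + \<beta>' *\<^sub>R (N x - l)}"
    using assms(2) span_base by blast
  then obtain r where "\<alpha> *\<^sub>R (k + P x) + \<beta> *\<^sub>R (N x - l) = (r * \<alpha>') *\<^sub>R (k + P x) + (r * \<beta>') *\<^sub>R (N x - l)"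
    by (auto simp: span_singleton scaleR_add_right)
  from lift_coeff_eq[OF x this] that show ?thesis by blast
qed

lemma span_lift_eqI:
  assumes "\<alpha> * \<beta>' = \<alpha>' * \<beta>" "(\<alpha>, \<beta>) \<noteq> (0, 0)" "(\<alpha>', \<beta>') \<noteq> (0, 0)"
  shows "span {\<alpha> *\<^sub>R (y :: r42) + \<beta> *\<^sub>R z} = span {\<alpha>' *\<^sub>R y + \<beta>' *\<^sub>R z}"
proof -
  have "\<exists>r. r \<noteq> 0 \<and> \<alpha>' = r * \<alpha> \<and> \<beta>' = r * \<beta>"
  proof (cases "\<alpha> = 0")
    case True
    then have "\<beta> \<noteq> 0" "\<alpha>' = 0" using assms by auto
    then show ?thesis using True assms by (intro exI[of _ "\<beta>' / \<beta>"]) auto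
  next
    case False
    then have "\<alpha>' \<noteq> 0" using assms by auto
    then show ?thesis using False assms by (intro exI[of _ "\<alpha>' / \<alpha>"]) (auto simp: field_simps)
  qed
  then obtain r where r: "r \<noteq> 0" "\<alpha>' = r * \<alpha>" "\<beta>' = r * \<beta>" by blast
  have "\<alpha>' *\<^sub>R y + \<beta>' *\<^sub>R z = r *\<^sub>R (\<alpha> *\<^sub>R y + \<beta> *\<^sub>R z)" unfolding r(2,3) by (simp add: scaleR_add_right)
  then show ?thesis
    using span_image_scale[of "{\<alpha> *\<^sub>R y + \<beta> *\<^sub>R z}" "\<lambda>_. r"] r(1) by simp
qed

text \<open>\<open>has_cross_ratio\<close> lets the spanning vectors vary, but rescaling them
  multiplies \<beta> \<alpha>' and \<alpha> \<beta>' by the same factor. The cross ratio is their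
  quotient.\<close>

lemma cross_ratio_iff:
  assumes x: "x \<in> points A" and d: "\<alpha> * \<beta>' - \<alpha>' * \<beta> \<noteq> 0"
  shows "has_cross_ratio (span {k + P x}) (span {N x - l}) (span {\<alpha> *\<^sub>R (k + P x) + \<beta> *\<^sub>R (N x - l)})
      (span {\<alpha>' *\<^sub>R (k + P x) + \<beta>' *\<^sub>R (N x - l)}) (-1) \<longleftrightarrow> \<alpha> * \<beta>' + \<alpha>' * \<beta> = 0"
proof
  let ?y = "k + P x" and ?z = "N x - l"
  assume "has_cross_ratio (span {?y}) (span {?z}) (span {\<alpha> *\<^sub>R ?y + \<beta> *\<^sub>R ?z}) (span {\<alpha>' *\<^sub>R ?y + \<beta>' *\<^sub>R ?z}) (-1)"
  then obtain X Y a b c d where *: "span {?y} = span {X}" "span {?z} = span {Y}"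
    "span {\<alpha> *\<^sub>R ?y + \<beta> *\<^sub>R ?z} = span {a *\<^sub>R X + b *\<^sub>R Y}" "span {\<alpha>' *\<^sub>R ?y + \<beta>' *\<^sub>R ?z} = span {c *\<^sub>R X + d *\<^sub>R Y}"
    "a * d \<noteq> 0" "-1 = (b * c) / (a * d)" unfolding has_cross_ratio_def by blast
  have "X \<in> span {?y}" "Y \<in> span {?z}" using *(1,2) span_base by blast+
  then obtain s t where st: "X = s *\<^sub>R ?y" "Y = t *\<^sub>R ?z" by (auto simp: span_singleton)
  have "span {\<alpha> *\<^sub>R ?y + \<beta> *\<^sub>R ?z} = span {(a * s) *\<^sub>R ?y + (b * t) *\<^sub>R ?z}"
    "span {\<alpha>' *\<^sub>R ?y + \<beta>' *\<^sub>R ?z} = span {(c * s) *\<^sub>R ?y + (d * t) *\<^sub>R ?z}" using *(3,4) unfolding st by simp_all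
  then obtain r r' where "\<alpha> = r * (a * s)" "\<beta> = r * (b * t)" "\<alpha>' = r' * (c * s)" "\<beta>' = r' * (d * t)"
    using span_lift_eq[OF x] by metis
  moreover have "b * c + a * d = 0" using *(5,6) by (simp add: field_simps)
  ultimately show "\<alpha> * \<beta>' + \<alpha>' * \<beta> = 0" by algebra
next
  let ?y = "k + P x" and ?z = "N x - l"
  assume h: "\<alpha> * \<beta>' + \<alpha>' * \<beta> = 0"
  have ne: "\<alpha> * \<beta>' \<noteq> 0" using h d by auto
  have "?y \<noteq> ?z" using lift_coeff_eq[OF x, of 1 0 0 1] by auto
  moreover have "independent {?y, ?z}"
  proof -
    have "?z \<noteq> 0" using lift_coeff_zero[OF x, of 0 1] by auto
    moreover have "?y \<notin> span {?z}"
    proof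
      assume "?y \<in> span {?z}"
      then obtain r where "1 *\<^sub>R ?y + 0 *\<^sub>R ?z = 0 *\<^sub>R ?y + r *\<^sub>R ?z" by (auto simp: span_singleton)
      from lift_coeff_eq(1)[OF x this] show False by simp
    qed
    ultimately show ?thesis using \<open>?y \<noteq> ?z\<close> by (simp add: independent_insert)
  qed
  moreover have "-1 = (\<beta> * \<alpha>') / (\<alpha> * \<beta>')" using h ne by (simp add: field_simps)
  ultimately show "has_cross_ratio (span {?y}) (span {?z}) (span {\<alpha> *\<^sub>R ?y + \<beta> *\<^sub>R ?z}) (span {\<alpha>' *\<^sub>R ?y + \<beta>' *\<^sub>R ?z}) (-1)"
    unfolding has_cross_ratio_def using ne by blast
qed

text \<open>The parallel fronts enter through r and r'. Scaling P by r and N by r' turns the pair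
  (\<alpha>, \<beta>) into (r' \<alpha>, r \<beta>), because r r' = 1.\<close>

lemma two_directions:
  assumes c: "c \<in> A" "x \<in> dom_c c"
    and "\<xi> \<noteq> 0" "\<eta> \<noteq> 0" "\<alpha>1 * \<beta>2 - \<alpha>2 * \<beta>1 \<noteq> 0"
    "\<alpha>1 *\<^sub>R dmap c P x \<xi> + \<beta>1 *\<^sub>R dmap c N x \<xi> = 0" "\<alpha>2 *\<^sub>R dmap c P x \<eta> + \<beta>2 *\<^sub>R dmap c N x \<eta> = 0"
    and r: "r * r' = 1"
  shows "two_curvature_directions k l (P x) (N x) (r *\<^sub>R D\<^sub>u (P \<circ> param c) (map_c c x)) (r *\<^sub>R D\<^sub>v (P \<circ> param c) (map_c c x))
    (r' *\<^sub>R D\<^sub>u (N \<circ> param c) (map_c c x)) (r' *\<^sub>R D\<^sub>v (N \<circ> param c) (map_c c x)) \<xi> \<eta> (r' * \<alpha>1) (r * \<beta>1) (r' * \<alpha>2) (r * \<beta>2)"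
proof -
  interpret nc: null_coords k l "P \<circ> param c" "N \<circ> param c" "map_c c ` dom_c c" by (rule coords[OF c(1)])
  have z: "map_c c x \<in> map_c c ` dom_c c" using c by auto
  have xp: "x \<in> points A" using dom_points[OF c] .
  have p: "param c (map_c c x) = x" using is_chartD(5)[OF chart[OF c(1)] c(2)] .
  note dP = dmap_D[OF smP c xp] and dN = dmap_D[OF smN c xp]
  have r0: "r \<noteq> 0" "r' \<noteq> 0" using r by auto
  have sc: "fst \<zeta> *\<^sub>R (s *\<^sub>R X) + snd \<zeta> *\<^sub>R (s *\<^sub>R Y) = s *\<^sub>R (fst \<zeta> *\<^sub>R X + snd \<zeta> *\<^sub>R Y)"
    for \<zeta> :: "real \<times> real" and s and X Y :: r42 by (simp add: algebra_simps)
  show ?thesis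
  proof
    show "null_frame k l (P x) (N x)" by (rule nf[OF xp])
    show "lip (r *\<^sub>R D\<^sub>u (P \<circ> param c) (map_c c x)) (r' *\<^sub>R D\<^sub>v (N \<circ> param c) (map_c c x)) =
      lip (r *\<^sub>R D\<^sub>v (P \<circ> param c) (map_c c x)) (r' *\<^sub>R D\<^sub>u (N \<circ> param c) (map_c c x))"
      using nc.mixed_sym[OF z] by (simp add: lip_simps)
    show "r' * \<alpha>1 * (r * \<beta>2) - r' * \<alpha>2 * (r * \<beta>1) \<noteq> 0"
    proof -
      have "r' * \<alpha>1 * (r * \<beta>2) - r' * \<alpha>2 * (r * \<beta>1) = (r * r') * (\<alpha>1 * \<beta>2 - \<alpha>2 * \<beta>1)" by (simp add: algebra_simps)
      then show ?thesis using r assms(5) by simp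
    qed
    show "\<zeta> = 0" if "fst \<zeta> *\<^sub>R (r *\<^sub>R D\<^sub>u (P \<circ> param c) (map_c c x)) + snd \<zeta> *\<^sub>R (r *\<^sub>R D\<^sub>v (P \<circ> param c) (map_c c x)) = 0"
      "fst \<zeta> *\<^sub>R (r' *\<^sub>R D\<^sub>u (N \<circ> param c) (map_c c x)) + snd \<zeta> *\<^sub>R (r' *\<^sub>R D\<^sub>v (N \<circ> param c) (map_c c x)) = 0" for \<zeta>
      using regular_dmap[OF c] that r0 unfolding sc dP dN by simp
    have *: "(r' * \<alpha>) *\<^sub>R (r *\<^sub>R X) + (r * \<beta>) *\<^sub>R (r' *\<^sub>R Y) = \<alpha> *\<^sub>R X + \<beta> *\<^sub>R Y" for \<alpha> \<beta> and X Y :: r42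
    proof -
      have "(r' * \<alpha>) *\<^sub>R (r *\<^sub>R X) + (r * \<beta>) *\<^sub>R (r' *\<^sub>R Y) = (r * r') *\<^sub>R (\<alpha> *\<^sub>R X + \<beta> *\<^sub>R Y)" by (simp add: algebra_simps)
      then show ?thesis by (simp only: r scaleR_one)
    qed
    show "(r' * \<alpha>1) *\<^sub>R (fst \<xi> *\<^sub>R (r *\<^sub>R D\<^sub>u (P \<circ> param c) (map_c c x)) + snd \<xi> *\<^sub>R (r *\<^sub>R D\<^sub>v (P \<circ> param c) (map_c c x))) +
      (r * \<beta>1) *\<^sub>R (fst \<xi> *\<^sub>R (r' *\<^sub>R D\<^sub>u (N \<circ> param c) (map_c c x)) + snd \<xi> *\<^sub>R (r' *\<^sub>R D\<^sub>v (N \<circ> param c) (map_c c x))) = 0"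
      unfolding sc * using assms(6) unfolding dP dN .
    show "(r' * \<alpha>2) *\<^sub>R (fst \<eta> *\<^sub>R (r *\<^sub>R D\<^sub>u (P \<circ> param c) (map_c c x)) + snd \<eta> *\<^sub>R (r *\<^sub>R D\<^sub>v (P \<circ> param c) (map_c c x))) +
      (r * \<beta>2) *\<^sub>R (fst \<eta> *\<^sub>R (r' *\<^sub>R D\<^sub>u (N \<circ> param c) (map_c c x)) + snd \<eta> *\<^sub>R (r' *\<^sub>R D\<^sub>v (N \<circ> param c) (map_c c x))) = 0"
      unfolding sc * using assms(7) unfolding dP dN .
    show "\<xi> \<noteq> 0" "\<eta> \<noteq> 0" by fact+
  qed (use nc.perp[OF z] p frame_perp_linear(3) in auto)
qed

text \<open>Here h is a parallel front, with r = exp t. The condition on the right does not contain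
  r, so a single parallel front that immerses at x decides about harmonic separation.\<close>

lemma flat_iff_harmonic:
  assumes c: "c \<in> A" "x \<in> dom_c c"
    and d: "\<xi> \<noteq> 0" "\<eta> \<noteq> 0" "\<alpha>1 * \<beta>2 - \<alpha>2 * \<beta>1 \<noteq> 0"
    "\<alpha>1 *\<^sub>R dmap c P x \<xi> + \<beta>1 *\<^sub>R dmap c N x \<xi> = 0" "\<alpha>2 *\<^sub>R dmap c P x \<eta> + \<beta>2 *\<^sub>R dmap c N x \<eta> = 0"
    and r: "r * r' = 1" and h: "h = (\<lambda>x. (1/2) *\<^sub>R (r *\<^sub>R P x + r' *\<^sub>R N x))"
  shows "inj (dmap c h x) \<Longrightarrow> intrinsic_curvature c h x = 0 \<longleftrightarrow> \<alpha>1 * \<beta>2 + \<alpha>2 * \<beta>1 = 0"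
    "r' * \<alpha>1 \<noteq> r * \<beta>1 \<Longrightarrow> r' * \<alpha>2 \<noteq> r * \<beta>2 \<Longrightarrow> inj (dmap c h x)"
proof -
  interpret nc: null_coords k l "P \<circ> param c" "N \<circ> param c" "map_c c ` dom_c c" by (rule coords[OF c(1)])
  let ?P = "\<lambda>z. r *\<^sub>R P (param c z)" and ?N = "\<lambda>z. r' *\<^sub>R N (param c z)" and ?z = "map_c c x"
  have z: "?z \<in> map_c c ` dom_c c" using c by auto
  have xp: "x \<in> points A" using dom_points[OF c] .
  have p: "param c ?z = x" using is_chartD(5)[OF chart[OF c(1)] c(2)] .
  have DP: "D\<^sub>u ?P y = r *\<^sub>R D\<^sub>u (P \<circ> param c) y" "D\<^sub>v ?P y = r *\<^sub>R D\<^sub>v (P \<circ> param c) y"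
     "D\<^sub>u ?N y = r' *\<^sub>R D\<^sub>u (N \<circ> param c) y" "D\<^sub>v ?N y = r' *\<^sub>R D\<^sub>v (N \<circ> param c) y" if "y \<in> map_c c ` dom_c c" for y
    using D_linear[OF bounded_linear_scaleR_right, of "P \<circ> param c" y r] smooth_on_differentiable[OF nc.smP that]
      D_linear[OF bounded_linear_scaleR_right, of "N \<circ> param c" y r'] smooth_on_differentiable[OF nc.smN that]
    by (simp_all add: o_def)
  have rr: "r * (r' * x) = x" "r' * (r * x) = x" for x
    using r by (metis mult.assoc mult.commute mult_1)+
  interpret n: null_coords k l ?P ?N "map_c c ` dom_c c"
  proof
    show "open (map_c c ` dom_c c)" by (rule nc.open_U)
    show "smooth_on (map_c c ` dom_c c) ?P" "smooth_on (map_c c ` dom_c c) ?N"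
      using smooth_on_linear[OF bounded_linear_scaleR_right nc.open_U nc.smP]
        smooth_on_linear[OF bounded_linear_scaleR_right nc.open_U nc.smN] by (simp_all add: o_def)
    fix y assume y: "y \<in> map_c c ` dom_c c"
    show "null_frame k l (?P y) (?N y)" using nc.nf[OF y] by (simp add: null_frame_def lip_simps rr)
    show "lip (D\<^sub>u ?P y) (?N y) = 0" "lip (D\<^sub>v ?P y) (?N y) = 0"
      unfolding DP[OF y] using nc.contact[OF y] by (simp_all add: lip_simps)
  qed
  interpret T: two_curvature_directions k l "P x" "N x" "D\<^sub>u ?P ?z" "D\<^sub>v ?P ?z" "D\<^sub>u ?N ?z" "D\<^sub>v ?N ?z" \<xi> \<eta> "r' * \<alpha>1" "r * \<beta>1" "r' * \<alpha>2" "r * \<beta>2"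
    unfolding DP[OF z] by (rule two_directions[OF c d r])
  have hH: "h \<circ> param c = n.H" by (simp add: h n.H_def fun_eq_iff)
  have dh: "dmap c h x \<zeta> = fst \<zeta> *\<^sub>R D\<^sub>u n.H ?z + snd \<zeta> *\<^sub>R D\<^sub>v n.H ?z" for \<zeta>
    unfolding dmap_def hH by (rule frechet_eq_D[OF smooth_on_differentiable[OF n.smH z]])
  have inj_iff: "inj (dmap c h x) \<longleftrightarrow> gram (D\<^sub>u n.H ?z) (D\<^sub>v n.H ?z) \<noteq> 0"
  proof
    assume inj: "inj (dmap c h x)"
    show "gram (D\<^sub>u n.H ?z) (D\<^sub>v n.H ?z) \<noteq> 0"
    proof
      assume "gram (D\<^sub>u n.H ?z) (D\<^sub>v n.H ?z) = 0"
      from gram_zero_dependent[OF n.nf[OF z] n.perp_HT(1,2)[OF z] this]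
      obtain a b where ab: "(a, b) \<noteq> (0, 0)" "a *\<^sub>R D\<^sub>u n.H ?z + b *\<^sub>R D\<^sub>v n.H ?z = 0" .
      then have "dmap c h x (a, b) = dmap c h x (0, 0)" by (simp add: dh)
      with inj ab(1) show False by (simp only: inj_eq)
    qed
  next
    assume g: "gram (D\<^sub>u n.H ?z) (D\<^sub>v n.H ?z) \<noteq> 0"
    have "linear (dmap c h x)" by (rule linearI) (simp_all add: dh algebra_simps)
    then show "inj (dmap c h x)"
    proof (subst linear_injective_0, assumption, intro allI impI)
      fix \<zeta> assume 0: "dmap c h x \<zeta> = 0"
      let ?X = "D\<^sub>u n.H ?z" and ?Y = "D\<^sub>v n.H ?z"
      have "fst \<zeta> * lip ?X ?X + snd \<zeta> * lip ?X ?Y = 0" "fst \<zeta> * lip ?X ?Y + snd \<zeta> * lip ?Y ?Y = 0"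
        using arg_cong[OF 0[unfolded dh], of "lip ?X"] arg_cong[OF 0[unfolded dh], of "lip ?Y"] lip_commute[of ?Y ?X] by (simp_all add: lip_simps)
      then have "fst \<zeta> * gram ?X ?Y = 0" "snd \<zeta> * gram ?X ?Y = 0" unfolding gram_def by algebra+
      then show "\<zeta> = 0" using g by (auto simp: prod_eq_iff)
    qed
  qed
  note HT = n.D_HT[OF z]
  show "intrinsic_curvature c h x = 0 \<longleftrightarrow> \<alpha>1 * \<beta>2 + \<alpha>2 * \<beta>1 = 0" if "inj (dmap c h x)"
  proof -
    have g: "gram (D\<^sub>u n.H ?z) (D\<^sub>v n.H ?z) \<noteq> 0" using that inj_iff by blast
    have "intrinsic_curvature c h x = 0 \<longleftrightarrow> lip (D\<^sub>u n.H ?z) (D\<^sub>u n.T ?z) * lip (D\<^sub>v n.H ?z) (D\<^sub>v n.T ?z) - (lip (D\<^sub>u n.H ?z) (D\<^sub>v n.T ?z))\<^sup>2 = gram (D\<^sub>u n.H ?z) (D\<^sub>v n.H ?z)"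
      unfolding intrinsic_curvature_def hH Let_def by (rule n.curvature_zero_iff[OF z g])
    also have "\<dots> \<longleftrightarrow> r' * \<alpha>1 * (r * \<beta>2) + r' * \<alpha>2 * (r * \<beta>1) = 0"
      using T.harmonic_iff_flat g unfolding HT by blast
    also have "r' * \<alpha>1 * (r * \<beta>2) + r' * \<alpha>2 * (r * \<beta>1) = \<alpha>1 * \<beta>2 + \<alpha>2 * \<beta>1"
    proof -
      have "r' * \<alpha>1 * (r * \<beta>2) + r' * \<alpha>2 * (r * \<beta>1) = (r * r') * (\<alpha>1 * \<beta>2 + \<alpha>2 * \<beta>1)" by (simp only: algebra_simps)
      then show ?thesis by (simp only: r mult_1)
    qed
    finally show ?thesis .
  qed
  show "inj (dmap c h x)" if "r' * \<alpha>1 \<noteq> r * \<beta>1" "r' * \<alpha>2 \<noteq> r * \<beta>2"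
    using T.gram_half_sum_nonzero[OF that] inj_iff unfolding HT by blast
qed

lemma curvature_directions:
  assumes c: "c \<in> A" "x \<in> dom_c c"
    and S: "curvature_sphere A f x S1" "curvature_sphere A f x S2" "S1 \<noteq> S2"
  obtains \<xi> \<eta> \<alpha>1 \<beta>1 \<alpha>2 \<beta>2 where "\<xi> \<noteq> 0" "\<eta> \<noteq> 0" "\<alpha>1 * \<beta>2 - \<alpha>2 * \<beta>1 \<noteq> 0"
    "\<alpha>1 *\<^sub>R dmap c P x \<xi> + \<beta>1 *\<^sub>R dmap c N x \<xi> = 0" "\<alpha>2 *\<^sub>R dmap c P x \<eta> + \<beta>2 *\<^sub>R dmap c N x \<eta> = 0"
    "S1 = span {\<alpha>1 *\<^sub>R (k + P x) + \<beta>1 *\<^sub>R (N x - l)}" "S2 = span {\<alpha>2 *\<^sub>R (k + P x) + \<beta>2 *\<^sub>R (N x - l)}"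
proof -
  obtain \<xi> \<alpha>1 \<beta>1 where 1: "\<xi> \<noteq> 0" "(\<alpha>1, \<beta>1) \<noteq> (0, 0)" "\<alpha>1 *\<^sub>R dmap c P x \<xi> + \<beta>1 *\<^sub>R dmap c N x \<xi> = 0"
      "S1 = span {\<alpha>1 *\<^sub>R (k + P x) + \<beta>1 *\<^sub>R (N x - l)}"
    using S(1) unfolding curvature_sphere_iff[OF c] by blast
  obtain \<eta> \<alpha>2 \<beta>2 where 2: "\<eta> \<noteq> 0" "(\<alpha>2, \<beta>2) \<noteq> (0, 0)" "\<alpha>2 *\<^sub>R dmap c P x \<eta> + \<beta>2 *\<^sub>R dmap c N x \<eta> = 0"
      "S2 = span {\<alpha>2 *\<^sub>R (k + P x) + \<beta>2 *\<^sub>R (N x - l)}"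
    using S(2) unfolding curvature_sphere_iff[OF c] by blast
  have "\<alpha>1 * \<beta>2 - \<alpha>2 * \<beta>1 \<noteq> 0"
  proof
    assume "\<alpha>1 * \<beta>2 - \<alpha>2 * \<beta>1 = 0"
    then have "\<alpha>1 * \<beta>2 = \<alpha>2 * \<beta>1" by simp
    from span_lift_eqI[OF this 1(2) 2(2), of "k + P x" "N x - l"] 1(4) 2(4) S(3) show False by simp
  qed
  then show ?thesis using that 1 2 by blast
qed

end

text \<open>The chart c is restricted and followed by the diffeomorphism G. The result need not
  belong to A, so compatibility with each chart of A is established. \<open>param d\<close> is an
  \<open>inv_into\<close> and is described by \<open>param c\<close> and g on V only.\<close>

lemma (in atlas) refined_chart:
  assumes c: "c \<in> A" and U: "open U" "U \<subseteq> map_c c ` dom_c c" and V: "open V"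
    and hom: "homeomorphism U V G g" and sm: "smooth_on U G" "smooth_on V g"
  defines "d \<equiv> ({x \<in> dom_c c. map_c c x \<in> U}, G \<circ> map_c c)"
  shows "is_chart d" "map_c d ` dom_c d = V" "\<And>y. y \<in> V \<Longrightarrow> param d y = param c (g y)" "local_coords A d"
proof -
  note C = is_chartD[OF chart[OF c]]
  have H: "\<And>z. z \<in> U \<Longrightarrow> g (G z) = z" "G ` U = V" "\<And>y. y \<in> V \<Longrightarrow> G (g y) = y" "g ` V = U" "continuous_on U G" "continuous_on V g"
    using hom unfolding homeomorphism_def by auto
  have dom: "dom_c d = {x \<in> dom_c c. map_c c x \<in> U}" and map: "map_c d = G \<circ> map_c c" by (simp_all add: d_def)
  have pU: "param c z \<in> dom_c d" "map_c c (param c z) = z" if "z \<in> U" for z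
    using C(6,7)[of z] that U(2) by (auto simp: dom)
  have inj: "inj_on (map_c d) (dom_c d)"
  proof (rule inj_onI)
    fix x y assume xy: "x \<in> dom_c d" "y \<in> dom_c d" "map_c d x = map_c d y"
    then have "map_c c x = map_c c y" using H(1) by (metis (mono_tags, lifting) dom map mem_Collect_eq o_apply)
    then show "x = y" using xy C(5) by (metis (mono_tags, lifting) dom mem_Collect_eq)
  qed
  show img: "map_c d ` dom_c d = V"
  proof
    show "map_c d ` dom_c d \<subseteq> V" using H(2) by (auto simp: dom map)
    show "V \<subseteq> map_c d ` dom_c d"
    proof
      fix y assume y: "y \<in> V"
      then have "g y \<in> U" using H(4) by blast
      then have "param c (g y) \<in> dom_c d" "map_c d (param c (g y)) = y" using pU H(3)[OF y] by (auto simp: map)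
      then show "y \<in> map_c d ` dom_c d" by (metis image_eqI)
    qed
  qed
  show par: "param d y = param c (g y)" if y: "y \<in> V" for y
  proof -
    have "g y \<in> U" using H(4) y by blast
    then have "param c (g y) \<in> dom_c d" "map_c d (param c (g y)) = y" using pU H(3)[OF y] by (auto simp: map)
    then show ?thesis unfolding param_def[of d] by (intro inv_into_f_eq[OF inj])
  qed
  have odom: "open (dom_c d)"
  proof -
    have "dom_c d = dom_c c \<inter> map_c c -` U" by (auto simp: dom)
    then show ?thesis using continuous_open_preimage[OF C(3,1) U(1)] by simp
  qed
  have gU: "g y \<in> U" if "y \<in> V" for y using H(4) that by blast
  show ch: "is_chart d"
    unfolding is_chart_def img
  proof (intro conjI odom V)
    show "homeomorphism (dom_c d) V (map_c d) (param d)"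
      unfolding homeomorphism_def
    proof (intro conjI ballI img)
      show "continuous_on (dom_c d) (map_c d)"
        unfolding map by (rule continuous_on_compose[OF continuous_on_subset[OF C(3)] continuous_on_subset[OF H(5)]]) (auto simp: dom)
      have "continuous_on V (param c \<circ> g)"
        by (rule continuous_on_compose[OF H(6) continuous_on_subset[OF C(4)]]) (use H(4) U(2) in auto)
      then show "continuous_on V (param d)" by (rule continuous_on_eq) (use par in auto)
      show inv: "param d (map_c d x) = x" if "x \<in> dom_c d" for x
        unfolding param_def using that inj by simp
      show "param d ` V = dom_c d"
        unfolding img[symmetric] image_image using inv by (auto simp: image_iff)
      show "map_c d (param d y) = y" if "y \<in> V" for y
        unfolding par[OF that] using pU(2)[OF gU[OF that]] H(3)[OF that] by (simp add: map)
    qed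
  qed
  note D = is_chartD[OF ch, unfolded img]
  show "local_coords A d"
    unfolding local_coords_def
  proof (intro conjI ballI ch)
    show "dom_c d \<subseteq> points A" using dom_points[OF c] by (auto simp: dom)
    fix e assume e: "e \<in> A"
    note E = is_chartD[OF chart[OF e]]
    let ?W = "map_c d ` (dom_c d \<inter> dom_c e)"
    have W: "open ?W" "?W \<subseteq> V" using open_chart_image[OF ch E(1)] img by auto
    have "smooth_on ?W (\<lambda>y. (map_c e \<circ> param c) (g y))"
    proof (rule smooth_on_compose[OF W(1) open_chart_image[OF chart[OF c] E(1)] _ smooth_on_subset[OF sm(2) W(2)]])
      show "g ` ?W \<subseteq> map_c c ` (dom_c c \<inter> dom_c e)"
      proof (rule image_subsetI)
        fix y assume y: "y \<in> ?W"
        then have "y \<in> V" "param d y \<in> dom_c e" using W(2) chart_image_iff[OF ch] by blast+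
        then show "g y \<in> map_c c ` (dom_c c \<inter> dom_c e)"
          unfolding chart_image_iff[OF chart[OF c]] using par[of y] subsetD[OF U(2) gU[of y]] by simp
      qed
      show "smooth_on (map_c c ` (dom_c c \<inter> dom_c e)) (map_c e \<circ> param c)"
        by (rule smooth_changeD(2)[OF chart[OF c] chart[OF e] change[OF c e]])
    qed
    then show "smooth_change d e"
      unfolding smooth_change_def using smooth_on_cong[OF W(1), of "\<lambda>y. (map_c e \<circ> param c) (g y)" "map_c e \<circ> param d"] par W(2)
      by (metis comp_apply subsetD)
    let ?X = "map_c e ` (dom_c e \<inter> dom_c d)"
    have X: "open ?X" by (rule open_chart_image[OF chart[OF e] odom])
    have Xsub: "?X \<subseteq> map_c e ` (dom_c e \<inter> dom_c c)" by (auto simp: dom)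
    have "smooth_on ?X (\<lambda>z. G ((map_c c \<circ> param e) z))"
    proof (rule smooth_on_compose[OF X U(1) _ _ sm(1)])
      show "smooth_on ?X (map_c c \<circ> param e)"
        by (rule smooth_on_subset[OF smooth_changeD(2)[OF chart[OF e] chart[OF c] change[OF e c]] Xsub])
      show "(map_c c \<circ> param e) ` ?X \<subseteq> U" using E(5) by (auto simp: dom)
    qed
    then show "smooth_change e d" unfolding smooth_change_def map by (simp add: o_def)
  qed
qed

lemma span_Un_lines: "span (span {a} \<union> span {b}) = span {a, b}"
proof
  show "span (span {a} \<union> span {b}) \<subseteq> span {a, b}"
    by (rule span_minimal) (auto intro: span_mono[THEN subsetD])
  show "span {a, b} \<subseteq> span (span {a} \<union> span {b})"
    by (rule span_mono) (auto simp: span_base)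
qed

lemma half_sum_diff:
  fixes a b :: "'a::real_vector"
  shows "(1/2) *\<^sub>R (a + b) + (1/2) *\<^sub>R (a - b) = a" "(1/2) *\<^sub>R (a + b) - (1/2) *\<^sub>R (a - b) = b"
  unfolding scaleR_add_right[symmetric] scaleR_diff_right[symmetric] by simp_all

lemma span_sum_diff:
  fixes a b :: "'a::real_vector"
  shows "span {a, b} = span {a + b, a - b}"
proof (rule antisym)
  have "a = (1/2) *\<^sub>R (a + b) + (1/2) *\<^sub>R (a - b)" "b = (1/2) *\<^sub>R (a + b) - (1/2) *\<^sub>R (a - b)"
    by (simp_all only: half_sum_diff)
  moreover have "(1/2) *\<^sub>R (a + b) + (1/2) *\<^sub>R (a - b) \<in> span {a + b, a - b}"
    "(1/2) *\<^sub>R (a + b) - (1/2) *\<^sub>R (a - b) \<in> span {a + b, a - b}"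
    by (intro span_add span_diff span_mul span_base; simp)+
  ultimately have "a \<in> span {a + b, a - b}" "b \<in> span {a + b, a - b}" by metis+
  then show "span {a, b} \<subseteq> span {a + b, a - b}" by (intro span_minimal) auto
  have "a + b \<in> span {a, b}" "a - b \<in> span {a, b}" by (intro span_add span_diff span_base; simp)+
  then show "span {a + b, a - b} \<subseteq> span {a, b}" by (intro span_minimal) auto
qed

section \<open>Harmonic separation, flatness of the parallel fronts and Moutard lifts\<close>

context null_map begin

abbreviation "sphere_k x \<equiv> span {k + P x}"
abbreviation "sphere_l x \<equiv> span {N x - l}"

definition base_front where "base_front x = (1/2) *\<^sub>R (P x + N x)"
definition base_normal where "base_normal x = (1/2) *\<^sub>R (P x - N x)"

text \<open>Parallel transformation is a hyperbolic rotation in the plane of F and T, and P and N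
  are its null eigenvectors.\<close>

lemma par_front_eq: "par_front t base_front base_normal = (\<lambda>x. (1/2) *\<^sub>R (exp t *\<^sub>R P x + exp (- t) *\<^sub>R N x))"
proof
  fix x
  have "par_front t base_front base_normal x = ((cosh t + sinh t) / 2) *\<^sub>R P x + ((cosh t - sinh t) / 2) *\<^sub>R N x"
    by (simp add: par_front_def base_front_def base_normal_def algebra_simps add_divide_distrib diff_divide_distrib)
  also have "\<dots> = (1/2) *\<^sub>R (exp t *\<^sub>R P x + exp (- t) *\<^sub>R N x)"
    by (simp add: cosh_plus_sinh cosh_minus_sinh algebra_simps)
  finally show "par_front t base_front base_normal x = (1/2) *\<^sub>R (exp t *\<^sub>R P x + exp (- t) *\<^sub>R N x)" .
qed

definition parallel_flat where
  "parallel_flat \<longleftrightarrow> (\<forall>t. \<forall>c\<in>A. \<forall>x\<in>dom_c c. inj (dmap c (par_front t base_front base_normal) x) \<longrightarrow>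
     intrinsic_curvature c (par_front t base_front base_normal) x = 0)"

lemma parallel_flat_if_harmonic:
  assumes umb: "umbilic_free A f" and sep: "separates_harmonically A f sphere_k sphere_l"
  shows parallel_flat
  unfolding parallel_flat_def
proof (intro allI ballI impI)
  fix t c x assume c: "c \<in> A" "x \<in> dom_c c" and inj: "inj (dmap c (par_front t base_front base_normal) x)"
  have xp: "x \<in> points A" using dom_points[OF c] .
  obtain S1 S2 where S: "curvature_sphere A f x S1" "curvature_sphere A f x S2" "S1 \<noteq> S2"
    using umb xp unfolding umbilic_free_def by blast
  then have cr: "has_cross_ratio (sphere_k x) (sphere_l x) S1 S2 (-1)"
    using sep xp unfolding separates_harmonically_def by blast
  obtain \<xi> \<eta> \<alpha>1 \<beta>1 \<alpha>2 \<beta>2 where *: "\<xi> \<noteq> 0" "\<eta> \<noteq> 0" "\<alpha>1 * \<beta>2 - \<alpha>2 * \<beta>1 \<noteq> 0"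
    "\<alpha>1 *\<^sub>R dmap c P x \<xi> + \<beta>1 *\<^sub>R dmap c N x \<xi> = 0" "\<alpha>2 *\<^sub>R dmap c P x \<eta> + \<beta>2 *\<^sub>R dmap c N x \<eta> = 0"
    "S1 = span {\<alpha>1 *\<^sub>R (k + P x) + \<beta>1 *\<^sub>R (N x - l)}" "S2 = span {\<alpha>2 *\<^sub>R (k + P x) + \<beta>2 *\<^sub>R (N x - l)}"
    by (rule curvature_directions[OF c S])
  have h: "\<alpha>1 * \<beta>2 + \<alpha>2 * \<beta>1 = 0" using cr cross_ratio_iff[OF xp *(3)] unfolding *(6,7) by blast
  have r: "exp t * exp (- t) = 1" by (simp add: exp_minus)
  show "intrinsic_curvature c (par_front t base_front base_normal) x = 0"
    using flat_iff_harmonic(1)[OF c *(1-5) r par_front_eq inj] h by blast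
qed

text \<open>The curvature is known to vanish only where a parallel front immerses, so t is chosen
  anew for each point.\<close>

lemma harmonic_if_parallel_flat:
  assumes parallel_flat
  shows "separates_harmonically A f sphere_k sphere_l"
  unfolding separates_harmonically_def
proof (intro ballI conjI allI impI)
  fix x assume xp: "x \<in> points A"
  show "f x = span (sphere_k x \<union> sphere_l x)" using f[OF xp] by (simp add: span_Un_lines)
  fix S1 S2 assume S: "curvature_sphere A f x S1" "curvature_sphere A f x S2" "S1 \<noteq> S2"
  from xp obtain c where c: "c \<in> A" "x \<in> dom_c c" by (rule pointsE)
  obtain \<xi> \<eta> \<alpha>1 \<beta>1 \<alpha>2 \<beta>2 where *: "\<xi> \<noteq> 0" "\<eta> \<noteq> 0" "\<alpha>1 * \<beta>2 - \<alpha>2 * \<beta>1 \<noteq> 0"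
    "\<alpha>1 *\<^sub>R dmap c P x \<xi> + \<beta>1 *\<^sub>R dmap c N x \<xi> = 0" "\<alpha>2 *\<^sub>R dmap c P x \<eta> + \<beta>2 *\<^sub>R dmap c N x \<eta> = 0"
    "S1 = span {\<alpha>1 *\<^sub>R (k + P x) + \<beta>1 *\<^sub>R (N x - l)}" "S2 = span {\<alpha>2 *\<^sub>R (k + P x) + \<beta>2 *\<^sub>R (N x - l)}"
    by (rule curvature_directions[OF c S])
  \<comment> \<open>Each principal curvature excludes at most one parallel front from being immersed.\<close>
  have one: "t = t'" if "exp (- t) * \<alpha> = exp t * \<beta>" "exp (- t') * \<alpha> = exp t' * \<beta>" "(\<alpha>, \<beta>) \<noteq> (0, 0)" for t t' \<alpha> \<beta> :: real
  proof -
    have a: "\<alpha> = exp s * exp s * \<beta>" if "exp (- s) * \<alpha> = exp s * \<beta>" for s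
    proof -
      have "exp s * (exp (- s) * \<alpha>) = exp s * (exp s * \<beta>)" using that by simp
      moreover have "exp s * (exp (- s) * \<alpha>) = \<alpha>" by (simp add: exp_minus)
      ultimately show ?thesis by simp
    qed
    have "\<beta> \<noteq> 0" using a[OF that(1)] that(3) by auto
    moreover have "exp t * exp t * \<beta> = exp t' * exp t' * \<beta>" by (rule trans[OF a[OF that(1), symmetric] a[OF that(2)]])
    ultimately have "exp t * exp t = exp t' * exp t'" by simp
    then have "exp (t + t) = exp (t' + t')" by (simp only: exp_add)
    then show ?thesis by simp
  qed
  have ne: "(\<alpha>1, \<beta>1) \<noteq> (0, 0)" "(\<alpha>2, \<beta>2) \<noteq> (0, 0)" using *(3) by auto
  have "\<exists>t. exp (- t) * \<alpha>1 \<noteq> exp t * \<beta>1 \<and> exp (- t) * \<alpha>2 \<noteq> exp t * \<beta>2"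
  proof (rule ccontr)
    assume no: "\<not> ?thesis"
    let ?E = "\<lambda>\<alpha> \<beta> t. exp (- t) * \<alpha> = exp t * (\<beta> :: real)"
    have "?E \<alpha>1 \<beta>1 t \<or> ?E \<alpha>2 \<beta>2 t" for t using no by blast
    \<comment> \<open>Pigeonhole: of the three parameters 0, 1, 2 two would be excluded by the same
      curvature sphere.\<close>
    from this[of 0] this[of 1] this[of 2]
    show False using one[OF _ _ ne(1), of 0 1] one[OF _ _ ne(1), of 0 2] one[OF _ _ ne(1), of 1 2]
      one[OF _ _ ne(2), of 0 1] one[OF _ _ ne(2), of 0 2] one[OF _ _ ne(2), of 1 2] by linarith
  qed
  then obtain t where t: "exp (- t) * \<alpha>1 \<noteq> exp t * \<beta>1" "exp (- t) * \<alpha>2 \<noteq> exp t * \<beta>2" by blast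
  have r: "exp t * exp (- t) = 1" by (simp add: exp_minus)
  note fl = flat_iff_harmonic[OF c *(1-5) r par_front_eq]
  have inj: "inj (dmap c (par_front t base_front base_normal) x)" by (rule fl(2)[OF t])
  then have "intrinsic_curvature c (par_front t base_front base_normal) x = 0" using assms c unfolding parallel_flat_def by blast
  then have "\<alpha>1 * \<beta>2 + \<alpha>2 * \<beta>1 = 0" using fl(1)[OF inj] by blast
  then show "has_cross_ratio (sphere_k x) (sphere_l x) S1 S2 (-1)"
    using cross_ratio_iff[OF xp *(3)] unfolding *(6,7) by blast
qed

lemma flat_coords_if_harmonic:
  assumes umb: "umbilic_free A f" and sep: "separates_harmonically A f sphere_k sphere_l" and c: "c \<in> A"
  shows "flat_coords k l (P \<circ> param c) (N \<circ> param c) (map_c c ` dom_c c)"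
proof -
  interpret nc: null_coords k l "P \<circ> param c" "N \<circ> param c" "map_c c ` dom_c c" by (rule coords[OF c])
  have pt: "\<exists>x. x \<in> dom_c c \<and> x \<in> points A \<and> map_c c x = z" if "z \<in> map_c c ` dom_c c" for z
    using that dom_points[OF c] by blast
  show ?thesis
  proof
    fix z \<zeta> assume "z \<in> map_c c ` dom_c c"
    then obtain x where x: "x \<in> dom_c c" "x \<in> points A" "map_c c x = z" using pt by blast
    assume "fst \<zeta> *\<^sub>R D\<^sub>u (P \<circ> param c) z + snd \<zeta> *\<^sub>R D\<^sub>v (P \<circ> param c) z = 0"
      "fst \<zeta> *\<^sub>R D\<^sub>u (N \<circ> param c) z + snd \<zeta> *\<^sub>R D\<^sub>v (N \<circ> param c) z = 0"
    then show "\<zeta> = 0"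
      using regular_dmap[OF c x(1), of \<zeta>] unfolding dmap_D[OF smP c x(1,2)] dmap_D[OF smN c x(1,2)] x(3) by blast
  next
    fix z assume "z \<in> map_c c ` dom_c c"
    then obtain x where x: "x \<in> dom_c c" "x \<in> points A" "map_c c x = z" using pt by blast
    note dP = dmap_D[OF smP c x(1,2), unfolded x(3)] and dN = dmap_D[OF smN c x(1,2), unfolded x(3)]
    obtain S1 S2 where S: "curvature_sphere A f x S1" "curvature_sphere A f x S2" "S1 \<noteq> S2"
      using umb x unfolding umbilic_free_def by blast
    then have cr: "has_cross_ratio (sphere_k x) (sphere_l x) S1 S2 (-1)"
      using sep x unfolding separates_harmonically_def by blast
    obtain \<xi> \<eta> \<alpha>1 \<beta>1 \<alpha>2 \<beta>2 where *: "\<xi> \<noteq> 0" "\<eta> \<noteq> 0" "\<alpha>1 * \<beta>2 - \<alpha>2 * \<beta>1 \<noteq> 0"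
      "\<alpha>1 *\<^sub>R dmap c P x \<xi> + \<beta>1 *\<^sub>R dmap c N x \<xi> = 0" "\<alpha>2 *\<^sub>R dmap c P x \<eta> + \<beta>2 *\<^sub>R dmap c N x \<eta> = 0"
      "S1 = span {\<alpha>1 *\<^sub>R (k + P x) + \<beta>1 *\<^sub>R (N x - l)}" "S2 = span {\<alpha>2 *\<^sub>R (k + P x) + \<beta>2 *\<^sub>R (N x - l)}"
      by (rule curvature_directions[OF c x(1) S])
    have h: "\<alpha>1 * \<beta>2 + \<alpha>2 * \<beta>1 = 0" using cr cross_ratio_iff[OF x(2) *(3)] unfolding *(6,7) by blast
    \<comment> \<open>The products \<alpha>1 \<beta>2 and \<alpha>2 \<beta>1 have sum zero and
      nonzero difference, so neither of them vanishes.\<close>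
    have nz: "\<alpha>1 \<noteq> 0" "\<alpha>2 \<noteq> 0" "\<beta>1 \<noteq> 0" "\<beta>2 \<noteq> 0" using h *(3) by auto
    define m where "m = - (\<alpha>1 / \<beta>1)"
    have solve: "Y = (- (\<alpha> / \<beta>)) *\<^sub>R X" if "\<alpha> *\<^sub>R X + \<beta> *\<^sub>R Y = 0" "\<beta> \<noteq> 0" for \<alpha> \<beta> and X Y :: r42
    proof -
      have "(1 / \<beta>) *\<^sub>R (\<alpha> *\<^sub>R X + \<beta> *\<^sub>R Y) = 0" using that(1) by simp
      then have "(\<alpha> / \<beta>) *\<^sub>R X + Y = 0" using that(2) by (simp add: scaleR_add_right)
      then show ?thesis by (simp add: add_eq_0_iff)
    qed
    have m2: "- (\<alpha>2 / \<beta>2) = - m" using h nz by (simp add: m_def field_simps)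
    have dN_eq: "dmap c N x \<xi> = m *\<^sub>R dmap c P x \<xi>" "dmap c N x \<eta> = (- m) *\<^sub>R dmap c P x \<eta>"
      using solve[OF *(4) nz(3)] solve[OF *(5) nz(4)] unfolding m2 by (simp_all only: m_def)
    have "m \<noteq> 0" using nz by (simp add: m_def)
    \<comment> \<open>\<open>flat_coords\<close> asks for a positive eigenvalue first; for negative
      m the two directions exchange their roles.\<close>
    then consider "m > 0" | "- m > 0" by linarith
    then have "\<exists>\<mu> \<xi> \<eta>. \<mu> > 0 \<and> \<xi> \<noteq> 0 \<and> \<eta> \<noteq> 0 \<and> dmap c N x \<xi> = \<mu> *\<^sub>R dmap c P x \<xi> \<and> dmap c N x \<eta> = (- \<mu>) *\<^sub>R dmap c P x \<eta>"
    proof cases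
      case 1
      then show ?thesis using dN_eq * by blast
    next
      case 2
      moreover have "dmap c N x \<xi> = (- (- m)) *\<^sub>R dmap c P x \<xi>" using dN_eq by simp
      ultimately show ?thesis using dN_eq(2) * by blast
    qed
    then show "\<exists>\<mu> \<xi> \<eta>. \<mu> > 0 \<and> \<xi> \<noteq> 0 \<and> \<eta> \<noteq> 0 \<and>
      fst \<xi> *\<^sub>R D\<^sub>u (N \<circ> param c) z + snd \<xi> *\<^sub>R D\<^sub>v (N \<circ> param c) z = \<mu> *\<^sub>R (fst \<xi> *\<^sub>R D\<^sub>u (P \<circ> param c) z + snd \<xi> *\<^sub>R D\<^sub>v (P \<circ> param c) z) \<and>
      fst \<eta> *\<^sub>R D\<^sub>u (N \<circ> param c) z + snd \<eta> *\<^sub>R D\<^sub>v (N \<circ> param c) z = (- \<mu>) *\<^sub>R (fst \<eta> *\<^sub>R D\<^sub>u (P \<circ> param c) z + snd \<eta> *\<^sub>R D\<^sub>v (P \<circ> param c) z)"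
      unfolding dP dN .
  qed
qed

lemma sphere_congruences:
  "sphere_congruence A sphere_k" "sphere_congruence A sphere_l"
proof -
  have *: "sphere_congruence A (\<lambda>x. span {\<sigma> x})"
    if "smooth_map A (points A) \<sigma>" "\<And>x. x \<in> points A \<Longrightarrow> \<sigma> x \<noteq> 0 \<and> lip (\<sigma> x) (\<sigma> x) = 0" for \<sigma>
    unfolding sphere_congruence_def
  proof (intro conjI ballI)
    fix x assume x: "x \<in> points A"
    show "null_line (span {\<sigma> x})"
      unfolding null_line_def
    proof (intro conjI ballI)
      show "dim (span {\<sigma> x}) = 1" using that(2)[OF x] by (simp add: dim_span dim_insert)
      show "subspace (span {\<sigma> x})" by (rule subspace_span)
    qed (use that(2)[OF x] in \<open>auto simp: span_singleton lip_simps\<close>)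
    show "\<exists>V \<sigma>'. x \<in> V \<and> local_section A (\<lambda>x. span {\<sigma> x}) V \<sigma>' \<and> (\<forall>y\<in>V. span {\<sigma> y} = span {\<sigma>' y})"
      by (rule exI[of _ "points A"], rule exI[of _ \<sigma>])
        (use x that(1) open_points in \<open>auto simp: local_section_def span_base\<close>)
  qed
  show "sphere_congruence A sphere_k"
  proof (rule *)
    show "smooth_map A (points A) (\<lambda>x. k + P x)" by (intro smooth_map_add smooth_map_const open_points smP)
    show "k + P x \<noteq> 0 \<and> lip (k + P x) (k + P x) = 0" if "x \<in> points A" for x
      using lift_coeff_zero[OF that, of 1 0] nf[OF that] null_frame_comm[OF nf[OF that]] by (auto simp: null_frame_def lip_simps)
  qed
  show "sphere_congruence A sphere_l"
  proof (rule *)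
    show "smooth_map A (points A) (\<lambda>x. N x - l)" by (intro smooth_map_diff smooth_map_const open_points smN)
    show "N x - l \<noteq> 0 \<and> lip (N x - l) (N x - l) = 0" if "x \<in> points A" for x
      using lift_coeff_zero[OF that, of 0 1] nf[OF that] null_frame_comm[OF nf[OF that]] by (auto simp: null_frame_def lip_simps)
  qed
qed

text \<open>In the parameters with N_u = a^2 P_u and N_v = - a^2 P_v the curvature spheres are
  spanned by N - l - a^2 (k + P) and N - l + a^2 (k + P). The same chart serves both Moutard
  lifts.\<close>

lemma moutard_coordinates:
  assumes umb: "umbilic_free A f" and sep: "separates_harmonically A f sphere_k sphere_l" and x: "x \<in> points A"
  obtains d \<sigma> \<tau> where "x \<in> dom_c d" "curvature_line_coords A f d" "moutard_lift A d sphere_k \<sigma>" "moutard_lift A d sphere_l \<tau>"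
proof -
  from x obtain c where c: "c \<in> A" "x \<in> dom_c c" by (rule pointsE)
  interpret fc: flat_coords k l "P \<circ> param c" "N \<circ> param c" "map_c c ` dom_c c"
    by (rule flat_coords_if_harmonic[OF umb sep c(1)])
  have z: "map_c c x \<in> map_c c ` dom_c c" using c by blast
  show ?thesis
  proof (rule fc.curvature_line_parameters[OF z])
    fix U V G g a
    assume U: "open U" "U \<subseteq> map_c c ` dom_c c" "map_c c x \<in> U" and V: "open V" and hom: "homeomorphism U V G g"
      and smG: "smooth_on U G" and smg: "smooth_on V g" and sma: "smooth_on V a" and apos: "\<And>y. y \<in> V \<Longrightarrow> a y > 0"
      and Nu: "\<And>y. y \<in> V \<Longrightarrow> D\<^sub>u (\<lambda>y. (N \<circ> param c) (g y)) y = (a y)\<^sup>2 *\<^sub>R D\<^sub>u (\<lambda>y. (P \<circ> param c) (g y)) y"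
      and Nv: "\<And>y. y \<in> V \<Longrightarrow> D\<^sub>v (\<lambda>y. (N \<circ> param c) (g y)) y = - (a y)\<^sup>2 *\<^sub>R D\<^sub>v (\<lambda>y. (P \<circ> param c) (g y)) y"
    define d where "d = ({x \<in> dom_c c. map_c c x \<in> U}, G \<circ> map_c c)"
    note R = refined_chart[OF c(1) U(1,2) V hom smG smg, folded d_def]
    note D = is_chartD[OF R(1), unfolded R(2)]
    have dpts: "dom_c d \<subseteq> points A" using dom_points[OF c(1)] by (auto simp: d_def)
    have dc: "dom_c d \<subseteq> dom_c c" by (auto simp: d_def)
    have xd: "x \<in> dom_c d" using c U(3) by (simp add: d_def)
    let ?p = "P \<circ> param d" and ?n = "N \<circ> param d"
    have change_d: "smooth_change d e" "smooth_change e d" if "e \<in> A" for e using R(4) that by (auto simp: local_coords_def)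
    have gU: "g ` V \<subseteq> map_c c ` dom_c c" using hom U(2) by (auto simp: homeomorphism_def)
    have smp: "smooth_on V ?p" and smn: "smooth_on V ?n"
      using smooth_on_compose[OF V fc.open_U gU smg fc.smP] smooth_on_compose[OF V fc.open_U gU smg fc.smN]
        smooth_on_cong[OF V, of ?p "\<lambda>y. (P \<circ> param c) (g y)"] smooth_on_cong[OF V, of ?n "\<lambda>y. (N \<circ> param c) (g y)"] R(3) by auto
    have Dp: "D\<^sub>u ?p y = D\<^sub>u (\<lambda>y. (P \<circ> param c) (g y)) y" "D\<^sub>v ?p y = D\<^sub>v (\<lambda>y. (P \<circ> param c) (g y)) y"
      "D\<^sub>u ?n y = D\<^sub>u (\<lambda>y. (N \<circ> param c) (g y)) y" "D\<^sub>v ?n y = D\<^sub>v (\<lambda>y. (N \<circ> param c) (g y)) y" if "y \<in> V" for y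
      by (rule D_cong_open[OF V that]; simp add: R(3))+
    have nu: "D\<^sub>u ?n y = (a y)\<^sup>2 *\<^sub>R D\<^sub>u ?p y" and nv: "D\<^sub>v ?n y = - (a y)\<^sup>2 *\<^sub>R D\<^sub>v ?p y" if "y \<in> V" for y
      using Nu[OF that] Nv[OF that] unfolding Dp[OF that] by auto
    have mapV: "map_c d x \<in> V" if "x \<in> dom_c d" for x using that R(2) by blast
    have sm_fun: "smooth_map A (dom_c d) (\<lambda>x. b (map_c d x))" if "smooth_on V b" for b :: "real \<times> real \<Rightarrow> real"
      unfolding smooth_map_def
    proof
      fix e assume e: "e \<in> A"
      note C = smooth_changeD[OF chart[OF e] R(1) change_d(2)[OF e]]
      have "smooth_on (map_c e ` (dom_c e \<inter> dom_c d)) (\<lambda>z. b ((map_c d \<circ> param e) z))"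
      proof (rule smooth_on_compose[OF C(1) V _ C(2) that], rule image_subsetI)
        fix z assume "z \<in> map_c e ` (dom_c e \<inter> dom_c d)"
        from C(3)[OF this] show "(map_c d \<circ> param e) z \<in> V" using R(2) by blast
      qed
      then show "smooth_on (map_c e ` (dom_c e \<inter> dom_c d)) ((\<lambda>x. b (map_c d x)) \<circ> param e)" by (simp add: o_def)
    qed
    have sP: "smooth_map A (dom_c d) P" "smooth_map A (dom_c d) N" using smP smN dpts smooth_map_subset by blast+
    have sk: "smooth_map A (dom_c d) (\<lambda>x. k + P x)" and sl: "smooth_map A (dom_c d) (\<lambda>x. N x - l)"
      by (intro smooth_map_add smooth_map_diff smooth_map_const D(1) sP)+
    define b where "b y = (a y)\<^sup>2" for y
    have smb: "smooth_on V b" unfolding b_def[abs_def] power2_eq_square by (intro smooth_on_mult V sma)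
    \<comment> \<open>The two curvature spheres at once: for \<epsilon> = -1 the u-derivatives of P
      and N cancel, for \<epsilon> = 1 the v-derivatives, and a multiple of k + P remains.\<close>
    define s where "s \<epsilon> x = (\<epsilon> * b (map_c d x)) *\<^sub>R (k + P x) + 1 *\<^sub>R (N x - l)" for \<epsilon> :: real and x
    have sec: "local_section A f (dom_c d) (s \<epsilon>)" for \<epsilon>
      unfolding local_section_def s_def[abs_def]
    proof (intro conjI D(1) dpts ballI smooth_map_add smooth_map_scaleR smooth_map_diff sP smooth_map_const smooth_map_bilinear[OF bounded_bilinear_mult] sm_fun smb)
      show "(\<epsilon> * b (map_c d x)) *\<^sub>R (k + P x) + 1 *\<^sub>R (N x - l) \<in> f x" if "x \<in> dom_c d" for x
        using mem_f[of x] that dpts by blast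
    qed
    have Ds: "D\<^sub>u (s \<epsilon> \<circ> param d) y = (\<epsilon> * b y) *\<^sub>R D\<^sub>u ?p y + D\<^sub>u ?n y + (\<epsilon> * D\<^sub>u b y) *\<^sub>R (k + ?p y)"
      "D\<^sub>v (s \<epsilon> \<circ> param d) y = (\<epsilon> * b y) *\<^sub>R D\<^sub>v ?p y + D\<^sub>v ?n y + (\<epsilon> * D\<^sub>v b y) *\<^sub>R (k + ?p y)" if y: "y \<in> V" for y \<epsilon>
    proof -
      have eq: "(s \<epsilon> \<circ> param d) w = (\<epsilon> *\<^sub>R b w) *\<^sub>R (k + ?p w) + (?n w - l)" if "w \<in> V" for w
        using D(6)[OF that] by (simp add: s_def)
      have db: "(b has_derivative (\<lambda>w. fst w *\<^sub>R D\<^sub>u b y + snd w *\<^sub>R D\<^sub>v b y)) (at y)" by (rule smooth_on_has_D[OF smb y])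
      have dp: "(?p has_derivative (\<lambda>w. fst w *\<^sub>R D\<^sub>u ?p y + snd w *\<^sub>R D\<^sub>v ?p y)) (at y)" by (rule smooth_on_has_D[OF smp y])
      have dn: "(?n has_derivative (\<lambda>w. fst w *\<^sub>R D\<^sub>u ?n y + snd w *\<^sub>R D\<^sub>v ?n y)) (at y)" by (rule smooth_on_has_D[OF smn y])
      have "((\<lambda>w. (\<epsilon> *\<^sub>R b w) *\<^sub>R (k + ?p w) + (?n w - l)) has_derivative
        (\<lambda>w. ((\<epsilon> *\<^sub>R b y) *\<^sub>R (0 + (fst w *\<^sub>R D\<^sub>u ?p y + snd w *\<^sub>R D\<^sub>v ?p y)) + (\<epsilon> *\<^sub>R (fst w *\<^sub>R D\<^sub>u b y + snd w *\<^sub>R D\<^sub>v b y)) *\<^sub>R (k + ?p y)) +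
          ((fst w *\<^sub>R D\<^sub>u ?n y + snd w *\<^sub>R D\<^sub>v ?n y) - 0))) (at y)"
        by (intro has_derivative_add has_derivative_diff has_derivative_scaleR has_derivative_scaleR_right has_derivative_const db dp dn)
      note DD = D_eq_derivative[OF this]
      have De: "D\<^sub>u (s \<epsilon> \<circ> param d) y = D\<^sub>u (\<lambda>w. (\<epsilon> *\<^sub>R b w) *\<^sub>R (k + ?p w) + (?n w - l)) y"
        "D\<^sub>v (s \<epsilon> \<circ> param d) y = D\<^sub>v (\<lambda>w. (\<epsilon> *\<^sub>R b w) *\<^sub>R (k + ?p w) + (?n w - l)) y"
        by (rule D_cong_open[OF V y]; simp only: eq)+
      show "D\<^sub>u (s \<epsilon> \<circ> param d) y = (\<epsilon> * b y) *\<^sub>R D\<^sub>u ?p y + D\<^sub>u ?n y + (\<epsilon> * D\<^sub>u b y) *\<^sub>R (k + ?p y)"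
        "D\<^sub>v (s \<epsilon> \<circ> param d) y = (\<epsilon> * b y) *\<^sub>R D\<^sub>v ?p y + D\<^sub>v ?n y + (\<epsilon> * D\<^sub>v b y) *\<^sub>R (k + ?p y)"
        unfolding De DD by simp_all
    qed
    have coords: "curvature_line_coords A f d"
      unfolding curvature_line_coords_def
    proof (intro conjI R(4), rule exI[of _ "s (-1)"], rule exI[of _ "s 1"], intro conjI sec ballI)
      fix x assume x: "x \<in> dom_c d"
      have xp: "x \<in> points A" and xc: "x \<in> dom_c c" using x dpts dc by auto
      let ?y = "map_c d x"
      have y: "?y \<in> V" and py: "param d ?y = x" using mapV[OF x] D(5)[OF x] by auto
      have bpos: "b ?y > 0" using apos[OF y] by (simp add: b_def)
      show "s (-1) x \<noteq> 0" "s 1 x \<noteq> 0" unfolding s_def using lift_coeff_zero(2)[OF xp] by fastforce+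
      show "span {s (-1) x} \<noteq> span {s 1 x}"
      proof
        assume "span {s (-1) x} = span {s 1 x}"
        from span_lift_eq[OF xp this[unfolded s_def]] obtain r where "-1 * b ?y = r * (1 * b ?y)" "1 = r * 1" .
        then show False using bpos by simp
      qed
      have "(k + P x) \<in> f x" using mem_f[OF xp, of "k + P x"] by (metis add.right_neutral scaleR_one scaleR_zero_left)
      then have in_f: "r *\<^sub>R (k + P x) \<in> f x" for r using f[OF xp] by (simp add: span_mul)
      have "D\<^sub>u (s (-1) \<circ> param d) ?y = (- D\<^sub>u b ?y) *\<^sub>R (k + P x)"
        unfolding Ds[OF y] nu[OF y] using py by (simp add: b_def)
      then show "D\<^sub>u (s (-1) \<circ> param d) ?y \<in> f x" using in_f by metis
      have "D\<^sub>v (s 1 \<circ> param d) ?y = (D\<^sub>v b ?y) *\<^sub>R (k + P x)"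
        unfolding Ds[OF y] nv[OF y] using py by (simp add: b_def)
      then show "D\<^sub>v (s 1 \<circ> param d) ?y \<in> f x" using in_f by metis
      \<comment> \<open>\<open>curvature_sphere\<close> refers to charts of A, so the coordinate
        direction is carried from d to c.\<close>
      have cs: "curvature_sphere A f x (span {s \<epsilon> x})"
        if nz: "\<zeta> \<noteq> 0" and zero: "(\<epsilon> * b ?y) *\<^sub>R dmap d P x \<zeta> + 1 *\<^sub>R dmap d N x \<zeta> = 0" for \<epsilon> \<zeta>
      proof -
        obtain \<xi> where \<xi>: "\<xi> \<noteq> 0" "\<And>g :: 'm \<Rightarrow> r42. (g \<circ> param c) differentiable (at (map_c c x)) \<Longrightarrow> dmap d g x \<zeta> = dmap c g x \<xi>"
          using dmap_chart_change[OF R(1) chart[OF c(1)] change_d[OF c(1)] x xc nz] by blast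
        have "dmap d P x \<zeta> = dmap c P x \<xi>" "dmap d N x \<zeta> = dmap c N x \<xi>"
          using \<xi>(2) smooth_map_differentiable[OF smP c(1) xc xp] smooth_map_differentiable[OF smN c(1) xc xp] by blast+
        with zero have e: "(\<epsilon> * b ?y) *\<^sub>R dmap c P x \<xi> + 1 *\<^sub>R dmap c N x \<xi> = 0" by simp
        show ?thesis unfolding curvature_sphere_iff[OF c(1) xc] s_def
          by (rule exI[of _ \<xi>], rule exI[of _ "\<epsilon> * b ?y"], rule exI[of _ 1]) (use \<xi>(1) e in auto)
      qed
      have dm: "dmap d h x (1, 0) = D\<^sub>u (h \<circ> param d) ?y" "dmap d h x (0, 1) = D\<^sub>v (h \<circ> param d) ?y" for h :: "'m \<Rightarrow> r42"
        by (simp_all add: dmap_def D\<^sub>u_def D\<^sub>v_def)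
      show "curvature_sphere A f x (span {s (-1) x})"
        by (rule cs[of "(1, 0)"]) (simp_all add: dm nu[OF y] b_def zero_prod_def)
      show "curvature_sphere A f x (span {s 1 x})"
        by (rule cs[of "(0, 1)"]) (simp_all add: dm nv[OF y] b_def zero_prod_def)
    qed
    have a0: "a y \<noteq> 0" if "y \<in> V" for y using apos[OF that] by simp
    \<comment> \<open>P_u = a^-2 N_u and P_v = - a^-2 N_v, so \<open>moutard_product\<close> applies
      with P and N exchanged, the factor 1 / a and the constant - l.\<close>
    define ia where "ia y = inverse (a y)" for y
    have smia: "smooth_on V ia" unfolding ia_def[abs_def] by (rule smooth_on_inverse[OF V sma a0])
    have ia0: "ia y \<noteq> 0" if "y \<in> V" for y using a0[OF that] by (simp add: ia_def)
    have pu: "D\<^sub>u ?p y = (ia y)\<^sup>2 *\<^sub>R D\<^sub>u ?n y" "D\<^sub>v ?p y = - (ia y)\<^sup>2 *\<^sub>R D\<^sub>v ?n y" if "y \<in> V" for y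
      unfolding nu[OF that] nv[OF that] using a0[OF that] by (simp_all add: ia_def power_inverse)
    have ml: "moutard_lift A d (\<lambda>x. span {\<sigma> x}) (\<lambda>x. e (map_c d x) *\<^sub>R \<sigma> x)"
      if e: "smooth_on V e" "\<And>y. y \<in> V \<Longrightarrow> e y \<noteq> 0" and \<sigma>: "smooth_map A (dom_c d) \<sigma>" "\<And>x. x \<in> dom_c d \<Longrightarrow> \<sigma> x \<noteq> 0"
        and eq: "\<And>x. \<sigma> x = j + h x"
        and M: "\<And>y. y \<in> V \<Longrightarrow> D\<^sub>v (D\<^sub>u (\<lambda>y. e y *\<^sub>R (j + (h \<circ> param d) y))) y = D\<^sub>v (D\<^sub>u e) y *\<^sub>R (j + (h \<circ> param d) y)"
      for e :: "real \<times> real \<Rightarrow> real" and \<sigma> h :: "'m \<Rightarrow> r42" and j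
      unfolding moutard_lift_def
    proof (intro conjI ballI)
      show "local_section A (\<lambda>x. span {\<sigma> x}) (dom_c d) (\<lambda>x. e (map_c d x) *\<^sub>R \<sigma> x)"
        unfolding local_section_def
        by (intro conjI D(1) dpts smooth_map_scaleR sm_fun e \<sigma> ballI span_mul) (auto simp: span_base)
      fix x assume x: "x \<in> dom_c d"
      let ?y = "map_c d x"
      have y: "?y \<in> V" and py: "param d ?y = x" using mapV[OF x] D(5)[OF x] by auto
      show "e ?y *\<^sub>R \<sigma> x \<noteq> 0" using e(2)[OF y] \<sigma>(2)[OF x] by simp
      let ?s = "(\<lambda>x. e (map_c d x) *\<^sub>R \<sigma> x) \<circ> param d"
      have s: "?s w = e w *\<^sub>R (j + (h \<circ> param d) w)" if "w \<in> V" for w using D(6)[OF that] by (simp add: eq)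
      have "D\<^sub>v (D\<^sub>u ?s) ?y = D\<^sub>v (D\<^sub>u (\<lambda>y. e y *\<^sub>R (j + (h \<circ> param d) y))) ?y"
        by (rule D_cong_open(2)[OF V y], rule D_cong_open(1)[OF V _ s])
      also have "\<dots> = D\<^sub>v (D\<^sub>u e) ?y *\<^sub>R \<sigma> x" unfolding M[OF y] using py by (simp add: eq)
      also have "\<dots> = (D\<^sub>v (D\<^sub>u e) ?y / e ?y) *\<^sub>R (e ?y *\<^sub>R \<sigma> x)" using e(2)[OF y] by simp
      finally show "\<exists>r. D\<^sub>v (D\<^sub>u ?s) ?y = r *\<^sub>R (e ?y *\<^sub>R \<sigma> x)" by blast
    qed
    have "moutard_lift A d sphere_k (\<lambda>x. a (map_c d x) *\<^sub>R (k + P x))"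
    proof (rule ml[OF sma a0 sk, where j=k and h=P])
      show "k + P x \<noteq> 0" if "x \<in> dom_c d" for x using lift_coeff_zero(1)[of x 1 0] dpts that by auto
      show "D\<^sub>v (D\<^sub>u (\<lambda>y. a y *\<^sub>R (k + ?p y))) y = D\<^sub>v (D\<^sub>u a) y *\<^sub>R (k + ?p y)" if "y \<in> V" for y
        by (rule moutard_product[OF V smp smn sma a0 nu nv that])
    qed simp_all
    moreover have "moutard_lift A d sphere_l (\<lambda>x. ia (map_c d x) *\<^sub>R (N x - l))"
    proof (rule ml[OF smia ia0 sl, where j="- l" and h=N])
      show "N x - l \<noteq> 0" if "x \<in> dom_c d" for x using lift_coeff_zero(2)[of x 0 1] dpts that by auto
      show "D\<^sub>v (D\<^sub>u (\<lambda>y. ia y *\<^sub>R (- l + ?n y))) y = D\<^sub>v (D\<^sub>u ia) y *\<^sub>R (- l + ?n y)" if "y \<in> V" for y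
        by (rule moutard_product[OF V smn smp smia ia0 pu that])
    qed simp_all
    ultimately show ?thesis using that xd coords by blast
  qed
qed

lemma omega_pair_if_harmonic:
  assumes umb: "umbilic_free A f" and sep: "separates_harmonically A f sphere_k sphere_l"
  shows "omega_pair A f sphere_k sphere_l"
proof -
  have "sphere_k x \<subseteq> f x" "sphere_l x \<subseteq> f x" if "x \<in> points A" for x
    unfolding f[OF that] by (intro span_mono; simp)+
  then show ?thesis
    unfolding omega_pair_def isothermic_def envelops_def
    using sphere_congruences sep moutard_coordinates[OF umb sep] by metis
qed

end

section \<open>From flat fronts to touching pairs\<close>

lemma (in atlas) null_map_of_front:
  assumes fr: "front A p q F T" and eq: "\<And>x. x \<in> points A \<Longrightarrow> f x = legendre_lift p q F T x"
  shows "null_map A (p + q) (p - q) (\<lambda>x. F x + T x) (\<lambda>x. F x - T x) f"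
proof
  have sm: "smooth_map A (points A) F" "smooth_map A (points A) T" and hf: "hyperbolic_frame p q"
    using fr by (auto simp: front_def)
  show "smooth_map A (points A) (\<lambda>x. F x + T x)" "smooth_map A (points A) (\<lambda>x. F x - T x)"
    by (intro smooth_map_add smooth_map_diff open_points sm)+
  have F: "lip (F x) (F x) = -1" "lip (F x) p = 0" "lip (F x) q = 0" if x: "x \<in> points A" for x
  proof -
    obtain H where "H \<in> hyperbolic_spaces p q" "F x \<in> H" using fr x by (auto simp: front_def)
    then have "F x \<in> {y \<in> r31 p q. lip y y = -1}" using in_components_subset unfolding hyperbolic_spaces_def by blast
    then show "lip (F x) (F x) = -1" "lip (F x) p = 0" "lip (F x) q = 0" by (auto simp: r31_def)
  qed
  have T: "lip (T x) (T x) = 1" "lip (T x) p = 0" "lip (T x) q = 0" "lip (T x) (F x) = 0" if x: "x \<in> points A" for x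
    using fr x by (auto simp: front_def de_sitter_def r31_def)
  show "null_frame (p + q) (p - q) (F x + T x) (F x - T x)" if x: "x \<in> points A" for x
    using F[OF x] T[OF x] hf lip_commute[of "F x" "T x"] lip_commute[of q p]
    by (simp add: null_frame_def lip_simps hyperbolic_frame_def)
  show "f x = span {p + q + (F x + T x), F x - T x - (p - q)}" if x: "x \<in> points A" for x
  proof -
    let ?a = "q + F x" and ?b = "p + T x"
    have e: "p + q + (F x + T x) = ?a + ?b" "F x - T x - (p - q) = ?a - ?b" by simp_all
    show ?thesis unfolding e eq[OF x] legendre_lift_def by (rule span_sum_diff)
  qed
  show "legendre_map A f"
    using fr legendre_map_cong[of "legendre_lift p q F T" f] eq by (simp add: front_def)
  show "lip (dmap c (\<lambda>x. F x + T x) x \<xi>) (F x - T x) = 0" if c: "c \<in> A" "x \<in> dom_c c" for c x \<xi>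
  proof -
    have x: "x \<in> points A" using dom_points[OF c] .
    have FF: "lip (dmap c F x \<xi>) (F x) = 0" "lip (dmap c T x \<xi>) (T x) = 0"
      using dmap_lip_const[OF open_points sm(1,1) F(1) c x, of \<xi>] dmap_lip_const[OF open_points sm(2,2) T(1) c x, of \<xi>]
        lip_commute[of "F x"] lip_commute[of "T x"] by auto
    \<comment> \<open>The normal condition covers both mixed terms, as differentiating (T, F) = 0
      gives (dT, F) = - (T, dF).\<close>
    have TF: "lip (T x) (dmap c F x \<xi>) = 0" using fr c unfolding front_def by blast
    then have "lip (dmap c T x \<xi>) (F x) = 0"
      using dmap_lip_const[OF open_points sm(2,1) T(4) c x, of \<xi>] by simp
    then show ?thesis
      using FF TF lip_commute[of "T x" "dmap c F x \<xi>"] unfolding dmap_add[OF sm c x] by (simp add: lip_simps)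
  qed
qed

lemma (in atlas) flat_front_omega:
  assumes "lift_of_flat_front A f p q F T"
  shows "\<exists>s\<^sub>p s\<^sub>m. omega_touching A f s\<^sub>p s\<^sub>m (p + q) (p - q)"
proof -
  have ff: "flat_front A p q F T" and eq: "\<And>x. x \<in> points A \<Longrightarrow> f x = legendre_lift p q F T x"
    using assms by (auto simp: lift_of_flat_front_def)
  have fr: "front A p q F T" and umb': "umbilic_free A (legendre_lift p q F T)" using ff by (auto simp: flat_front_def)
  interpret null_map A "p + q" "p - q" "\<lambda>x. F x + T x" "\<lambda>x. F x - T x" f
    by (rule null_map_of_front[OF fr eq])
  have umb: "umbilic_free A f" using umbilic_free_cong[of "legendre_lift p q F T" f] umb' eq by simp
  have FT: "base_front = F" "base_normal = T"
    by (auto simp: fun_eq_iff base_front_def base_normal_def simp flip: scaleR_2)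
  have parallel_flat
    using ff unfolding parallel_flat_def FT flat_front_def by blast
  then have sep: "separates_harmonically A f sphere_k sphere_l" by (rule harmonic_if_parallel_flat)
  note om = omega_pair_if_harmonic[OF umb sep]
  have hf: "lip p p = -1" "lip q q = 1" "lip p q = 0" "lip q p = 0"
    using fr lip_commute[of q p] by (auto simp: Defs.front_def hyperbolic_frame_def)
  have kl: "lip (p + q) (p + q) = 0" "lip (p - q) (p - q) = 0" "lip (p + q) (p - q) = -2" "lip (p - q) (p + q) = -2"
    using hf by (simp_all add: lip_simps)
  have "p + q \<noteq> 0" "p - q \<noteq> 0"
    using kl(3) by (metis lip.zero_left zero_neq_neg_numeral, metis lip.zero_right zero_neq_neg_numeral)
  moreover have "touches_fixed A sphere_k (p + q)" "touches_fixed A sphere_l (p - q)"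
    unfolding touches_fixed_def
    using lip_frame(2)[where \<alpha>=1 and \<beta>=0] lip_frame(1)[where \<alpha>=0 and \<beta>=1] by (auto simp: span_singleton lip.scaleR_left)
  ultimately have "omega_touching A f sphere_k sphere_l (p + q) (p - q)"
    unfolding omega_touching_def omega_surface_def sphere_vector_def using legendre umb om kl by auto
  then show ?thesis by blast
qed

section \<open>Spheres touched by all contact elements\<close>

text \<open>The coefficient \<open>x\<close> of \<open>w = x s + y t\<close> for independent \<open>s, t\<close>, in a form that is visibly
  smooth in \<open>s, t, w\<close>.\<close>

definition coeff :: "'a::real_inner \<Rightarrow> 'a \<Rightarrow> 'a \<Rightarrow> real" where
  "coeff s t w = ((w \<bullet> s) * (t \<bullet> t) - (w \<bullet> t) * (s \<bullet> t)) / ((s \<bullet> s) * (t \<bullet> t) - (s \<bullet> t)\<^sup>2)"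

lemma inner_gram_nonzero:
  fixes s t :: "'a::real_inner"
  assumes "s \<noteq> 0" "t \<notin> span {s}"
  shows "(s \<bullet> s) * (t \<bullet> t) - (s \<bullet> t)\<^sup>2 \<noteq> 0"
proof
  assume 0: "(s \<bullet> s) * (t \<bullet> t) - (s \<bullet> t)\<^sup>2 = 0"
  let ?v = "(s \<bullet> s) *\<^sub>R t - (s \<bullet> t) *\<^sub>R s"
  have "?v \<bullet> ?v = (s \<bullet> s) * ((s \<bullet> s) * (t \<bullet> t) - (s \<bullet> t)\<^sup>2)"
    by (simp add: inner_simps inner_commute[of t s] power2_eq_square algebra_simps)
  then have "?v = 0" using 0 by simp
  then have "(1 / (s \<bullet> s)) *\<^sub>R ((s \<bullet> s) *\<^sub>R t) = (1 / (s \<bullet> s)) *\<^sub>R ((s \<bullet> t) *\<^sub>R s)" by simp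
  then have "t = ((s \<bullet> t) / (s \<bullet> s)) *\<^sub>R s" using assms(1) by simp
  then show False using assms(2) by (metis span_base span_mul singletonI)
qed

text \<open>Cramer's rule for the Gram matrix of the Euclidean inner product. \<open>lip\<close>
  could not be used, as it vanishes identically on contact elements.\<close>

lemma coeff_eq:
  fixes s t :: "'a::real_inner"
  assumes "s \<noteq> 0" "t \<notin> span {s}"
  shows "coeff s t (x *\<^sub>R s + y *\<^sub>R t) = x" "coeff t s (x *\<^sub>R s + y *\<^sub>R t) = y"
proof -
  note g = inner_gram_nonzero[OF assms]
  have 1: "((x *\<^sub>R s + y *\<^sub>R t) \<bullet> s) * (t \<bullet> t) - ((x *\<^sub>R s + y *\<^sub>R t) \<bullet> t) * (s \<bullet> t) = x * ((s \<bullet> s) * (t \<bullet> t) - (s \<bullet> t)\<^sup>2)"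
    and 2: "((x *\<^sub>R s + y *\<^sub>R t) \<bullet> t) * (s \<bullet> s) - ((x *\<^sub>R s + y *\<^sub>R t) \<bullet> s) * (t \<bullet> s) = y * ((s \<bullet> s) * (t \<bullet> t) - (s \<bullet> t)\<^sup>2)"
    and 3: "(t \<bullet> t) * (s \<bullet> s) - (t \<bullet> s)\<^sup>2 = (s \<bullet> s) * (t \<bullet> t) - (s \<bullet> t)\<^sup>2"
    by (simp_all add: inner_simps inner_commute[of t s] power2_eq_square algebra_simps)
  show "coeff s t (x *\<^sub>R s + y *\<^sub>R t) = x" unfolding coeff_def 1 using g by simp
  show "coeff t s (x *\<^sub>R s + y *\<^sub>R t) = y" unfolding coeff_def 2 3 using g by simp
qed

lemma span_pairE:
  fixes a b w :: "'a::real_vector"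
  assumes "w \<in> span {a, b}"
  obtains u v where "w = u *\<^sub>R a + v *\<^sub>R b"
proof -
  obtain u where "w - u *\<^sub>R a \<in> span {b}" using assms span_breakdown_eq by blast
  then obtain v where "w - u *\<^sub>R a = v *\<^sub>R b" by (auto simp: span_singleton)
  then have "w = u *\<^sub>R a + v *\<^sub>R b" by (simp add: diff_eq_eq add.commute)
  then show ?thesis by (rule that)
qed

lemma smooth_on_coeff:
  fixes s t w :: "'b::real_normed_vector \<Rightarrow> 'a::real_inner"
  assumes S: "open S" and sm: "smooth_on S s" "smooth_on S t" "smooth_on S w"
    and ne: "\<And>x. x \<in> S \<Longrightarrow> s x \<noteq> 0" "\<And>x. x \<in> S \<Longrightarrow> t x \<notin> span {s x}"
  shows "smooth_on S (\<lambda>x. coeff (s x) (t x) (w x))"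
  unfolding coeff_def
proof (intro smooth_on_divide smooth_on_diff smooth_on_mult smooth_on_bilinear[OF bounded_bilinear_inner] S sm)
  show "smooth_on S (\<lambda>x. (s x \<bullet> t x)\<^sup>2)"
    unfolding power2_eq_square by (intro smooth_on_mult smooth_on_bilinear[OF bounded_bilinear_inner] S sm)
qed (intro inner_gram_nonzero ne)

text \<open>On the segment from z0 to z the two equations combine to a linear ordinary differential
  equation with a continuous coefficient.\<close>

lemma linear_pde_zero:
  fixes m a b :: "real \<times> real \<Rightarrow> real"
  assumes sm: "smooth_on (ball z0 r) m" and ab: "continuous_on (ball z0 r) a" "continuous_on (ball z0 r) b"
    and m: "\<And>z. z \<in> ball z0 r \<Longrightarrow> D\<^sub>u m z = a z * m z" "\<And>z. z \<in> ball z0 r \<Longrightarrow> D\<^sub>v m z = b z * m z"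
    and 0: "m z0 = 0" and z: "z \<in> ball z0 r"
  shows "m z = 0"
proof -
  let ?w = "\<lambda>t. z0 + t *\<^sub>R (z - z0)"
  have inB: "?w t \<in> ball z0 r" if "t \<in> {0..1}" for t
  proof -
    have "norm (t *\<^sub>R (z - z0)) \<le> norm (z - z0)" using that by (simp add: mult_left_le_one_le)
    then show ?thesis using z by (simp add: dist_norm norm_minus_commute)
  qed
  define c where "c t = fst (z - z0) * a (?w t) + snd (z - z0) * b (?w t)" for t
  have "m (?w 1) = 0"
  proof (rule linear_ode_zero[of "\<lambda>t. m (?w t)" c])
    fix t :: real assume t: "t \<in> {0..1}"
    have "((\<lambda>t. ?w t) has_derivative (\<lambda>s. s *\<^sub>R (z - z0))) (at t within {0..1})"
      by (auto intro!: derivative_eq_intros)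
    from diff_chain_within[OF this has_derivative_at_withinI[OF smooth_on_has_D[OF sm inB[OF t]]]]
    show "((\<lambda>t. m (?w t)) has_real_derivative c t * m (?w t)) (at t within {0..1})"
      unfolding has_field_derivative_def o_def m[OF inB[OF t]] c_def
      by (rule has_derivative_eq_rhs) (auto simp: algebra_simps)
  next
    show "continuous_on {0..1} c"
      unfolding c_def
      by (intro continuous_intros continuous_on_compose2[OF ab(1)] continuous_on_compose2[OF ab(2)] image_subsetI inB)
  qed (use 0 in simp)
  then show ?thesis by simp
qed

context atlas begin

text \<open>A constant section has derivative 0 in all directions. Together with a curvature sphere
  \<sigma> other than k it spans f, so in the curvature direction of \<sigma> every section has its
  derivative in f, which regularity forbids.\<close>

lemma fixed_section_in_f:
  assumes leg: "legendre_map A f" and umb: "umbilic_free A f" and W: "open W" "W \<subseteq> points A" "x \<in> W" and k0: "k \<noteq> 0"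
    and k: "\<And>y. y \<in> W \<Longrightarrow> k \<in> f y"
  shows False
proof -
  have xp: "x \<in> points A" using W by blast
  obtain S1 S2 where "curvature_sphere A f x S1" "curvature_sphere A f x S2" "S1 \<noteq> S2"
    using umb xp unfolding umbilic_free_def by blast
  then obtain S where S: "curvature_sphere A f x S" "S \<noteq> span {k}" by blast
  then obtain V \<sigma> c \<xi> where *: "x \<in> V" "local_section A f V \<sigma>" "\<sigma> x \<noteq> 0" "S = span {\<sigma> x}"
        "c \<in> A" "x \<in> dom_c c" "\<xi> \<noteq> 0" "dmap c \<sigma> x \<xi> \<in> f x"
    unfolding curvature_sphere_def by blast
  have ce: "contact_element (f x)" if "x \<in> points A" for x
    using leg that by (auto simp: legendre_map_def contact_congruence_def)
  have sub: "subspace (f x)" and d2: "dim (f x) = 2" using ce[OF xp] by (auto simp: contact_element_def)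
  have sx: "\<sigma> x \<in> f x" and V: "open V" "V \<subseteq> points A" "smooth_map A V \<sigma>" using * by (auto simp: local_section_def)
  have indep: "\<sigma> x \<notin> span {k}"
  proof
    assume "\<sigma> x \<in> span {k}"
    then obtain r where r: "\<sigma> x = r *\<^sub>R k" by (auto simp: span_singleton)
    then have "r \<noteq> 0" using *(3) by auto
    then have "span {\<sigma> x} = span {k}" using span_image_scale[of "{k}" "\<lambda>_. r"] r by simp
    with S(2) *(4) show False by simp
  qed
  \<comment> \<open>Near \<open>x\<close> every section is a combination of \<open>\<sigma>\<close> and the constant \<open>k\<close>.\<close>
  have "continuous_on V \<sigma>" by (rule smooth_map_continuous[OF V(3,1,2)])
  then have co: "continuous_on V (\<lambda>y. (\<sigma> y \<bullet> \<sigma> y) * (k \<bullet> k) - (\<sigma> y \<bullet> k)\<^sup>2)" by (intro continuous_intros)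
  let ?g = "\<lambda>y. (\<sigma> y \<bullet> \<sigma> y) * (k \<bullet> k) - (\<sigma> y \<bullet> k)\<^sup>2"
  have "k \<notin> span {\<sigma> x}"
  proof
    assume "k \<in> span {\<sigma> x}"
    then obtain r where r: "k = r *\<^sub>R \<sigma> x" by (auto simp: span_singleton)
    then have "\<sigma> x = (1 / r) *\<^sub>R k" using k0 by auto
    then show False using indep by (metis span_base span_mul singletonI)
  qed
  then have g0: "?g x \<noteq> 0" by (rule inner_gram_nonzero[OF *(3)])
  have "\<xi> = 0"
  proof -
    have "dmap c \<tau> x \<xi> \<in> f x" if "x \<in> V'" and \<tau>: "local_section A f V' \<tau>" for V' \<tau>
    proof -
      have V': "open V'" "V' \<subseteq> points A" "smooth_map A V' \<tau>" "\<And>y. y \<in> V' \<Longrightarrow> \<tau> y \<in> f y" using \<tau> by (auto simp: local_section_def)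
      \<comment> \<open>The Gram determinant of \<sigma> and k is continuous and nonzero at x; on X
        the two stay independent and have smooth coefficient functions.\<close>
      define X where "X = (V \<inter> ?g -` (- {0})) \<inter> V' \<inter> W"
      have X: "open X" "x \<in> X" "X \<subseteq> V" "X \<subseteq> V'" "X \<subseteq> W"
        unfolding X_def using continuous_open_preimage[OF co V(1), of "- {0}"] V'(1) W(1,3) *(1) that(1) g0 by auto
      have smX: "smooth_map A X \<sigma>" "smooth_map A X \<tau>" using V(3) V'(3) X smooth_map_subset by blast+
      have sk: "smooth_map A X (\<lambda>_. k)" by (rule smooth_map_const[OF X(1)])
      have in_: "smooth_map A X (\<lambda>y. u y \<bullet> v y)" if "smooth_map A X u" "smooth_map A X v" for u v :: "'m \<Rightarrow> r42"
        by (rule smooth_map_bilinear[OF bounded_bilinear_inner X(1) that])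
      have mu: "smooth_map A X (\<lambda>y. u y * v y)" if "smooth_map A X u" "smooth_map A X v" for u v :: "'m \<Rightarrow> real"
        by (rule smooth_map_bilinear[OF bounded_bilinear_mult X(1) that])
      have gX: "?g y \<noteq> 0" if "y \<in> X" for y using that by (auto simp: X_def)
      have smg: "smooth_map A X (\<lambda>y. inverse (?g y))"
        by (intro smooth_map_inverse X(1) gX) (unfold power2_eq_square, intro smooth_map_diff mu in_ smX sk X(1))
      have gX': "(k \<bullet> k) * (\<sigma> y \<bullet> \<sigma> y) - (k \<bullet> \<sigma> y)\<^sup>2 = ?g y" for y by (simp add: inner_commute)
      define a b where "a y = coeff (\<sigma> y) k (\<tau> y)" and "b y = coeff k (\<sigma> y) (\<tau> y)" for y
      have sma: "smooth_map A X a" "smooth_map A X b"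
        unfolding a_def[abs_def] b_def[abs_def] coeff_def gX' divide_inverse
        by (intro mu smooth_map_diff in_ smX sk X(1) smg)+
      have \<tau>_eq: "\<tau> y = a y *\<^sub>R \<sigma> y + b y *\<^sub>R k" if y: "y \<in> X" for y
      proof -
        have yp: "y \<in> points A" using X(5) W(2) y by blast
        have sy: "\<sigma> y \<in> f y" "k \<in> f y" "\<tau> y \<in> f y"
          using *(2) X y k V'(4) by (auto simp: local_section_def)
        have ind: "\<sigma> y \<noteq> 0" "k \<notin> span {\<sigma> y}"
        proof -
          show "\<sigma> y \<noteq> 0" using gX[OF y] by auto
          show "k \<notin> span {\<sigma> y}"
          proof
            assume "k \<in> span {\<sigma> y}"
            then obtain r where "k = r *\<^sub>R \<sigma> y" by (auto simp: span_singleton)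
            then have "?g y = 0" by (simp add: power2_eq_square algebra_simps)
            with gX[OF y] show False by simp
          qed
        qed
        have "independent {k, \<sigma> y}" using ind by (simp add: independent_insert)
        moreover have "card {k, \<sigma> y} = 2" using ind by (auto simp: card_insert_if span_base)
        moreover have "dim (f y) = 2" "subspace (f y)" using ce[OF yp] by (auto simp: contact_element_def)
        ultimately have "f y \<subseteq> span {k, \<sigma> y}"
          using card_ge_dim_independent[of "{k, \<sigma> y}" "f y"] sy by simp
        from span_pairE[OF subsetD[OF this sy(3)]] obtain v u where "\<tau> y = v *\<^sub>R k + u *\<^sub>R \<sigma> y" .
        then have uv: "\<tau> y = u *\<^sub>R \<sigma> y + v *\<^sub>R k" by (simp add: add.commute)
        then show ?thesis unfolding a_def b_def using coeff_eq[OF ind] by simp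
      qed
      have "dmap c \<tau> x \<xi> = dmap c (\<lambda>y. a y *\<^sub>R \<sigma> y + b y *\<^sub>R k) x \<xi>"
        by (rule dmap_cong[OF *(5,6) X(1,2) \<tau>_eq])
      also have "\<dots> = dmap c (\<lambda>y. a y *\<^sub>R \<sigma> y) x \<xi> + dmap c (\<lambda>y. b y *\<^sub>R k) x \<xi>"
        by (rule dmap_add[OF smooth_map_scaleR[OF X(1) sma(1) smX(1)] smooth_map_scaleR[OF X(1) sma(2) sk] *(5,6) X(2)])
      also have "\<dots> = a x *\<^sub>R dmap c \<sigma> x \<xi> + dmap c a x \<xi> *\<^sub>R \<sigma> x + dmap c b x \<xi> *\<^sub>R k"
        using dmap_bilinear[OF bounded_bilinear_scaleR sma(1) smX(1) *(5,6) X(2)]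
          dmap_bilinear[OF bounded_bilinear_scaleR sma(2) sk *(5,6) X(2)] by (simp add: dmap_const)
      also have "\<dots> \<in> f x" using sub *(8) sx k[OF W(3)] by (intro subspace_add subspace_scale)
      finally show ?thesis .
    qed
    then show ?thesis using leg *(5,6) unfolding legendre_map_def regular_def by blast
  qed
  with *(7) show False by simp
qed

text \<open>This is what permits normalisation: the second congruence of the pair can be scaled to a
  prescribed product with k only where some sphere of f does not touch k.\<close>

lemma not_touched_identically:
  assumes leg: "legendre_map A f" and umb: "umbilic_free A f"
    and s: "isothermic A f s" and t: "touches_fixed A s k" and k: "k \<noteq> 0" "lip k k = 0"
    and nc: "\<And>x. x \<in> points A \<Longrightarrow> \<not> curvature_sphere A f x (s x)" and x: "x \<in> points A"
  obtains y where "y \<in> f x" "lip y k \<noteq> 0"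
proof -
  have "\<exists>y\<in>f x. lip y k \<noteq> 0"
  proof (rule ccontr)
    assume no: "\<not> ?thesis"
    have ce: "contact_element (f x)" if "x \<in> points A" for x
      using leg that by (auto simp: legendre_map_def contact_congruence_def)
    obtain c where c: "x \<in> dom_c c" "curvature_line_coords A f c" using s x unfolding isothermic_def by blast
    have lc: "local_coords A c" using c by (simp add: curvature_line_coords_def)
    then have ch: "is_chart c" and dp: "dom_c c \<subseteq> points A" and cd: "\<And>d. d \<in> A \<Longrightarrow> smooth_change c d" "\<And>d. d \<in> A \<Longrightarrow> smooth_change d c"
      by (auto simp: local_coords_def)
    note C = is_chartD[OF ch]
    obtain \<sigma> \<tau> where st: "local_section A f (dom_c c) \<sigma>" "local_section A f (dom_c c) \<tau>"
      "\<And>x. x \<in> dom_c c \<Longrightarrow> \<sigma> x \<noteq> 0 \<and> \<tau> x \<noteq> 0 \<and> span {\<sigma> x} \<noteq> span {\<tau> x} \<and>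
           curvature_sphere A f x (span {\<sigma> x}) \<and> curvature_sphere A f x (span {\<tau> x}) \<and>
           D\<^sub>u (\<sigma> \<circ> param c) (map_c c x) \<in> f x \<and> D\<^sub>v (\<tau> \<circ> param c) (map_c c x) \<in> f x"
      using c(2) unfolding curvature_line_coords_def by blast
    have "sphere_congruence A s" using s by (simp add: isothermic_def)
    then obtain V0 \<rho>0 where V0: "x \<in> V0" "local_section A s V0 \<rho>0" "\<forall>y\<in>V0. s y = span {\<rho>0 y}"
      using x unfolding sphere_congruence_def by blast
    define V where "V = V0 \<inter> dom_c c"
    have V: "open V" "x \<in> V" "V \<subseteq> dom_c c" "V \<subseteq> points A" using V0 c C(1) dp by (auto simp: V_def local_section_def)
    \<comment> \<open>The curvature line chart c need not belong to A, while
      \<open>smooth_map\<close> speaks about charts of A, so smoothness is transferred by the chart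
      changes.\<close>
    have smooth_c: "smooth_on (map_c c ` (dom_c c \<inter> V)) (h \<circ> param c)" if "smooth_map A V h" for h :: "'m \<Rightarrow> r42"
    proof (rule smooth_on_local)
      fix z assume z: "z \<in> map_c c ` (dom_c c \<inter> V)"
      then have pz: "param c z \<in> V" "z \<in> map_c c ` dom_c c" using chart_image_iff[OF ch] by blast+
      from subsetD[OF V(4) pz(1)] obtain d where d: "d \<in> A" "param c z \<in> dom_c d" by (rule pointsE)
      let ?X = "map_c c ` (dom_c c \<inter> (V \<inter> dom_c d))"
      note S = smooth_changeD[OF ch chart[OF d(1)] cd(1)[OF d(1)]]
      have X: "open ?X" by (rule open_chart_image[OF ch]) (use V(1) is_chartD(1)[OF chart[OF d(1)]] in blast)
      have sub: "?X \<subseteq> map_c c ` (dom_c c \<inter> dom_c d)" by blast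
      have "smooth_on ?X (\<lambda>z. (h \<circ> param d) ((map_c d \<circ> param c) z))"
      proof (rule smooth_on_compose[OF X open_chart_image[OF chart[OF d(1)] V(1)] _ smooth_on_subset[OF S(2) sub] smooth_mapD[OF that d(1)]])
        show "(map_c d \<circ> param c) ` ?X \<subseteq> map_c d ` (dom_c d \<inter> V)"
          using C(5) by auto
      qed
      moreover have "(h \<circ> param d) ((map_c d \<circ> param c) z) = (h \<circ> param c) z" if "z \<in> ?X" for z
        using S(4)[of z] that sub by auto
      ultimately have "smooth_on ?X (h \<circ> param c)" using smooth_on_cong[OF X] by (metis (no_types, lifting))
      moreover have "z \<in> ?X" using pz d unfolding chart_image_iff[OF ch] by blast
      ultimately show "\<exists>T. open T \<and> z \<in> T \<and> smooth_on T (h \<circ> param c)" using X by blast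
    qed
    have smV: "smooth_map A V \<sigma>" "smooth_map A V \<tau>" "smooth_map A V \<rho>0"
      using st(1,2) V0(2) smooth_map_subset V(3) unfolding local_section_def V_def by blast+
    let ?O = "map_c c ` (dom_c c \<inter> V)" and ?z = "map_c c x"
    have O: "open ?O" "?z \<in> ?O" using open_chart_image[OF ch V(1)] V by auto
    obtain r where r: "r > 0" "ball ?z r \<subseteq> ?O" using O open_contains_ball by blast
    let ?B = "ball ?z r" and ?s = "\<sigma> \<circ> param c" and ?t = "\<tau> \<circ> param c" and ?r = "\<rho>0 \<circ> param c"
    have sm: "smooth_on ?B ?s" "smooth_on ?B ?t" "smooth_on ?B ?r" using smooth_c[OF smV(1)] smooth_c[OF smV(2)] smooth_c[OF smV(3)] r(2) smooth_on_subset by blast+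
    have B: "param c z \<in> V" "param c z \<in> dom_c c" "param c z \<in> points A" "map_c c (param c z) = z" if "z \<in> ?B" for z
    proof -
      have "z \<in> ?O" using that r(2) by blast
      then show "param c z \<in> V" "map_c c (param c z) = z" using chart_image_iff[OF ch] C(6) by blast+
      then show "param c z \<in> dom_c c" "param c z \<in> points A" using V by auto
    qed
    have ne: "?s z \<noteq> 0" "?t z \<noteq> 0" "?s z \<notin> span {?t z}" "?t z \<notin> span {?s z}" if "z \<in> ?B" for z
    proof -
      note q = st(3)[OF B(2)[OF that]]
      show 0: "?s z \<noteq> 0" "?t z \<noteq> 0" using q by auto
      have *: "span {a} = span {b}" if a0: "a \<noteq> 0" and ab: "a \<in> span {b}" for a b :: r42
      proof -
        obtain r where r: "a = r *\<^sub>R b" using ab by (auto simp: span_singleton)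
        then have "r \<noteq> 0" using a0 by auto
        then show ?thesis using span_image_scale[of "{b}" "\<lambda>_. r"] r by simp
      qed
      show "?s z \<notin> span {?t z}" "?t z \<notin> span {?s z}"
        using *[OF 0(1), of "?t z"] *[OF 0(2), of "?s z"] q unfolding o_apply by blast+
    qed
    have fz: "w = coeff (?s z) (?t z) w *\<^sub>R ?s z + coeff (?t z) (?s z) w *\<^sub>R ?t z" if z: "z \<in> ?B" and w: "w \<in> f (param c z)" for z w
    proof -
      have "?s z \<in> f (param c z)" "?t z \<in> f (param c z)" using st(1,2) B(2)[OF z] by (auto simp: local_section_def)
      moreover have "independent {?s z, ?t z}" using ne[OF z] by (simp add: independent_insert)
      moreover have "card {?s z, ?t z} = 2" using ne[OF z] span_base by (metis card_2_iff singletonI)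
      moreover have "dim (f (param c z)) = 2" "subspace (f (param c z))" using ce[OF B(3)[OF z]] by (auto simp: contact_element_def)
      ultimately have "f (param c z) \<subseteq> span {?s z, ?t z}"
        using card_ge_dim_independent[of "{?s z, ?t z}" "f (param c z)"] by simp
      then have "w \<in> span {?s z, ?t z}" using w by blast
      then obtain u v where uv: "w = u *\<^sub>R ?s z + v *\<^sub>R ?t z" by (rule span_pairE)
      show ?thesis using coeff_eq[OF ne(1,4)[OF z], of u v] unfolding uv by simp
    qed
    \<comment> \<open>As \<open>s\<close> touches \<open>k\<close>, the functions \<open>(\<sigma>, k)\<close> and \<open>(\<tau>, k)\<close> are multiples of each other, so
      \<open>\<sigma>\<^sub>u, \<tau>\<^sub>v \<in> f\<close> yields a linear equation for \<open>(\<sigma>, k)\<close>.\<close>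
    define a b where "a z = coeff (?s z) (?t z) (?r z)" and "b z = coeff (?t z) (?s z) (?r z)" for z
    have rz: "?r z = a z *\<^sub>R ?s z + b z *\<^sub>R ?t z" "a z \<noteq> 0" "b z \<noteq> 0" "lip (?r z) k = 0" if z: "z \<in> ?B" for z
    proof -
      have sp: "s (param c z) = span {?r z}" using V0(3) B(1)[OF z] by (simp add: V_def)
      have "s (param c z) \<subseteq> f (param c z)" using s B(3)[OF z] by (simp add: isothermic_def envelops_def)
      then have "?r z \<in> f (param c z)" unfolding sp using span_base by blast
      from fz[OF z this] show e: "?r z = a z *\<^sub>R ?s z + b z *\<^sub>R ?t z" by (simp add: a_def b_def)
      have n: "null_line (span {?r z})" using \<open>sphere_congruence A s\<close> B(3)[OF z] sp by (auto simp: sphere_congruence_def)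
      have r0: "?r z \<noteq> 0"
      proof
        assume "?r z = 0"
        then have "dim (span {?r z}) = 0" by (simp add: dim_span)
        with n show False by (simp add: null_line_def)
      qed
      have *: "span {r *\<^sub>R b} = span {b}" if "r \<noteq> 0" for r and b :: r42
        using span_image_scale[of "{b}" "\<lambda>_. r"] that by simp
      have nc': "span {?r z} \<noteq> span {?s z}" "span {?r z} \<noteq> span {?t z}" using nc[OF B(3)[OF z]] sp st(3)[OF B(2)[OF z]] by auto
      show "a z \<noteq> 0"
      proof
        assume "a z = 0"
        then have "?r z = b z *\<^sub>R ?t z" "b z \<noteq> 0" using e r0 by auto
        then show False using *[of "b z" "?t z"] nc'(2) by metis
      qed
      show "b z \<noteq> 0"
      proof
        assume "b z = 0"
        then have "?r z = a z *\<^sub>R ?s z" "a z \<noteq> 0" using e r0 by auto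
        then show False using *[of "a z" "?s z"] nc'(1) by metis
      qed
      show "lip (?r z) k = 0" using t B(3)[OF z] sp span_base unfolding touches_fixed_def by blast
    qed
    define m where "m z = lip (?s z) k" for z
    have smm: "smooth_on ?B m" unfolding m_def[abs_def] by (intro smooth_on_lip open_ball sm smooth_on_const)
    have Dm: "D\<^sub>u m z = lip (D\<^sub>u ?s z) k" "D\<^sub>v m z = lip (D\<^sub>v ?s z) k" if z: "z \<in> ?B" for z
      unfolding m_def[abs_def] using D_lip[OF sm(1) smooth_on_const[OF open_ball] z, of k] D_const_on[OF open_ball z, of "\<lambda>_. k" k] by (auto simp: lip_simps)
    have n_eq: "lip (?t z) k = - (a z / b z) * m z" "m z = - (b z / a z) * lip (?t z) k" if z: "z \<in> ?B" for z
    proof -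
      have "a z * m z + b z * lip (?t z) k = 0" using rz(1,4)[OF z] by (simp add: m_def lip_simps)
      then show "lip (?t z) k = - (a z / b z) * m z" "m z = - (b z / a z) * lip (?t z) k" using rz(2,3)[OF z] by (auto simp: field_simps)
    qed
    have Dt: "D\<^sub>v (\<lambda>z. lip (?t z) k) z = lip (D\<^sub>v ?t z) k" if z: "z \<in> ?B" for z
      using D_lip[OF sm(2) smooth_on_const[OF open_ball] z, of k] D_const_on[OF open_ball z, of "\<lambda>_. k" k] by (auto simp: lip_simps)
    define n where "n z = lip (?t z) k" for z
    have smn: "smooth_on ?B n" unfolding n_def[abs_def] by (intro smooth_on_lip open_ball sm smooth_on_const)
    have smc: "smooth_on ?B (\<lambda>z. coeff (?s z) (?t z) (w z))" "smooth_on ?B (\<lambda>z. coeff (?t z) (?s z) (w z))"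
      if "smooth_on ?B w" for w
      by (intro smooth_on_coeff[OF open_ball sm(1,2) that] smooth_on_coeff[OF open_ball sm(2,1) that] ne; assumption)+
    \<comment> \<open>The relation a m + b n = 0, which says that s touches k, becomes m = \<rho> n.
      As s is nowhere a curvature sphere, neither a nor b vanishes, so \<rho> is smooth and never
      zero.\<close>
    define \<rho> where "\<rho> z = - (b z / a z)" for z
    have sma: "smooth_on ?B a" "smooth_on ?B b" unfolding a_def[abs_def] b_def[abs_def] by (intro smc sm(3))+
    have sm\<rho>: "smooth_on ?B \<rho>" unfolding \<rho>_def[abs_def]
      by (intro smooth_on_minus smooth_on_divide open_ball sma rz(2))
    have \<rho>0: "\<rho> z \<noteq> 0" if "z \<in> ?B" for z using rz(2,3)[OF that] by (simp add: \<rho>_def)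
    define c1 c2 d1 d2 where cd: "c1 z = coeff (?s z) (?t z) (D\<^sub>u ?s z)" "c2 z = coeff (?t z) (?s z) (D\<^sub>u ?s z)"
      "d1 z = coeff (?s z) (?t z) (D\<^sub>v ?t z)" "d2 z = coeff (?t z) (?s z) (D\<^sub>v ?t z)" for z
    have smcd: "smooth_on ?B c1" "smooth_on ?B c2" "smooth_on ?B d1" "smooth_on ?B d2"
      unfolding cd[abs_def] by (intro smc smooth_on_D sm)+
    have mn: "m z = \<rho> z * n z" if "z \<in> ?B" for z using n_eq(2)[OF that] by (simp add: \<rho>_def n_def)
    \<comment> \<open>The logarithmic derivatives that the two curvature spheres impose on m:
      \<open>A1\<close> comes from the u-equation with n = m / \<rho> inserted, \<open>A2\<close>
      from differentiating m = \<rho> n and using the v-equation for n.\<close>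
    define A1 where "A1 z = c1 z + c2 z / \<rho> z" for z
    define A2 where "A2 z = d1 z * \<rho> z + d2 z + D\<^sub>v \<rho> z / \<rho> z" for z
    have smA: "smooth_on ?B A1" "smooth_on ?B A2"
      unfolding A1_def[abs_def] A2_def[abs_def]
      using smooth_on_add[OF open_ball smcd(1) smooth_on_divide[OF open_ball smcd(2) sm\<rho> \<rho>0]]
        smooth_on_add[OF open_ball smooth_on_add[OF open_ball smooth_on_mult[OF open_ball smcd(3) sm\<rho>] smcd(4)]
          smooth_on_divide[OF open_ball smooth_on_D(2)[OF sm\<rho>] sm\<rho> \<rho>0]] by blast+
    have du: "D\<^sub>u m z = A1 z * m z" if z: "z \<in> ?B" for z
    proof -
      have "D\<^sub>u ?s z \<in> f (param c z)" using st(3)[OF B(2)[OF z]] B(4)[OF z] by simp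
      from arg_cong[OF fz[OF z this], of "\<lambda>x. lip x k"]
      have "D\<^sub>u m z = c1 z * m z + c2 z * n z" unfolding Dm(1)[OF z] by (simp add: lip_simps cd m_def n_def)
      then show ?thesis unfolding A1_def mn[OF z] using \<rho>0[OF z] by (simp add: field_simps)
    qed
    have dv: "D\<^sub>v m z = A2 z * m z" if z: "z \<in> ?B" for z
    proof -
      have "D\<^sub>v ?t z \<in> f (param c z)" using st(3)[OF B(2)[OF z]] B(4)[OF z] by simp
      from arg_cong[OF fz[OF z this], of "\<lambda>x. lip x k"]
      have Dn: "D\<^sub>v n z = d1 z * m z + d2 z * n z"
        unfolding n_def[abs_def] Dt[OF z] by (simp add: lip_simps cd m_def)
      have "D\<^sub>v m z = D\<^sub>v (\<lambda>z. \<rho> z * n z) z" by (rule D_cong_open(2)[OF open_ball z mn])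
      also have "\<dots> = \<rho> z * D\<^sub>v n z + D\<^sub>v \<rho> z * n z"
        by (rule D_bilinear(2)[OF bounded_bilinear_mult smooth_on_differentiable[OF sm\<rho> z] smooth_on_differentiable[OF smn z]])
      finally show ?thesis unfolding A2_def Dn mn[OF z] using \<rho>0[OF z] by (simp add: field_simps)
    qed
    have sx: "\<sigma> x \<in> f x" using st(1) c(1) by (auto simp: local_section_def)
    have "m ?z = 0" using no sx C(5)[OF c(1)] by (simp add: m_def)
    have m0: "m z = 0" if "z \<in> ?B" for z
      by (rule linear_pde_zero[OF smm smooth_on_continuous[OF smA(1)] smooth_on_continuous[OF smA(2)] du dv \<open>m ?z = 0\<close> that])
    have kf: "k \<in> f (param c z)" if z: "z \<in> ?B" for z
    proof (rule perp_contact_element[OF ce[OF B(3)[OF z]] k(2)])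
      fix w assume "w \<in> f (param c z)"
      note arg_cong[OF fz[OF z this], of "\<lambda>x. lip x k"]
      moreover have "lip (?s z) k = 0" "lip (?t z) k = 0"
        using m0[OF z] mn[OF z] \<rho>0[OF z] by (auto simp: m_def n_def)
      ultimately show "lip w k = 0" by (simp add: lip_simps)
    qed
    have "open (dom_c c \<inter> map_c c -` ?B)" by (rule continuous_open_preimage[OF C(3,1) open_ball])
    then show False
    proof (rule fixed_section_in_f[OF leg umb _ _ _ k(1)])
      show "dom_c c \<inter> map_c c -` ?B \<subseteq> points A" using dp by blast
      show "x \<in> dom_c c \<inter> map_c c -` ?B" using c(1) r(1) by simp
      show "k \<in> f y" if "y \<in> dom_c c \<inter> map_c c -` ?B" for y
        using kf[of "map_c c y"] that C(5)[of y] by auto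
    qed
  qed
  with that show ?thesis by blast
qed

end

section \<open>From touching isothermic congruences to flat fronts\<close>

lemma span_line_scale:
  fixes v :: "'a::real_vector"
  shows "r \<noteq> 0 \<Longrightarrow> span {r *\<^sub>R v} = span {v}"
  using span_image_scale[of "{v}" "\<lambda>_. r"] by simp

lemma span_line_eqE:
  fixes v w :: "'a::real_vector"
  assumes "span {v} = span {w}"
  obtains r where "v = r *\<^sub>R w"
proof -
  have "v \<in> span {w}" using assms span_base by blast
  then show ?thesis using that by (auto simp: span_singleton)
qed

text \<open>A harmonic range has a b \<noteq> 0, so C is neither A nor B. Exchanging A and B inverts
  the cross ratio, and -1 is its own inverse.\<close>

lemma cross_ratio_harmonicD:
  assumes "has_cross_ratio A B C D (-1)"
  shows "A \<noteq> C" "B \<noteq> C" "has_cross_ratio B A C D (-1)"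
proof -
  obtain x y a b c d where *: "x \<noteq> y" "independent {x, y}" "A = span {x}" "B = span {y}"
        "C = span {a *\<^sub>R x + b *\<^sub>R y}" "D = span {c *\<^sub>R x + d *\<^sub>R y}" "a * d \<noteq> 0" "-1 = (b * c) / (a * d)"
    using assms unfolding has_cross_ratio_def by blast
  have bc: "b * c = - (a * d)" using *(7,8) by (simp add: field_simps)
  then have nz: "a \<noteq> 0" "b \<noteq> 0" using *(7) by auto
  have nx: "x \<notin> span {y}" using *(1,2) by (simp add: independent_insert)
  have ny: "y \<notin> span {x}" using *(1,2) by (simp add: insert_commute[of x y] independent_insert)
  have in_C: "a *\<^sub>R x + b *\<^sub>R y \<in> C" using *(5) span_base by blast
  show "A \<noteq> C"
  proof
    assume "A = C"
    then have "a *\<^sub>R x + b *\<^sub>R y \<in> span {x}" using in_C *(3) by simp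
    then have "(a *\<^sub>R x + b *\<^sub>R y) - a *\<^sub>R x \<in> span {x}" by (rule span_diff) (intro span_mul span_base, simp)
    then have "b *\<^sub>R y \<in> span {x}" by simp
    from span_mul[OF this, of "1 / b"] show False using ny nz by simp
  qed
  show "B \<noteq> C"
  proof
    assume "B = C"
    then have "a *\<^sub>R x + b *\<^sub>R y \<in> span {y}" using in_C *(4) by simp
    then have "(a *\<^sub>R x + b *\<^sub>R y) - b *\<^sub>R y \<in> span {y}" by (rule span_diff) (intro span_mul span_base, simp)
    then have "a *\<^sub>R x \<in> span {y}" by simp
    from span_mul[OF this, of "1 / a"] show False using nx nz by simp
  qed
  have ind: "independent {y, x}" using *(2) by (simp add: insert_commute)
  have CD: "C = span {b *\<^sub>R y + a *\<^sub>R x}" "D = span {d *\<^sub>R y + c *\<^sub>R x}"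
    unfolding *(5,6) by (subst add.commute, rule refl)+
  have ratio: "b * c \<noteq> 0" "-1 = (a * d) / (b * c)" unfolding bc using *(7) by simp_all
  show "has_cross_ratio B A C D (-1)"
    unfolding has_cross_ratio_def
    by (rule exI[of _ y], rule exI[of _ x], rule exI[of _ b], rule exI[of _ a], rule exI[of _ d], rule exI[of _ c])
      (intro conjI *(1)[symmetric] ind *(4,3) CD ratio)
qed

lemma separates_harmonically_swap:
  "separates_harmonically A f s s' \<Longrightarrow> separates_harmonically A f s' s"
  unfolding separates_harmonically_def using cross_ratio_harmonicD(3) by (metis Un_commute)

text \<open>A front has to name a hyperbolic space even if the surface is empty; this provides
  one.\<close>

lemma hyperboloid_nonempty:
  assumes "hyperbolic_frame p q"
  obtains y where "y \<in> r31 p q" "lip y y = -1"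
proof -
  have hf: "lip p p = -1" "lip q q = 1" "lip p q = 0" "lip q p = 0"
    using assms lip_commute[of q p] by (auto simp: hyperbolic_frame_def)
  \<comment> \<open>The negative part of p rotated by a right angle: orthogonal to p and of negative
    square. Removing its q component lowers the square further, as q has square 1.\<close>
  define w :: r42 where "w = (0, \<chi> i. if i = 1 then - (snd p $ 2) else snd p $ 1)"
  have wp: "lip w p = 0" by (simp add: w_def lip_def inner_vec_def sum_2)
  have "snd p \<noteq> 0"
  proof
    assume "snd p = 0"
    then have "lip p p \<ge> 0" by (simp add: lip_def)
    then show False using hf by simp
  qed
  then have "snd w \<noteq> 0" by (auto simp: w_def vec_eq_iff forall_2)
  then have ww: "lip w w < 0" by (simp add: lip_def w_def)
  define v where "v = w - lip w q *\<^sub>R q"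
  have v: "lip v p = 0" "lip v q = 0" "lip v v = lip w w - (lip w q)\<^sup>2"
    using hf wp lip_commute[of q w] by (simp_all add: v_def lip_simps power2_eq_square algebra_simps)
  then have neg: "lip v v < 0" using ww by (smt (verit) zero_le_power2)
  let ?y = "(1 / sqrt (- lip v v)) *\<^sub>R v"
  have "lip ?y ?y = -1" using neg by (simp add: lip_simps divide_simps)
  moreover have "?y \<in> r31 p q" using v by (simp add: r31_def lip_simps)
  ultimately show ?thesis using that by blast
qed

context atlas begin

text \<open>Prescribing the product with l singles out one vector in each null line, so g is global,
  and locally it is a smooth lift divided by its nonvanishing product with l.\<close>

lemma normalized_lift:
  assumes s: "sphere_congruence A s" and ne: "\<And>x. x \<in> points A \<Longrightarrow> \<exists>y\<in>s x. lip y l \<noteq> 0" and r: "r \<noteq> 0"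
  obtains g where "smooth_map A (points A) g" "\<And>x. x \<in> points A \<Longrightarrow> g x \<in> s x"
    "\<And>x. x \<in> points A \<Longrightarrow> lip (g x) l = r" "\<And>x. x \<in> points A \<Longrightarrow> s x = span {g x}"
proof -
  have sub: "subspace (s x)" if "x \<in> points A" for x
    using s that by (auto simp: sphere_congruence_def null_line_def)
  have "\<exists>y. y \<in> s x \<and> lip y l = r" if x: "x \<in> points A" for x
  proof -
    obtain y where y: "y \<in> s x" "lip y l \<noteq> 0" using ne[OF x] by blast
    then show ?thesis using subspace_scale[OF sub[OF x] y(1), of "r / lip y l"]
      by (intro exI[of _ "(r / lip y l) *\<^sub>R y"]) (auto simp: lip_simps)
  qed
  then obtain g where g: "\<And>x. x \<in> points A \<Longrightarrow> g x \<in> s x \<and> lip (g x) l = r" by metis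
  have loc: "\<exists>W. open W \<and> x \<in> W \<and> smooth_map A W g \<and> s x = span {g x}" if x: "x \<in> points A" for x
  proof -
    obtain V \<sigma> where V: "x \<in> V" "local_section A s V \<sigma>" "\<forall>y\<in>V. s y = span {\<sigma> y}"
      using s x unfolding sphere_congruence_def by blast
    then have oV: "open V" "V \<subseteq> points A" "smooth_map A V \<sigma>" by (auto simp: local_section_def)
    have eq: "g y = (r / lip (\<sigma> y) l) *\<^sub>R \<sigma> y \<and> lip (\<sigma> y) l \<noteq> 0" if "y \<in> V" for y
    proof -
      have gy: "g y \<in> span {\<sigma> y}" "lip (g y) l = r" using g[of y] V(3) that oV(2) by auto
      then obtain c where c: "g y = c *\<^sub>R \<sigma> y" by (auto simp: span_singleton)
      then have "c * lip (\<sigma> y) l = r" using gy(2) by (simp add: lip_simps)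
      then show ?thesis using c r by (auto simp: field_simps)
    qed
    have "smooth_map A V (\<lambda>y. (r * inverse (lip (\<sigma> y) l)) *\<^sub>R \<sigma> y)"
      by (intro smooth_map_scaleR smooth_map_bilinear[OF bounded_bilinear_mult] smooth_map_inverse smooth_map_lip
         smooth_map_const oV(1,3)) (use eq in blast)
    then have "smooth_map A V g"
      using smooth_map_cong[OF oV(1), of g "\<lambda>y. (r * inverse (lip (\<sigma> y) l)) *\<^sub>R \<sigma> y"] eq by (simp add: divide_inverse)
    moreover have "s x = span {g x}"
    proof -
      have "r / lip (\<sigma> x) l \<noteq> 0" using eq[OF V(1)] r by simp
      then show ?thesis using eq[OF V(1)] V(1,3) span_line_scale[of "r / lip (\<sigma> x) l" "\<sigma> x"] by simp
    qed
    ultimately show ?thesis using V(1) oV(1) by blast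
  qed
  show ?thesis
  proof (rule that)
    show "smooth_map A (points A) g" by (rule smooth_map_local) (use loc in blast)
  qed (use g loc in blast)+
qed

lemma flat_front_of_omega:
  assumes leg: "legendre_map A f" and umb: "umbilic_free A f" and iso: "isothermic A f s" "isothermic A f s'"
    and sep: "separates_harmonically A f s s'" and hf: "hyperbolic_frame p q"
    and touch: "touches_fixed A s (p + q)" "touches_fixed A s' (p - q)"
  shows "\<exists>F T. lift_of_flat_front A f p q F T"
proof -
  define k l where "k = p + q" and "l = p - q"
  have pq: "lip p p = -1" "lip q q = 1" "lip p q = 0" "lip q p = 0"
    using hf lip_commute[of q p] by (auto simp: hyperbolic_frame_def)
  have kl: "lip k k = 0" "lip l l = 0" "lip k l = -2" "lip l k = -2"
    using pq by (simp_all add: k_def l_def lip_simps)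
  have k0: "k \<noteq> 0" and l0: "l \<noteq> 0" using kl(3) by (auto simp: lip_simps)
  have sc: "sphere_congruence A s" "sphere_congruence A s'" using iso by (auto simp: isothermic_def)
  have fs: "f x = span (s x \<union> s' x)" if "x \<in> points A" for x
    using sep that by (auto simp: separates_harmonically_def)
  have ce: "contact_element (f x)" if "x \<in> points A" for x
    using leg that by (auto simp: legendre_map_def contact_congruence_def)
  \<comment> \<open>A curvature sphere that belongs to the pair would coincide with a member of the
    range it separates harmonically; a second curvature sphere exists because there are no
    umbilics.\<close>
  have nc: "\<not> curvature_sphere A f x (s x)" "\<not> curvature_sphere A f x (s' x)" if x: "x \<in> points A" for x
  proof -
    have other: "\<exists>S2. curvature_sphere A f x S2 \<and> S \<noteq> S2" for S
      using umb x unfolding umbilic_free_def by metis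
    have cr: "has_cross_ratio (s x) (s' x) S1 S2 (-1)" if "curvature_sphere A f x S1" "curvature_sphere A f x S2" "S1 \<noteq> S2" for S1 S2
      using sep x that unfolding separates_harmonically_def by blast
    show "\<not> curvature_sphere A f x (s x)" using other[of "s x"] cr cross_ratio_harmonicD(1) by blast
    show "\<not> curvature_sphere A f x (s' x)" using other[of "s' x"] cr cross_ratio_harmonicD(2) by blast
  qed
  have tk: "lip y k = 0" if "x \<in> points A" "y \<in> s x" for x y using touch(1) that by (auto simp: touches_fixed_def k_def)
  have tl: "lip y l = 0" if "x \<in> points A" "y \<in> s' x" for x y using touch(2) that by (auto simp: touches_fixed_def l_def)
  have perp_span: "lip y v = 0" if "y \<in> span (a \<union> b)" "\<And>u. u \<in> a \<Longrightarrow> lip u v = 0" "\<And>u. u \<in> b \<Longrightarrow> lip u v = 0"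
    for y v :: r42 and a b
  proof -
    have "subspace {y. lip y v = 0}" by (auto simp: subspace_def lip_simps)
    moreover have "a \<union> b \<subseteq> {y. lip y v = 0}" using that by auto
    ultimately show ?thesis using span_minimal that(1) by blast
  qed
  \<comment> \<open>s' touches l by assumption. If s did so at x, all of f x would, being spanned by
    the two.\<close>
  have ex_l: "\<exists>y\<in>s x. lip y l \<noteq> 0" if x: "x \<in> points A" for x
  proof (rule ccontr)
    assume no: "\<not> ?thesis"
    obtain y where "y \<in> f x" "lip y l \<noteq> 0"
      by (rule not_touched_identically[OF leg umb iso(2) touch(2)[folded l_def] l0 kl(2) nc(2) x])
    then show False using perp_span[of y "s x" "s' x" l] no tl[OF x] fs[OF x] by blast
  qed
  have ex_k: "\<exists>y\<in>s' x. lip y k \<noteq> 0" if x: "x \<in> points A" for x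
  proof (rule ccontr)
    assume no: "\<not> ?thesis"
    obtain y where "y \<in> f x" "lip y k \<noteq> 0"
      by (rule not_touched_identically[OF leg umb iso(1) touch(1)[folded k_def] k0 kl(1) nc(1) x])
    then show False using perp_span[of y "s x" "s' x" k] no tk[OF x] fs[OF x] by blast
  qed
  \<comment> \<open>The products -2 with l here and 2 with k for h are those of k + P and N - l, so
    that g - k and h + l complete k, l to a null frame.\<close>
  obtain g where g: "smooth_map A (points A) g" "\<And>x. x \<in> points A \<Longrightarrow> g x \<in> s x"
    "\<And>x. x \<in> points A \<Longrightarrow> lip (g x) l = -2" "\<And>x. x \<in> points A \<Longrightarrow> s x = span {g x}"
    using normalized_lift[OF sc(1) ex_l, of "-2"] by auto
  obtain h where h: "smooth_map A (points A) h" "\<And>x. x \<in> points A \<Longrightarrow> h x \<in> s' x"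
    "\<And>x. x \<in> points A \<Longrightarrow> lip (h x) k = 2" "\<And>x. x \<in> points A \<Longrightarrow> s' x = span {h x}"
    using normalized_lift[OF sc(2) ex_k, of 2] by auto
  define P N where "P x = g x - k" and "N x = h x + l" for x
  have gh: "g x \<in> f x" "h x \<in> f x" if x: "x \<in> points A" for x
    unfolding fs[OF x] using g(2)[OF x] h(2)[OF x] by (auto intro: span_base)
  have sec: "local_section A f (points A) g" "local_section A f (points A) h"
    unfolding local_section_def using g(1) h(1) gh open_points by auto
  have f_eq: "f x = span {g x, h x}" if x: "x \<in> points A" for x
    unfolding fs[OF x] g(4)[OF x] h(4)[OF x] by (rule span_Un_lines)
  interpret nm: null_map A k l P N f
  proof
    show "smooth_map A (points A) P" "smooth_map A (points A) N"
      unfolding P_def[abs_def] N_def[abs_def] by (intro smooth_map_diff smooth_map_add smooth_map_const open_points g(1) h(1))+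
    show "f x = span {k + P x, N x - l}" if "x \<in> points A" for x using f_eq[OF that] by (simp add: P_def N_def)
    show "legendre_map A f" by (rule leg)
    show "null_frame k l (P x) (N x)" if x: "x \<in> points A" for x
    proof -
      have "lip a b = 0" if "a \<in> f x" "b \<in> f x" for a b using ce[OF x] that by (auto simp: contact_element_def)
      then have "lip (g x) (g x) = 0" "lip (h x) (h x) = 0" "lip (g x) (h x) = 0" "lip (h x) (g x) = 0" using gh[OF x] by auto
      then show ?thesis
        using kl g(3)[OF x] h(3)[OF x] tk[OF x g(2)[OF x]] tl[OF x h(2)[OF x]]
          lip_commute[of k "g x"] lip_commute[of l "g x"] lip_commute[of k "h x"] lip_commute[of l "h x"]
        by (simp add: null_frame_def P_def N_def lip_simps)
    qed
    show "lip (dmap c P x \<xi>) (N x) = 0" if c: "c \<in> A" "x \<in> dom_c c" for c x \<xi>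
    proof -
      have x: "x \<in> points A" using dom_points[OF c] .
      have "dmap c P x \<xi> = dmap c g x \<xi>"
        unfolding P_def[abs_def] dmap_diff[OF g(1) smooth_map_const[OF open_points] c x] by (simp add: dmap_const)
      moreover have "lip (dmap c g x \<xi>) (h x) = 0"
        using leg sec c x unfolding legendre_map_def contact_condition_def by blast
      moreover have "lip (dmap c g x \<xi>) l = 0"
        using dmap_lip_const[OF open_points g(1) smooth_map_const[OF open_points] g(3) c x, of \<xi>] by (simp add: dmap_const lip_simps)
      ultimately show ?thesis by (simp add: N_def lip_simps)
    qed
  qed
  have kP: "span {k + P x} = s x" "span {N x - l} = s' x" if "x \<in> points A" for x
    using g(4)[OF that] h(4)[OF that] by (simp_all add: P_def N_def)
  have "separates_harmonically A f nm.sphere_k nm.sphere_l"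
    using sep kP unfolding separates_harmonically_def by auto
  then have flat: nm.parallel_flat by (rule nm.parallel_flat_if_harmonic[OF umb])
  let ?F = nm.base_front and ?T = nm.base_normal
  have lift: "f x = legendre_lift p q ?F ?T x" if x: "x \<in> points A" for x
  proof -
    have FT: "?F x + ?T x = P x" "?F x - ?T x = N x"
      using half_sum_diff[of "P x" "N x"] by (simp_all add: nm.base_front_def nm.base_normal_def)
    have "span {q + ?F x, p + ?T x} = span {(q + ?F x) + (p + ?T x), (q + ?F x) - (p + ?T x)}" by (rule span_sum_diff)
    moreover have "(q + ?F x) + (p + ?T x) = k + P x" "(q + ?F x) - (p + ?T x) = N x - l"
      unfolding FT[symmetric] k_def l_def by simp_all
    ultimately show ?thesis unfolding nm.f[OF x] legendre_lift_def by metis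
  qed
  have vals: "lip (?F x) (?F x) = -1" "lip (?T x) (?T x) = 1" "lip (?T x) (?F x) = 0"
    "lip (?F x) p = 0" "lip (?F x) q = 0" "lip (?T x) p = 0" "lip (?T x) q = 0" if x: "x \<in> points A" for x
  proof -
    note n = nm.nf[OF x] null_frame_comm[OF nm.nf[OF x]]
    have p: "p = (1/2) *\<^sub>R (k + l)" "q = (1/2) *\<^sub>R (k - l)"
      unfolding k_def l_def by (simp_all flip: scaleR_2)
    show "lip (?F x) (?F x) = -1" "lip (?T x) (?T x) = 1" "lip (?T x) (?F x) = 0"
      using n by (simp_all add: nm.base_front_def nm.base_normal_def null_frame_def lip_simps)
    show "lip (?F x) p = 0" "lip (?F x) q = 0" "lip (?T x) p = 0" "lip (?T x) q = 0"
      unfolding p using n by (simp_all add: nm.base_front_def nm.base_normal_def null_frame_def lip_simps)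
  qed
  have smFT: "smooth_map A (points A) ?F" "smooth_map A (points A) ?T"
    unfolding nm.base_front_def[abs_def] nm.base_normal_def[abs_def]
    by (intro smooth_map_linear[OF bounded_linear_scaleR_right] smooth_map_add smooth_map_diff open_points nm.smP nm.smN)+
  have "Defs.front A p q ?F ?T"
    unfolding Defs.front_def
  proof (intro conjI hf smFT ballI allI)
    let ?Q = "{y \<in> r31 p q. lip y y = -1}"
    have FQ: "?F ` points A \<subseteq> ?Q" using vals by (auto simp: r31_def)
    \<comment> \<open>The image of the connected surface lies in one component of the hyperboloid;
      for the empty surface any component will do.\<close>
    obtain y0 where y0: "y0 \<in> ?Q" "?F ` points A \<subseteq> connected_component_set ?Q y0"
    proof (cases "points A = {}")
      case True
      obtain y where "y \<in> r31 p q" "lip y y = -1" by (rule hyperboloid_nonempty[OF hf])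
      then show ?thesis using that[of y] True by simp
    next
      case False
      then obtain x where x: "x \<in> points A" by blast
      have "connected (?F ` points A)"
        by (rule connected_continuous_image[OF smooth_map_continuous[OF smFT(1) open_points order_refl] connected])
      then have "?F ` points A \<subseteq> connected_component_set ?Q (?F x)"
        using x FQ by (intro connected_component_maximal) auto
      then show ?thesis using that[of "?F x"] x FQ by blast
    qed
    then show "\<exists>H\<in>hyperbolic_spaces p q. \<forall>x\<in>points A. ?F x \<in> H"
      unfolding hyperbolic_spaces_def components_def by blast
    show "?T x \<in> de_sitter p q" "lip (?T x) (?F x) = 0" if "x \<in> points A" for x
      using vals[OF that] by (auto simp: de_sitter_def r31_def)
    show "lip (?T x) (dmap c ?F x \<xi>) = 0" if c: "c \<in> A" "x \<in> dom_c c" for c x \<xi>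
    proof -
      have x: "x \<in> points A" using dom_points[OF c] .
      have d: "dmap c ?F x \<xi> = (1/2) *\<^sub>R (dmap c P x \<xi> + dmap c N x \<xi>)"
        unfolding nm.base_front_def[abs_def]
          dmap_scale[OF smooth_map_add[OF open_points nm.smP nm.smN] c x] dmap_add[OF nm.smP nm.smN c x] ..
      have "lip (dmap c ?F x \<xi>) (?T x) = 0"
        using nm.perp_dmap[OF c, of \<xi>] unfolding d nm.base_normal_def frame_perp_def by (simp add: lip_simps)
      then show ?thesis by (simp add: lip_commute)
    qed
    show "legendre_map A (legendre_lift p q ?F ?T)" by (rule legendre_map_cong[OF lift leg])
  qed
  moreover have "umbilic_free A (legendre_lift p q ?F ?T)" by (rule umbilic_free_cong[OF lift umb])
  ultimately have "flat_front A p q ?F ?T"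
    using flat unfolding flat_front_def nm.parallel_flat_def by blast
  then show ?thesis using lift unfolding lift_of_flat_front_def by blast
qed

lemma touches_fixed_span:
  assumes "span {k} = span {k'}" "touches_fixed A s k'"
  shows "touches_fixed A s k"
proof -
  obtain r where "k = r *\<^sub>R k'" using span_line_eqE[OF assms(1)] .
  then show ?thesis using assms(2) by (simp add: touches_fixed_def lip_simps)
qed

text \<open>The infinity spheres form an unordered pair, so p - q may belong to a; then s and s' are
  exchanged, which preserves harmonic separation.\<close>

lemma flat_front_of_omega_touching:
  assumes om: "omega_touching A f s s' a b" and hf: "hyperbolic_frame p q" and inf: "infinity_spheres p q = {span {a}, span {b}}"
  shows "\<exists>F T. lift_of_flat_front A f p q F T"
proof -
  have *: "legendre_map A f" "umbilic_free A f" "isothermic A f s" "isothermic A f s'" "separates_harmonically A f s s'"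
    "touches_fixed A s a" "touches_fixed A s' b"
    using om by (auto simp: omega_touching_def omega_surface_def omega_pair_def)
  from inf consider "span {p + q} = span {a}" "span {p - q} = span {b}" | "span {p + q} = span {b}" "span {p - q} = span {a}"
    unfolding infinity_spheres_def doubleton_eq_iff by blast
  then show ?thesis
  proof cases
    case 1
    show ?thesis
      by (rule flat_front_of_omega[OF *(1-5) hf touches_fixed_span[OF 1(1) *(6)] touches_fixed_span[OF 1(2) *(7)]])
  next
    case 2
    show ?thesis
      by (rule flat_front_of_omega[OF *(1,2,4,3) separates_harmonically_swap[OF *(5)] hf
        touches_fixed_span[OF 2(1) *(7)] touches_fixed_span[OF 2(2) *(6)]])
  qed
qed

end

section \<open>The point sphere complex and parallel fronts\<close>

lemma frame_of_spheres:
  assumes "sphere_vector a" "sphere_vector b" "lip a b \<noteq> 0"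
  obtains p q where "hyperbolic_frame p q" "infinity_spheres p q = {span {a}, span {b}}"
proof -
  \<comment> \<open>Scales b to have product -2 with a; the span of b, and thus the infinity sphere,
    is unaffected.\<close>
  let ?r = "-2 / lip a b"
  let ?p = "(1/2) *\<^sub>R (a + ?r *\<^sub>R b)" and ?q = "(1/2) *\<^sub>R (a - ?r *\<^sub>R b)"
  have "hyperbolic_frame ?p ?q"
    using assms lip_commute[of b a] by (simp add: hyperbolic_frame_def sphere_vector_def lip_simps)
  moreover have "?p + ?q = a" "?p - ?q = ?r *\<^sub>R b"
  proof -
    have "?p + ?q = a" by (rule half_sum_diff(1))
    moreover have "?p - ?q = ?r *\<^sub>R b" by (rule half_sum_diff(2))
    ultimately show "?p + ?q = a" "?p - ?q = ?r *\<^sub>R b" .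
  qed
  then have "infinity_spheres ?p ?q = {span {a}, span {b}}"
    unfolding infinity_spheres_def using span_line_scale[of ?r b] assms(3) by simp
  ultimately show ?thesis by (rule that)
qed

text \<open>The null vectors p' + q' and p' - q' are multiples of p + q and p - q in some order.
  Both pairs have product -2, so the factors are reciprocal: \<delta> exp t and \<delta> exp (- t).
  The exchanged order reverses the sign of q', which accounts for \<epsilon> = - \<delta>.\<close>

lemma frames_parallel:
  assumes hf: "hyperbolic_frame p q" "hyperbolic_frame p' q'" and inf: "infinity_spheres p q = infinity_spheres p' q'"
  obtains t \<epsilon> \<delta> :: real where "\<epsilon> \<in> {1, -1}" "\<delta> \<in> {1, -1}"
    "p' = \<delta> *\<^sub>R (cosh t *\<^sub>R p + sinh t *\<^sub>R q)" "q' = \<epsilon> *\<^sub>R (sinh t *\<^sub>R p + cosh t *\<^sub>R q)"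
proof -
  have l2: "lip (p + q) (p - q) = -2" "lip (p - q) (p + q) = -2" if "hyperbolic_frame p q" for p q
    using that lip_commute[of q p] by (simp_all add: hyperbolic_frame_def lip_simps)
  have half: "p' = (1/2) *\<^sub>R ((p' + q') + (p' - q'))" "q' = (1/2) *\<^sub>R ((p' + q') - (p' - q'))"
    by (simp_all flip: scaleR_2)
  have sg: "\<exists>t \<delta>. \<delta> \<in> {1, -1} \<and> x = \<delta> * exp t \<and> y = \<delta> * exp (- t)" if "x * y = 1" for x y :: real
  proof (intro exI conjI)
    have x: "x \<noteq> 0" using that by auto
    show "sgn x \<in> {1, -1}" using x by (auto simp: sgn_if)
    show "x = sgn x * exp (ln \<bar>x\<bar>)" using x by (simp add: sgn_mult_abs)
    have "sgn x * exp (- ln \<bar>x\<bar>) = 1 / x" using x by (auto simp: exp_minus sgn_if field_simps)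
    also have "\<dots> = y" using that x by (simp add: field_simps)
    finally show "y = sgn x * exp (- ln \<bar>x\<bar>)" by simp
  qed
  have ch: "(1/2) *\<^sub>R ((\<delta> * exp t) *\<^sub>R (p + q) + (\<delta> * exp (- t)) *\<^sub>R (p - q)) = \<delta> *\<^sub>R (cosh t *\<^sub>R p + sinh t *\<^sub>R q)"
    "(1/2) *\<^sub>R ((\<delta> * exp t) *\<^sub>R (p + q) - (\<delta> * exp (- t)) *\<^sub>R (p - q)) = \<delta> *\<^sub>R (sinh t *\<^sub>R p + cosh t *\<^sub>R q)" for t \<delta>
    by (simp_all add: cosh_field_def sinh_field_def algebra_simps add_divide_distrib diff_divide_distrib)
  from inf consider "span {p' + q'} = span {p + q}" "span {p' - q'} = span {p - q}"
    | "span {p' + q'} = span {p - q}" "span {p' - q'} = span {p + q}"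
    unfolding infinity_spheres_def doubleton_eq_iff by metis
  then show ?thesis
  proof cases
    case 1
    obtain x where x: "p' + q' = x *\<^sub>R (p + q)" by (rule span_line_eqE[OF 1(1)])
    obtain y where y: "p' - q' = y *\<^sub>R (p - q)" by (rule span_line_eqE[OF 1(2)])
    have "x * y = 1" using l2(1)[OF hf(2)] l2(1)[OF hf(1)] unfolding x y by (simp only: lip.scaleR_left lip.scaleR_right real_scaleR_def) (simp add: mult.commute)
    then obtain t \<delta> where t: "\<delta> \<in> {1, -1}" "x = \<delta> * exp t" "y = \<delta> * exp (- t)" using sg by blast
    show ?thesis
    proof (rule that[OF t(1,1)])
      show "p' = \<delta> *\<^sub>R (cosh t *\<^sub>R p + sinh t *\<^sub>R q)" using half(1) unfolding x y t(2,3) ch .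
      show "q' = \<delta> *\<^sub>R (sinh t *\<^sub>R p + cosh t *\<^sub>R q)" using half(2) unfolding x y t(2,3) ch .
    qed
  next
    case 2
    obtain x where x: "p' + q' = x *\<^sub>R (p - q)" by (rule span_line_eqE[OF 2(1)])
    obtain y where y: "p' - q' = y *\<^sub>R (p + q)" by (rule span_line_eqE[OF 2(2)])
    have "y * x = 1" using l2(1)[OF hf(2)] l2(2)[OF hf(1)] unfolding x y by (simp only: lip.scaleR_left lip.scaleR_right real_scaleR_def)
    then obtain t \<delta> where t: "\<delta> \<in> {1, -1}" "y = \<delta> * exp t" "x = \<delta> * exp (- t)" using sg by blast
    show ?thesis
    proof (rule that[of "- \<delta>" \<delta>])
      show "- \<delta> \<in> {1, -1}" "\<delta> \<in> {1, -1}" using t(1) by auto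
      have p: "p' = (1/2) *\<^sub>R (y *\<^sub>R (p + q) + x *\<^sub>R (p - q))" using half(1) unfolding x y by (simp only: add.commute)
      show "p' = \<delta> *\<^sub>R (cosh t *\<^sub>R p + sinh t *\<^sub>R q)" using p unfolding t(2,3) ch .
      have "q' = - ((1/2) *\<^sub>R (y *\<^sub>R (p + q) - x *\<^sub>R (p - q)))"
        using half(2) unfolding x y by (simp only: minus_diff_eq scaleR_minus_right[symmetric])
      then show "q' = (- \<delta>) *\<^sub>R (sinh t *\<^sub>R p + cosh t *\<^sub>R q)" unfolding t(2,3) ch scaleR_minus_left .
    qed
  qed
qed

lemma (in atlas) front_values:
  assumes "front A p q F T" "x \<in> points A"
  shows "lip (F x) p = 0" "lip (F x) q = 0" "lip (T x) p = 0" "lip (T x) q = 0"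
proof -
  obtain H where "H \<in> hyperbolic_spaces p q" "F x \<in> H" using assms by (auto simp: front_def)
  then have "F x \<in> {y \<in> r31 p q. lip y y = -1}" using in_components_subset unfolding hyperbolic_spaces_def by blast
  moreover have "T x \<in> de_sitter p q" using assms by (auto simp: front_def)
  ultimately show "lip (F x) p = 0" "lip (F x) q = 0" "lip (T x) p = 0" "lip (T x) q = 0"
    by (auto simp: r31_def de_sitter_def)
qed

text \<open>The contact element f x projects bijectively onto the plane of p and q, so F' x is
  determined as the remaining component of the vector of f x that lies over q', and T' x likewise
  over p'.\<close>

lemma (in atlas) flat_fronts_parallel:
  assumes l1: "lift_of_flat_front A f p q F T" and l2: "lift_of_flat_front A f p' q' F' T'"
    and inf: "infinity_spheres p q = infinity_spheres p' q'"
  shows "parallel_related A p q F T p' q' F' T'"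
proof -
  have fr: "front A p q F T" "front A p' q' F' T'" using l1 l2 by (auto simp: lift_of_flat_front_def flat_front_def)
  then have hf: "hyperbolic_frame p q" "hyperbolic_frame p' q'" by (auto simp: front_def)
  obtain t \<epsilon> \<delta> :: real where ed: "\<epsilon> \<in> {1, -1}" "\<delta> \<in> {1, -1}"
    and p': "p' = \<delta> *\<^sub>R (cosh t *\<^sub>R p + sinh t *\<^sub>R q)" and q': "q' = \<epsilon> *\<^sub>R (sinh t *\<^sub>R p + cosh t *\<^sub>R q)"
    by (rule frames_parallel[OF hf inf])
  have pq: "lip p p = -1" "lip q q = 1" "lip p q = 0" "lip q p = 0"
    using hf(1) lip_commute[of q p] by (auto simp: hyperbolic_frame_def)
  have "F' x = \<epsilon> *\<^sub>R par_front t F T x \<and> T' x = \<delta> *\<^sub>R par_normal t F T x" if x: "x \<in> points A" for x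
  proof -
    have span: "span {q + F x, p + T x} = span {q' + F' x, p' + T' x}"
      using l1 l2 x by (auto simp: lift_of_flat_front_def legendre_lift_def)
    \<comment> \<open>p' and q' arise from p and q by a hyperbolic rotation up to signs, whose
      determinant cosh^2 - sinh^2 = 1 allows it to be inverted.\<close>
    have perp: "lip w p = 0 \<and> lip w q = 0" if "lip w p' = 0" "lip w q' = 0" for w
    proof -
      have "cosh t * lip w p + sinh t * lip w q = 0" "sinh t * lip w p + cosh t * lip w q = 0"
        using that ed unfolding p' q' by (auto simp: lip_simps)
      moreover have "cosh t * cosh t - sinh t * sinh t = (1::real)"
        using hyperbolic_pythagoras[of t] by (simp add: power2_eq_square)
      ultimately have "lip w p = 0" "lip w q = 0" by algebra+
      then show ?thesis by blast
    qed
    note v = front_values[OF fr(1) x] and v' = front_values[OF fr(2) x]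
    have F'p: "lip (F' x) p = 0" "lip (F' x) q = 0" and T'p: "lip (T' x) p = 0" "lip (T' x) q = 0"
      using perp[OF v'(1,2)] perp[OF v'(3,4)] by auto
    \<comment> \<open>Here u is the component of a vector of f x in the plane of p and q, and w the
      one orthogonal to this plane. Pairing with q and p gives the coefficients, with a sign at p
      because p has square -1.\<close>
    have combo: "w = lip u q *\<^sub>R F x - lip u p *\<^sub>R T x"
      if mem: "u + w \<in> span {q + F x, p + T x}" and "lip w p = 0" "lip w q = 0" "u = lip u q *\<^sub>R q - lip u p *\<^sub>R p" for u w
    proof -
      obtain a b where ab: "u + w = a *\<^sub>R (q + F x) + b *\<^sub>R (p + T x)" by (rule span_pairE[OF mem])
      have "lip (u + w) q = a" "lip (u + w) p = - b" unfolding ab using pq v by (simp_all add: lip_simps)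
      then have a: "a = lip u q" and b: "b = - lip u p" using that(2,3) by (simp_all add: lip_simps)
      have "u + w = (a *\<^sub>R q + b *\<^sub>R p) + (a *\<^sub>R F x + b *\<^sub>R T x)"
        using ab by (simp add: algebra_simps)
      moreover have "a *\<^sub>R q + b *\<^sub>R p = u" using that(4) by (simp add: a b)
      ultimately have "w = a *\<^sub>R F x + b *\<^sub>R T x" by simp
      then show ?thesis by (simp add: a b)
    qed
    have q'v: "lip q' q = \<epsilon> * cosh t" "lip q' p = - (\<epsilon> * sinh t)" and p'v: "lip p' q = \<delta> * sinh t" "lip p' p = - (\<delta> * cosh t)"
      unfolding p' q' using pq by (simp_all add: lip_simps)
    have "F' x = lip q' q *\<^sub>R F x - lip q' p *\<^sub>R T x"
    proof (rule combo[OF _ F'p])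
      show "q' + F' x \<in> span {q + F x, p + T x}" unfolding span by (simp add: span_base)
      show "q' = lip q' q *\<^sub>R q - lip q' p *\<^sub>R p" unfolding q'v by (simp add: q' algebra_simps)
    qed
    moreover have "T' x = lip p' q *\<^sub>R F x - lip p' p *\<^sub>R T x"
    proof (rule combo[OF _ T'p])
      show "p' + T' x \<in> span {q + F x, p + T x}" unfolding span by (simp add: span_base)
      show "p' = lip p' q *\<^sub>R q - lip p' p *\<^sub>R p" unfolding p'v by (simp add: p' algebra_simps)
    qed
    ultimately show ?thesis
      unfolding q'v p'v by (simp add: par_front_def par_normal_def algebra_simps)
  qed
  then show ?thesis unfolding parallel_related_def using ed p' q' by blast
qed

theorem mainTheorem1:
  fixes A :: "'m::{t2_space,second_countable_topology} chart set"
    and f :: "'m \<Rightarrow> r42 set"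
  assumes "surface A"
  shows
    "((\<exists>p q F T. lift_of_flat_front A f p q F T) \<longleftrightarrow>
        (\<exists>s\<^sub>p s\<^sub>m q\<^sub>p q\<^sub>m. omega_touching A f s\<^sub>p s\<^sub>m q\<^sub>p q\<^sub>m)) \<and>
     (\<forall>p q F T. lift_of_flat_front A f p q F T \<longrightarrow>
        (\<exists>s\<^sub>p s\<^sub>m. omega_touching A f s\<^sub>p s\<^sub>m (p + q) (p - q))) \<and>
     (\<forall>s\<^sub>p s\<^sub>m q\<^sub>p q\<^sub>m. omega_touching A f s\<^sub>p s\<^sub>m q\<^sub>p q\<^sub>m \<longrightarrow>
        (\<exists>p q. hyperbolic_frame p q \<and> infinity_spheres p q = {span {q\<^sub>p}, span {q\<^sub>m}}) \<and>
        (\<forall>p q. hyperbolic_frame p q \<and> infinity_spheres p q = {span {q\<^sub>p}, span {q\<^sub>m}} \<longrightarrow>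
           (\<exists>F T. lift_of_flat_front A f p q F T)) \<and>
        (\<forall>p q F T p' q' F' T'.
           lift_of_flat_front A f p q F T \<and> infinity_spheres p q = {span {q\<^sub>p}, span {q\<^sub>m}} \<and>
           lift_of_flat_front A f p' q' F' T' \<and> infinity_spheres p' q' = {span {q\<^sub>p}, span {q\<^sub>m}} \<longrightarrow>
           parallel_related A p q F T p' q' F' T'))"
proof -
  interpret atlas A by unfold_locales (rule assms)
  have frame: "\<exists>p q. hyperbolic_frame p q \<and> infinity_spheres p q = {span {a}, span {b}}"
    if "omega_touching A f s s' a b" for s s' a b
    using that frame_of_spheres[of a b] unfolding omega_touching_def by metis
  have 1: "\<forall>p q F T. lift_of_flat_front A f p q F T \<longrightarrow> (\<exists>s\<^sub>p s\<^sub>m. omega_touching A f s\<^sub>p s\<^sub>m (p + q) (p - q))"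
    using flat_front_omega by blast
  have 2: "\<exists>F T. lift_of_flat_front A f p q F T"
    if "omega_touching A f s s' a b" "hyperbolic_frame p q" "infinity_spheres p q = {span {a}, span {b}}" for s s' a b p q
    by (rule flat_front_of_omega_touching[OF that])
  have 3: "parallel_related A p q F T p' q' F' T'"
    if "lift_of_flat_front A f p q F T" "infinity_spheres p q = {span {a}, span {b}}"
      "lift_of_flat_front A f p' q' F' T'" "infinity_spheres p' q' = {span {a}, span {b}}" for p q F T p' q' F' T' and a b :: r42
    using flat_fronts_parallel[OF that(1,3)] that(2,4) by simp
  show ?thesis
  proof (intro conjI allI impI)
    show "(\<exists>p q F T. lift_of_flat_front A f p q F T) \<longleftrightarrow> (\<exists>s\<^sub>p s\<^sub>m q\<^sub>p q\<^sub>m. omega_touching A f s\<^sub>p s\<^sub>m q\<^sub>p q\<^sub>m)"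
    proof
      assume "\<exists>p q F T. lift_of_flat_front A f p q F T"
      then show "\<exists>s\<^sub>p s\<^sub>m q\<^sub>p q\<^sub>m. omega_touching A f s\<^sub>p s\<^sub>m q\<^sub>p q\<^sub>m" using 1 by blast
    next
      assume "\<exists>s\<^sub>p s\<^sub>m q\<^sub>p q\<^sub>m. omega_touching A f s\<^sub>p s\<^sub>m q\<^sub>p q\<^sub>m"
      then obtain s s' a b where om: "omega_touching A f s s' a b" by blast
      with frame obtain p q where "hyperbolic_frame p q" "infinity_spheres p q = {span {a}, span {b}}" by blast
      from 2[OF om this] show "\<exists>p q F T. lift_of_flat_front A f p q F T" by blast
    qed
  next
    fix s s' :: "'m \<Rightarrow> r42 set" and a b
    assume om: "omega_touching A f s s' a b"
    show "\<exists>p q. hyperbolic_frame p q \<and> infinity_spheres p q = {span {a}, span {b}}" by (rule frame[OF om])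
    show "\<exists>F T. lift_of_flat_front A f p q F T"
      if "hyperbolic_frame p q \<and> infinity_spheres p q = {span {a}, span {b}}" for p q
      using 2[OF om] that by blast
    show "parallel_related A p q F T p' q' F' T'"
      if "lift_of_flat_front A f p q F T \<and> infinity_spheres p q = {span {a}, span {b}} \<and>
        lift_of_flat_front A f p' q' F' T' \<and> infinity_spheres p' q' = {span {a}, span {b}}" for p q F T p' q' F' T'
      using 3[of p q F T a b p' q' F' T'] that by simp
  qed (use 1 in blast)
qed

end
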